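(* Let $n\ge 1$. For $1\leq i\leq n$, let $G_i$ be a non-elementary, finitely generated group acting properly discontinuously and cocompactly by isometries on a proper, based, geodesic metric space $(\mathcal{X}_i,d_i,o_i)$ with a strongly contracting element. Let $G=G_1\times\cdots\times G_n$, let $\mathcal{X}=\mathcal{X}_1\times\cdots\times\mathcal{X}_n$ with base point $o=(o_1,\dots,o_n)$, and let $d$ be the $L^p$ metric on $\mathcal{X}$ for some $1\le p\le\infty$. Let $G$ act on $\mathcal{X}$ coordinate-wise. Then the action of $G$ on $(\mathcal{X},d)$ is growth tight unless $p=1$ and $n>1$; that is, it is growth tight if $p>1$ or $n=1$, and it is not growth tight if $p=1$ and $n>1$.
   Context: A group is elementary if it is finite or has an infinite cyclic subgroup of finite index; non-elementary means not elementary. Strongly contracting elements. Let $(X,d)$ be a proper geodesic metric space. For a subset $A\subset X$ and $C>0$, a map $\pi_A\colon X\to A$ is a $C$-strongly contracting projection if (i) $d(a,\pi_A(a))\le C$ for every $a\in A$, and (ii) for all $x,y\in X$ with $d(\pi_A(x),\pi_A(y))>C$, every geodesic segment $P$ with endpoints $x$ and $y$ satisfies $d(\pi_A(x),P)\le C$ and $d(\pi_A(y),P)\le C$. Let $G$ be a finitely generated group acting properly discontinuously, cocompactly and by isometries on $X$, with base point $o\in X$. An element $h\in G$ is $C$-strongly contracting if $i\mapsto h^i.o$ ($i\in\mathbb{Z}$) is a quasi-geodesic and for every geodesic segment $P$ with endpoints on $\langle h\rangle.o$ there is a $C$-strongly contracting projection $\pi_P\colon X\to P$. It is strongly contracting if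 it is $C$-strongly contracting for some $C>0$. "Acting with a strongly contracting element" means that the group contains a strongly contracting element for the action. $L^p$ metric. For $1\le p<\infty$, $d^p(x,y)=\left(\sum_{i=1}^n d_i(x_i,y_i)^p\right)^{1/p}$, and $d^\infty(x,y)=\max_i d_i(x_i,y_i)$. Growth. For a set $A$ with a pseudo-metric $d$ and base point $a_0\in A$, the growth exponent is $\delta_{A,d}=\limsup_{r\to\infty}\frac1r\log\#\{a\in A\mid d(a_0,a)\le r\}$ (independent of the base point). If $G$ acts properly discontinuously and cocompactly by isometries on a proper based geodesic metric space $(X,d,o)$ and $N$ is a normal subgroup of $G$, then $G/N$ carries the left invariant pseudo-metric $\bar d(gN,g'N)=\min_{n,n'\in N}d(gn.o,g'n'.o)$. Write $\delta_{G/N}=\delta_{G/N,\bar d}$ and $\delta_G=\delta_{G/\{1\}}$. The action is growth tight if $\delta_G>\delta_{G/N}$ for every infinite normal subgroup $N$ of $G$. *)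

theory Defs
  imports
    "HOL-Analysis.Analysis"
    "HOL-Algebra.Group_Action"
    "HOL-Algebra.Generated_Groups"
    "HOL-Algebra.Product_Groups"
begin

section \<open>Groups\<close>

definition finitely_generated_group :: "('g, 'm) monoid_scheme \<Rightarrow> bool" where
  "finitely_generated_group G \<longleftrightarrow>
     group G \<and> (\<exists>S. finite S \<and> S \<subseteq> carrier G \<and> generate G S = carrier G)"

definition elementary_group :: "('g, 'm) monoid_scheme \<Rightarrow> bool" where
  "elementary_group G \<longleftrightarrow>
     finite (carrier G) \<or>
     (\<exists>x\<in>carrier G. infinite (generate G {x}) \<and> finite (rcosets\<^bsub>G\<^esub> (generate G {x})))"

section \<open>Proper geodesic metric spaces\<close>

definition proper_metric_space :: "'x set \<Rightarrow> ('x \<Rightarrow> 'x \<Rightarrow> real) \<Rightarrow> bool" where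
  "proper_metric_space X d \<longleftrightarrow>
     Metric_space X d \<and>
     (\<forall>x\<in>X. \<forall>r. compactin (Metric_space.mtopology X d) (Metric_space.mcball X d x r))"

text \<open>A geodesic segment is a subset of the space: the image of an isometric embedding of a
  compact interval.\<close>

definition geodesic_segment ::
    "'x set \<Rightarrow> ('x \<Rightarrow> 'x \<Rightarrow> real) \<Rightarrow> 'x \<Rightarrow> 'x \<Rightarrow> 'x set \<Rightarrow> bool" where
  "geodesic_segment X d x y P \<longleftrightarrow>
     (\<exists>(\<gamma> :: real \<Rightarrow> 'x) L. 0 \<le> L \<and> \<gamma> ` {0..L} \<subseteq> X \<and>
        (\<forall>s\<in>{0..L}. \<forall>t\<in>{0..L}. d (\<gamma> s) (\<gamma> t) = \<bar>s - t\<bar>) \<and>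
        \<gamma> 0 = x \<and> \<gamma> L = y \<and> P = \<gamma> ` {0..L})"

definition geodesic_metric_space :: "'x set \<Rightarrow> ('x \<Rightarrow> 'x \<Rightarrow> real) \<Rightarrow> bool" where
  "geodesic_metric_space X d \<longleftrightarrow>
     Metric_space X d \<and> (\<forall>x\<in>X. \<forall>y\<in>X. \<exists>P. geodesic_segment X d x y P)"

definition dist_to_set :: "('x \<Rightarrow> 'x \<Rightarrow> real) \<Rightarrow> 'x \<Rightarrow> 'x set \<Rightarrow> real" where
  "dist_to_set d x P = (INF p\<in>P. d x p)"

section \<open>Actions\<close>

definition isometric_action ::
    "('g, 'm) monoid_scheme \<Rightarrow> 'x set \<Rightarrow> ('x \<Rightarrow> 'x \<Rightarrow> real) \<Rightarrow> ('g \<Rightarrow> 'x \<Rightarrow> 'x) \<Rightarrow> bool" where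
  "isometric_action G X d \<phi> \<longleftrightarrow>
     group_action G X \<phi> \<and>
     (\<forall>g\<in>carrier G. \<forall>x\<in>X. \<forall>y\<in>X. d (\<phi> g x) (\<phi> g y) = d x y)"

definition properly_discontinuous ::
    "('g, 'm) monoid_scheme \<Rightarrow> 'x set \<Rightarrow> ('x \<Rightarrow> 'x \<Rightarrow> real) \<Rightarrow> ('g \<Rightarrow> 'x \<Rightarrow> 'x) \<Rightarrow> bool" where
  "properly_discontinuous G X d \<phi> \<longleftrightarrow>
     (\<forall>K. compactin (Metric_space.mtopology X d) K \<longrightarrow>
        finite {g \<in> carrier G. \<phi> g ` K \<inter> K \<noteq> {}})"

definition cocompact ::
    "('g, 'm) monoid_scheme \<Rightarrow> 'x set \<Rightarrow> ('x \<Rightarrow> 'x \<Rightarrow> real) \<Rightarrow> ('g \<Rightarrow> 'x \<Rightarrow> 'x) \<Rightarrow> bool" where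
  "cocompact G X d \<phi> \<longleftrightarrow>
     (\<exists>K. compactin (Metric_space.mtopology X d) K \<and> (\<Union>g\<in>carrier G. \<phi> g ` K) = X)"

section \<open>Strongly contracting elements\<close>

definition strongly_contracting_projection ::
    "'x set \<Rightarrow> ('x \<Rightarrow> 'x \<Rightarrow> real) \<Rightarrow> real \<Rightarrow> 'x set \<Rightarrow> ('x \<Rightarrow> 'x) \<Rightarrow> bool" where
  "strongly_contracting_projection X d C A \<pi> \<longleftrightarrow>
     \<pi> ` X \<subseteq> A \<and>
     (\<forall>a\<in>A. d a (\<pi> a) \<le> C) \<and>
     (\<forall>x\<in>X. \<forall>y\<in>X. d (\<pi> x) (\<pi> y) > C \<longrightarrow>
        (\<forall>P. geodesic_segment X d x y P \<longrightarrow>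
           dist_to_set d (\<pi> x) P \<le> C \<and> dist_to_set d (\<pi> y) P \<le> C))"

text \<open>Quasi-isometric embeddings of the integers; no continuity is required.\<close>

definition quasi_geodesic :: "('x \<Rightarrow> 'x \<Rightarrow> real) \<Rightarrow> (int \<Rightarrow> 'x) \<Rightarrow> bool" where
  "quasi_geodesic d q \<longleftrightarrow>
     (\<exists>L\<ge>1. \<exists>A\<ge>0. \<forall>i j.
        \<bar>real_of_int (i - j)\<bar> / L - A \<le> d (q i) (q j) \<and>
        d (q i) (q j) \<le> L * \<bar>real_of_int (i - j)\<bar> + A)"

definition C_strongly_contracting ::
    "('g, 'm) monoid_scheme \<Rightarrow> 'x set \<Rightarrow> ('x \<Rightarrow> 'x \<Rightarrow> real) \<Rightarrow> ('g \<Rightarrow> 'x \<Rightarrow> 'x) \<Rightarrow> 'x \<Rightarrow>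
     real \<Rightarrow> 'g \<Rightarrow> bool" where
  "C_strongly_contracting G X d \<phi> bp C h \<longleftrightarrow>
     h \<in> carrier G \<and>
     quasi_geodesic d (\<lambda>i::int. \<phi> (h [^]\<^bsub>G\<^esub> i) bp) \<and>
     (\<forall>x y P. x \<in> (\<lambda>g. \<phi> g bp) ` generate G {h} \<and> y \<in> (\<lambda>g. \<phi> g bp) ` generate G {h} \<and>
        geodesic_segment X d x y P \<longrightarrow>
          (\<exists>\<pi>. strongly_contracting_projection X d C P \<pi>))"

definition strongly_contracting ::
    "('g, 'm) monoid_scheme \<Rightarrow> 'x set \<Rightarrow> ('x \<Rightarrow> 'x \<Rightarrow> real) \<Rightarrow> ('g \<Rightarrow> 'x \<Rightarrow> 'x) \<Rightarrow> 'x \<Rightarrow>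
     'g \<Rightarrow> bool" where
  "strongly_contracting G X d \<phi> bp h \<longleftrightarrow> (\<exists>C>0. C_strongly_contracting G X d \<phi> bp C h)"

section \<open>Products\<close>

definition Lp_metric ::
    "ereal \<Rightarrow> 'i set \<Rightarrow> ('i \<Rightarrow> 'x \<Rightarrow> 'x \<Rightarrow> real) \<Rightarrow> ('i \<Rightarrow> 'x) \<Rightarrow> ('i \<Rightarrow> 'x) \<Rightarrow> real" where
  "Lp_metric p I d x y =
     (if p = \<infinity> then (MAX i\<in>I. d i (x i) (y i))
      else (\<Sum>i\<in>I. d i (x i) (y i) powr real_of_ereal p) powr (1 / real_of_ereal p))"

definition coordinatewise_action ::
    "'i set \<Rightarrow> ('i \<Rightarrow> 'x set) \<Rightarrow> ('i \<Rightarrow> 'g \<Rightarrow> 'x \<Rightarrow> 'x) \<Rightarrow> ('i \<Rightarrow> 'g) \<Rightarrow> ('i \<Rightarrow> 'x) \<Rightarrow> ('i \<Rightarrow> 'x)" where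
  "coordinatewise_action I X \<phi> g = (\<lambda>x\<in>(\<Pi>\<^sub>E i\<in>I. X i). \<lambda>i\<in>I. \<phi> i (g i) (x i))"

section \<open>Growth\<close>

text \<open>Since \<^const>\<open>card\<close> of an infinite set is \<open>0\<close>, infinite balls are given logarithmic size
  \<open>\<infinity>\<close> explicitly.\<close>

definition log_card :: "'a set \<Rightarrow> ereal" where
  "log_card A = (if finite A then ereal (ln (real (card A))) else \<infinity>)"

definition growth_exponent :: "'a set \<Rightarrow> ('a \<Rightarrow> 'a \<Rightarrow> real) \<Rightarrow> 'a \<Rightarrow> ereal" where
  "growth_exponent A d a0 =
     Limsup at_top (\<lambda>r::real. ereal (1 / r) * log_card {a \<in> A. d a0 a \<le> r})"

text \<open>Pseudo-metric on \<open>G/N\<close>. Its arguments are cosets: for normal \<open>N\<close> the elements of the right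
  coset \<open>Ng = gN\<close> are exactly the products \<open>gn\<close>. For a properly discontinuous isometric action on
  a proper space the infimum is attained.\<close>

definition quotient_dist ::
    "('x \<Rightarrow> 'x \<Rightarrow> real) \<Rightarrow> ('g \<Rightarrow> 'x \<Rightarrow> 'x) \<Rightarrow> 'x \<Rightarrow> 'g set \<Rightarrow> 'g set \<Rightarrow> real" where
  "quotient_dist d \<phi> bp A B = Inf {d (\<phi> a bp) (\<phi> b bp) | a b. a \<in> A \<and> b \<in> B}"

text \<open>The base point in \<open>G/N\<close> is the trivial coset \<open>N\<close>.\<close>

definition quotient_growth ::
    "('g, 'm) monoid_scheme \<Rightarrow> ('x \<Rightarrow> 'x \<Rightarrow> real) \<Rightarrow> ('g \<Rightarrow> 'x \<Rightarrow> 'x) \<Rightarrow> 'x \<Rightarrow> 'g set \<Rightarrow> ereal" where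
  "quotient_growth G d \<phi> bp N = growth_exponent (carrier (G Mod N)) (quotient_dist d \<phi> bp) N"

definition growth_tight ::
    "('g, 'm) monoid_scheme \<Rightarrow> ('x \<Rightarrow> 'x \<Rightarrow> real) \<Rightarrow> ('g \<Rightarrow> 'x \<Rightarrow> 'x) \<Rightarrow> 'x \<Rightarrow> bool" where
  "growth_tight G d \<phi> bp \<longleftrightarrow>
     (\<forall>N. N \<lhd> G \<and> infinite N \<longrightarrow>
        quotient_growth G d \<phi> bp {\<one>\<^bsub>G\<^esub>} > quotient_growth G d \<phi> bp N)"

end

theory Submission
  imports Defs
begin

text \<open>
  Everything except the passage from the definition of strong contraction takes place in the group
  with the length function \<open>g \<mapsto> d(o, g.o)\<close>: a subset is contracting if two points whose nearest
  points on it are far apart are joined by a shortest path through these nearest points, up to a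
  bounded error. A contracting element of \<open>N\<close> is obtained as a commutator \<open>c = [h\<^sup>m, f]\<close> with
  \<open>f \<in> N\<close> not commensurating \<open>\<langle>h\<rangle>\<close>. Shortest representatives of the cosets of \<open>N\<close> have bounded
  projections to all translates of \<open>\<langle>c\<rangle>\<close>, so that the products \<open>a\<^sub>1 c\<^sup>M a\<^sub>2 c\<^sup>M \<dots>\<close> of
  separated representatives with a fixed large power of \<open>c\<close> are pairwise distinct. As the Poincare
  series of \<open>G/N\<close> diverges at its critical exponent, counting these products gives \<open>G\<close> a strictly
  larger exponent. In a product, a normal subgroup with infinite projection to a factor meets this
  factor in an infinite subgroup, because the commutator above lies in both; and the growth exponent
  of the \<open>L\<^sup>p\<close> product is the dual norm of the vector of exponents of the factors, which is strictly
  monotone in each entry for \<open>p > 1\<close>, but is the maximum for \<open>p = 1\<close>.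
\<close>

text \<open>Strictness comes from divergence. Coarse subadditivity of the logarithmic ball counts
  exhibits the exponent \<delta>' of G/N as an infimum, so balls have at least a constant times
  exp(\<delta>' r) elements and the Poincare series diverges at \<delta>' itself. Each repair of the
  set of shortest representatives costs only a constant factor: dropping short ones, thinning to a
  separated set, appending a fixed power of c. Hence some finite set of letters still has weight at
  least 2 at \<delta>'. A finite sum is continuous in the exponent, so the weight stays at least 1
  at some s > \<delta>', and free words in these letters force an exponent of at least s. The
  obstacle is that N may contain no power of h, whereas cutting down representatives requires a
  contracting element inside N. The commutator lies in N by normality, and it is contracting because
  f is chosen off the commensurator: the axis of h and its translate by f then have bounded
  projections to each other. Exponents are handled by the pair \<open>exp_lower\<close> and
  \<open>exp_summable\<close>; the Limsup enters only when the estimates are translated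
  back.\<close>

no_notation subset_mset (infix \<open><#\<close> 50)

section \<open>Groups with a proper length function\<close>

text \<open>\<open>len g\<close> stands for the distance from the base point to its image under
  \<open>g\<close>. Elements of the stabiliser of the base point have length 0, so the induced
  \<open>rho\<close> is only a left invariant pseudo-metric; proper discontinuity survives as
  finiteness of balls.\<close>

locale length_group = group G for G (structure) +
  fixes len :: "'a \<Rightarrow> real"
  assumes len_one: "len \<one> = 0"
    and len_inv: "x \<in> carrier G \<Longrightarrow> len (inv x) = len x"
    and len_mult: "\<lbrakk>x \<in> carrier G; y \<in> carrier G\<rbrakk> \<Longrightarrow> len (x \<otimes> y) \<le> len x + len y"
    and finite_ball: "finite {x \<in> carrier G. len x \<le> r}"
begin

lemma inv_cancel_left [simp]: "\<lbrakk>g \<in> carrier G; y \<in> carrier G\<rbrakk> \<Longrightarrow> inv g \<otimes> (g \<otimes> y) = y"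
  by (simp add: m_assoc[symmetric])

lemma cancel_inv_left [simp]: "\<lbrakk>g \<in> carrier G; y \<in> carrier G\<rbrakk> \<Longrightarrow> g \<otimes> (inv g \<otimes> y) = y"
  by (simp add: m_assoc[symmetric])

lemma len_nonneg: "x \<in> carrier G \<Longrightarrow> 0 \<le> len x"
  using len_mult[of x "inv x"] by (simp add: len_one len_inv)

definition rho :: "'a \<Rightarrow> 'a \<Rightarrow> real" where
  "rho x y = len (inv x \<otimes> y)"

lemma rho_nonneg: "\<lbrakk>x \<in> carrier G; y \<in> carrier G\<rbrakk> \<Longrightarrow> 0 \<le> rho x y"
  by (simp add: rho_def len_nonneg)

lemma rho_self [simp]: "x \<in> carrier G \<Longrightarrow> rho x x = 0"
  by (simp add: rho_def len_one)

lemma rho_sym: "\<lbrakk>x \<in> carrier G; y \<in> carrier G\<rbrakk> \<Longrightarrow> rho x y = rho y x"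
  unfolding rho_def using len_inv[of "inv x \<otimes> y"] by (simp add: inv_mult_group)

lemma rho_triangle:
  assumes "x \<in> carrier G" "y \<in> carrier G" "z \<in> carrier G"
  shows "rho x z \<le> rho x y + rho y z"
proof -
  have "inv x \<otimes> z = (inv x \<otimes> y) \<otimes> (inv y \<otimes> z)"
    using assms by (simp add: m_assoc)
  then show ?thesis unfolding rho_def using assms by (simp add: len_mult)
qed

lemma rho_translate [simp]:
  assumes "g \<in> carrier G" "x \<in> carrier G" "y \<in> carrier G"
  shows "rho (g \<otimes> x) (g \<otimes> y) = rho x y"
proof -
  have "inv (g \<otimes> x) \<otimes> (g \<otimes> y) = inv x \<otimes> y"
    using assms by (simp add: inv_mult_group m_assoc)
  then show ?thesis by (simp add: rho_def)
qed

lemma rho_one_left [simp]: "x \<in> carrier G \<Longrightarrow> rho \<one> x = len x"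
  by (simp add: rho_def)

lemma rho_mult_right [simp]: "\<lbrakk>x \<in> carrier G; y \<in> carrier G\<rbrakk> \<Longrightarrow> rho x (x \<otimes> y) = len y"
  using rho_translate[of x \<one> y] by simp

lemma finite_rho_ball:
  assumes x: "x \<in> carrier G"
  shows "finite {y \<in> carrier G. rho x y \<le> r}"
proof -
  have "{y \<in> carrier G. rho x y \<le> r} \<subseteq> (\<lambda>y. x \<otimes> y) ` {y \<in> carrier G. len y \<le> r}"
  proof
    fix y assume y: "y \<in> {y \<in> carrier G. rho x y \<le> r}"
    have "y = x \<otimes> (inv x \<otimes> y)" using x y by simp
    then show "y \<in> (\<lambda>y. x \<otimes> y) ` {y \<in> carrier G. len y \<le> r}"
      using x y by (intro image_eqI[where x="inv x \<otimes> y"]) (auto simp: rho_def)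
  qed
  then show ?thesis using finite_ball finite_surj by blast
qed

section \<open>Nearest points and contracting sets\<close>

definition nearest :: "'a set \<Rightarrow> 'a \<Rightarrow> 'a \<Rightarrow> bool" where
  "nearest Z x p \<longleftrightarrow> p \<in> Z \<and> (\<forall>z\<in>Z. rho x p \<le> rho x z)"

text \<open>Strong contraction as an inequality: the broken path over the two projections is
  shortest up to \<open>C\<close>. The group contains no geodesics, so their closeness to the
  projections is expressed through lengths. Nearest points need not be unique; quantifying over all
  of them makes the notion exactly invariant under translation.\<close>

definition contracting :: "real \<Rightarrow> 'a set \<Rightarrow> bool" where
  "contracting C Z \<longleftrightarrow> (\<forall>x\<in>carrier G. \<forall>y\<in>carrier G. \<forall>p q.
     nearest Z x p \<and> nearest Z y q \<and> C < rho p q \<longrightarrow>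
       rho x p + rho p q + rho q y - C \<le> rho x y)"

lemma contractingD:
  "\<lbrakk>contracting C Z; nearest Z x p; nearest Z y q; C < rho p q; x \<in> carrier G; y \<in> carrier G\<rbrakk>
    \<Longrightarrow> rho x p + rho p q + rho q y - C \<le> rho x y"
  unfolding contracting_def by blast

lemma nearest_in: "nearest Z x p \<Longrightarrow> p \<in> Z"
  by (simp add: nearest_def)

lemma nearest_carrier: "\<lbrakk>nearest Z x p; Z \<subseteq> carrier G\<rbrakk> \<Longrightarrow> p \<in> carrier G"
  by (auto simp: nearest_def)

lemma nearest_self: "\<lbrakk>Z \<subseteq> carrier G; z \<in> Z\<rbrakk> \<Longrightarrow> nearest Z z z"
  unfolding nearest_def using rho_nonneg by (auto simp: subset_iff)

lemma nearest_le: "\<lbrakk>nearest Z x p; z \<in> Z\<rbrakk> \<Longrightarrow> rho x p \<le> rho x z"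
  by (simp add: nearest_def)

lemma nearest_exists:
  assumes "Z \<subseteq> carrier G" "Z \<noteq> {}" "x \<in> carrier G"
  obtains p where "nearest Z x p"
proof -
  obtain z0 where z0: "z0 \<in> Z" using assms by blast
  define F where "F = {z \<in> Z. rho x z \<le> rho x z0}"
  have "F \<subseteq> {y \<in> carrier G. rho x y \<le> rho x z0}" using assms by (auto simp: F_def)
  then have fin: "finite F" using finite_rho_ball[OF assms(3)] finite_subset by blast
  have ne: "F \<noteq> {}" using z0 by (auto simp: F_def)
  obtain p where p: "p \<in> F" "\<forall>z\<in>F. rho x p \<le> rho x z"
    using arg_min_if_finite(1)[OF fin ne] arg_min_least[OF fin ne] by metis
  have "nearest Z x p"
    unfolding nearest_def
  proof (intro conjI ballI)
    show "p \<in> Z" using p by (simp add: F_def)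
    fix z assume "z \<in> Z"
    then show "rho x p \<le> rho x z"
      using p z0 by (cases "z \<in> F") (auto simp: F_def)
  qed
  then show ?thesis using that by blast
qed

lemma contracting_lipschitz:
  assumes "contracting C Z" "nearest Z x p" "nearest Z y q" "Z \<subseteq> carrier G" "0 \<le> C"
    "x \<in> carrier G" "y \<in> carrier G"
  shows "rho p q \<le> rho x y + C"
proof (cases "C < rho p q")
  case True
  have pq: "p \<in> carrier G" "q \<in> carrier G" using assms nearest_carrier by blast+
  then show ?thesis using contractingD[OF assms(1-3) True assms(6,7)] rho_nonneg[of x p] rho_nonneg[of q y] assms
    by linarith
next
  case False
  then show ?thesis using rho_nonneg[OF assms(6,7)] by linarith
qed

lemma l_coset_carrier: "\<lbrakk>g \<in> carrier G; Z \<subseteq> carrier G\<rbrakk> \<Longrightarrow> g <# Z \<subseteq> carrier G"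
  by (auto simp: l_coset_def)

lemma l_coset_memI: "z \<in> Z \<Longrightarrow> g \<otimes> z \<in> g <# Z"
  by (auto simp: l_coset_def)

lemma nearest_translateI:
  assumes "nearest Z x p" "Z \<subseteq> carrier G" "x \<in> carrier G" "g \<in> carrier G"
  shows "nearest (g <# Z) (g \<otimes> x) (g \<otimes> p)"
  using assms unfolding nearest_def l_coset_def by (auto simp: subset_iff)

lemma nearest_translateD:
  assumes "nearest (g <# Z) (g \<otimes> x) p" "Z \<subseteq> carrier G" "x \<in> carrier G" "g \<in> carrier G"
  obtains p' where "p = g \<otimes> p'" "nearest Z x p'"
proof -
  obtain p' where p': "p' \<in> Z" "p = g \<otimes> p'" using assms(1) by (auto simp: nearest_def l_coset_def)
  have "nearest Z x p'"
    unfolding nearest_def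
  proof (intro conjI ballI p'(1))
    fix z assume z: "z \<in> Z"
    then have "rho (g \<otimes> x) p \<le> rho (g \<otimes> x) (g \<otimes> z)" using assms(1) l_coset_memI nearest_le by blast
    then show "rho x p' \<le> rho x z" using p' z assms by (auto simp: subset_iff)
  qed
  then show ?thesis using p' that by blast
qed

lemma nearest_translateE:
  assumes "nearest (g <# Z) x p" "Z \<subseteq> carrier G" "x \<in> carrier G" "g \<in> carrier G"
  obtains p' where "p = g \<otimes> p'" "nearest Z (inv g \<otimes> x) p'"
proof -
  have "x = g \<otimes> (inv g \<otimes> x)" using assms by simp
  then show ?thesis using nearest_translateD[of g Z "inv g \<otimes> x" p] assms that by auto
qed

lemma contracting_translate:
  assumes C: "contracting C Z" and Z: "Z \<subseteq> carrier G" and g: "g \<in> carrier G"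
  shows "contracting C (g <# Z)"
  unfolding contracting_def
proof (intro ballI allI impI, elim conjE)
  fix x y p q assume xy: "x \<in> carrier G" "y \<in> carrier G"
    and p: "nearest (g <# Z) x p" and q: "nearest (g <# Z) y q" and l: "C < rho p q"
  obtain p' where p': "p = g \<otimes> p'" "nearest Z (inv g \<otimes> x) p'"
    using nearest_translateE[OF p Z xy(1) g] .
  obtain q' where q': "q = g \<otimes> q'" "nearest Z (inv g \<otimes> y) q'"
    using nearest_translateE[OF q Z xy(2) g] .
  have c: "p' \<in> carrier G" "q' \<in> carrier G" using p' q' Z nearest_carrier by blast+
  have e: "x = g \<otimes> (inv g \<otimes> x)" "y = g \<otimes> (inv g \<otimes> y)" using xy g by simp_all
  have t: "rho x p = rho (inv g \<otimes> x) p'" "rho q y = rho q' (inv g \<otimes> y)"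
    "rho x y = rho (inv g \<otimes> x) (inv g \<otimes> y)" "rho p q = rho p' q'"
    using rho_translate[of g "inv g \<otimes> x" p'] rho_translate[of g q' "inv g \<otimes> y"]
    by (simp_all add: p'(1) q'(1) c g xy)
  have "C < rho p' q'" using l t by simp
  then show "rho x p + rho p q + rho q y - C \<le> rho x y"
    unfolding t using contractingD[OF C p'(2) q'(2)] xy g by simp
qed

text \<open>A point cannot be seen far from \<open>e\<close> in \<open>Z\<close> and at the same time far from \<open>e'\<close> in \<open>Z'\<close>: it
  would have to be closer to \<open>e\<close> than to \<open>e'\<close> and conversely.\<close>

lemma behrstock:
  assumes C: "contracting C Z" "contracting C Z'" "0 \<le> C"
    and Z: "Z \<subseteq> carrier G" "Z \<noteq> {}" "Z' \<subseteq> carrier G" "Z' \<noteq> {}"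
    and c: "e \<in> carrier G" "e' \<in> carrier G" "x \<in> carrier G"
    and e: "\<And>p. nearest Z e' p \<Longrightarrow> rho e p \<le> B" and e': "\<And>p. nearest Z' e p \<Longrightarrow> rho e' p \<le> B"
    and far: "2 * B + C < rho e e'"
    and q: "nearest Z x q" "nearest Z' x q'"
  shows "rho e q \<le> B + C \<or> rho e' q' \<le> B + C"
proof (rule ccontr)
  assume "\<not> ?thesis"
  then have n: "rho e q > B + C" "rho e' q' > B + C" by auto
  have qc: "q \<in> carrier G" "q' \<in> carrier G" using q Z nearest_carrier by blast+
  \<comment> \<open>A path from \<open>x\<close> to \<open>v\<close> enters \<open>W\<close> near
    \<open>s\<close>, far from \<open>w\<close>, and leaves it near \<open>w\<close>, so it passes
    close to \<open>w\<close>. The two instances, for \<open>Z\<close> and for \<open>Z'\<close>,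
    add up to a bound on \<open>rho e e'\<close> that contradicts \<open>far\<close>.\<close>
  have half: "rho x v \<ge> rho x w + rho v w - 2 * B - C"
    if "contracting C W" "W \<subseteq> carrier G" "W \<noteq> {}" "v \<in> carrier G" "w \<in> carrier G"
      "\<And>p. nearest W v p \<Longrightarrow> rho w p \<le> B" "nearest W x s" "rho w s > B + C" for W v w s
  proof -
    note ne = nearest_exists[OF that(2,3,4)]
    obtain p where p: "nearest W v p" by (rule ne)
    have k: "p \<in> carrier G" "s \<in> carrier G" using p that nearest_carrier by blast+
    have wp: "rho w p \<le> B" using that p by blast
    have "rho w s \<le> rho w p + rho p s" using rho_triangle that k by blast
    then have "C < rho s p" using wp that(8) rho_sym[OF k] by linarith
    then have "rho x s + rho s p + rho p v - C \<le> rho x v"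
      using contractingD[OF that(1) that(7) p] c that by blast
    moreover have "rho x w \<le> rho x p + rho w p" "rho v w \<le> rho p v + rho w p" "rho x p \<le> rho x s + rho s p"
      using rho_triangle rho_sym k that c by metis+
    ultimately show ?thesis using wp by linarith
  qed
  have "rho x e \<ge> rho x e' + rho e e' - 2 * B - C"
    using half[OF C(2) Z(3,4) c(1,2) e' q(2) n(2)] .
  moreover have "rho x e' \<ge> rho x e + rho e' e - 2 * B - C"
    using half[OF C(1) Z(1,2) c(2,1) e q(1) n(1)] .
  ultimately show False using far rho_sym[OF c(1,2)] by linarith
qed

text \<open>The coarse projection \<open>\<pi>\<close> may depend on the points in question. This allows one to project to
  finite segments of an axis only.\<close>

lemma contractingI:
  assumes Z: "Z \<subseteq> carrier G" and K: "0 \<le> K"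
    and ex: "\<And>x y p q. \<lbrakk>x \<in> carrier G; y \<in> carrier G; p \<in> Z; q \<in> Z\<rbrakk> \<Longrightarrow>
      \<exists>\<pi>. \<pi> ` {x, y, p, q} \<subseteq> Z \<and> rho p (\<pi> p) \<le> K \<and> rho q (\<pi> q) \<le> K \<and>
        (\<forall>u\<in>{x, y, p, q}. \<forall>w\<in>{x, y, p, q}. K < rho (\<pi> u) (\<pi> w) \<longrightarrow>
          rho u (\<pi> u) + rho (\<pi> u) (\<pi> w) + rho (\<pi> w) w - K \<le> rho u w)"
  shows "contracting (9 * K) Z"
  unfolding contracting_def
proof (intro ballI allI impI, elim conjE)
  fix x y p q assume xy: "x \<in> carrier G" "y \<in> carrier G"
    and p: "nearest Z x p" and q: "nearest Z y q" and l: "9 * K < rho p q"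
  have pqZ: "p \<in> Z" "q \<in> Z" using p q by (auto simp: nearest_def)
  then have pq: "p \<in> carrier G" "q \<in> carrier G" using Z by auto
  obtain \<pi> where im: "\<pi> ` {x, y, p, q} \<subseteq> Z" and pp: "rho p (\<pi> p) \<le> K" "rho q (\<pi> q) \<le> K"
    and con: "\<And>u w. \<lbrakk>u \<in> {x,y,p,q}; w \<in> {x,y,p,q}; K < rho (\<pi> u) (\<pi> w)\<rbrakk> \<Longrightarrow>
      rho u (\<pi> u) + rho (\<pi> u) (\<pi> w) + rho (\<pi> w) w - K \<le> rho u w"
    using ex[OF xy pqZ] by blast
  have c: "\<pi> x \<in> carrier G" "\<pi> y \<in> carrier G" "\<pi> p \<in> carrier G" "\<pi> q \<in> carrier G"
    and cZ: "\<pi> x \<in> Z" "\<pi> y \<in> Z" using im Z by auto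
  \<comment> \<open>The coarse projection and a nearest point \<open>w\<close> agree up to 2 K: if
    \<open>\<pi> u\<close> and \<open>\<pi> w\<close> were more than \<open>K\<close> apart,
    contraction would put \<open>w\<close> farther from \<open>u\<close> than
    \<open>\<pi> u\<close>, which is a point of \<open>Z\<close>.\<close>
  have 1: "rho (\<pi> u) w \<le> 2 * K" if "u \<in> {x, y}" "w \<in> {p, q}" "nearest Z u w" "rho w (\<pi> w) \<le> K" for u w
  proof -
    have cc: "u \<in> carrier G" "w \<in> carrier G" "\<pi> u \<in> carrier G" "\<pi> w \<in> carrier G" "\<pi> u \<in> Z" using that xy pq c cZ by auto
    have "rho (\<pi> u) (\<pi> w) \<le> K"
    proof (rule ccontr)
      assume n: "\<not> rho (\<pi> u) (\<pi> w) \<le> K"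
      then have "rho u (\<pi> u) + rho (\<pi> u) (\<pi> w) + rho (\<pi> w) w - K \<le> rho u w"
        using con that by (metis insert_iff not_le)
      moreover have "rho u w \<le> rho u (\<pi> u)" using that cc nearest_le by blast
      ultimately show False using n rho_nonneg[of "\<pi> w" w] cc by linarith
    qed
    then show ?thesis using rho_triangle[of "\<pi> u" "\<pi> w" w] rho_sym[of w "\<pi> w"] that cc by linarith
  qed
  have a: "rho (\<pi> x) p \<le> 2 * K" "rho (\<pi> y) q \<le> 2 * K" using 1 p q pp by auto
  have t: "rho p q \<le> rho p (\<pi> x) + rho (\<pi> x) (\<pi> y) + rho (\<pi> y) q" "rho x p \<le> rho x (\<pi> x) + rho (\<pi> x) p"
     "rho q y \<le> rho (\<pi> y) q + rho (\<pi> y) y"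
    using rho_triangle[of p "\<pi> x" q] rho_triangle[of "\<pi> x" "\<pi> y" q] rho_triangle[of x "\<pi> x" p]
      rho_triangle[of q "\<pi> y" y] rho_sym[of "\<pi> y" q] xy pq c by linarith+
  moreover have s: "rho p (\<pi> x) = rho (\<pi> x) p" using rho_sym pq c by blast
  ultimately have "K < rho (\<pi> x) (\<pi> y)" using a l K by linarith
  then have "rho x (\<pi> x) + rho (\<pi> x) (\<pi> y) + rho (\<pi> y) y - K \<le> rho x y" using con by blast
  \<comment> \<open>Replacing \<open>p\<close> and \<open>q\<close> by the coarse projections costs
    2 K at each of their four occurrences; the \<open>K\<close> of the assumption brings this to 9
    K.\<close>
  then show "rho x p + rho p q + rho q y - 9 * K \<le> rho x y" using a t s by linarith
qed

section \<open>Contracting cyclic subgroups\<close>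

definition cyc :: "'a \<Rightarrow> 'a set" where
  "cyc h = range (\<lambda>i::int. h [^] i)"

lemma cyc_carrier [simp]: "h \<in> carrier G \<Longrightarrow> cyc h \<subseteq> carrier G"
  by (auto simp: cyc_def)

lemma cyc_nonempty [simp]: "cyc h \<noteq> {}"
  by (simp add: cyc_def)

lemma pow_in_cyc [simp]: "h [^] (i::int) \<in> cyc h"
  by (simp add: cyc_def)

lemma one_in_cyc: "\<one> \<in> cyc h"
  using pow_in_cyc[of h 0] by simp

lemma cycE: assumes "x \<in> cyc h" obtains i :: int where "x = h [^] i"
  using assms by (auto simp: cyc_def)

lemma rho_pow: "h \<in> carrier G \<Longrightarrow> rho (h [^] (i::int)) (h [^] (j::int)) = len (h [^] (j - i))"
  using rho_mult_right[of "h [^] i" "h [^] (j - i)"] by (simp add: int_pow_mult[symmetric])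

lemma l_coset_mult: "\<lbrakk>a \<in> carrier G; b \<in> carrier G; Z \<subseteq> carrier G\<rbrakk> \<Longrightarrow> a <# (b <# Z) = (a \<otimes> b) <# Z"
  by (auto simp: l_coset_def m_assoc subset_iff)

lemma pow_coset_cyc: assumes "h \<in> carrier G" shows "(h [^] (i::int)) <# cyc h = cyc h"
proof (intro equalityI subsetI)
  fix x assume "x \<in> (h [^] i) <# cyc h"
  then obtain j :: int where "x = h [^] i \<otimes> h [^] j" by (auto simp: l_coset_def cyc_def)
  then show "x \<in> cyc h" using int_pow_mult[OF assms, of i j] pow_in_cyc by metis
next
  fix x assume "x \<in> cyc h"
  then obtain j :: int where "x = h [^] j" by (rule cycE)
  then have "x = h [^] i \<otimes> h [^] (j - i)" using int_pow_mult[OF assms, of i "j - i"] by simp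
  then show "x \<in> (h [^] i) <# cyc h" using l_coset_memI pow_in_cyc by metis
qed

lemma nearest_cyc_shift:
  assumes "nearest (cyc h) x p" "h \<in> carrier G" "x \<in> carrier G"
  shows "nearest (cyc h) (h [^] (i::int) \<otimes> x) (h [^] i \<otimes> p)"
  using nearest_translateI[OF assms(1), of "h [^] i"] assms by (simp add: pow_coset_cyc)

text \<open>Distinct powers and finite balls leave only finitely many exponents with short powers.
  In this form the growth of powers depends on injectivity alone, which is easy to establish for the
  commutators built later.\<close>

lemma large_pow:
  assumes "h \<in> carrier G" "inj (\<lambda>i::int. h [^] i)"
  obtains n :: nat where "n > 0" "\<And>j::int. int n \<le> \<bar>j\<bar> \<Longrightarrow> r < len (h [^] j)"
proof -
  have "finite ((\<lambda>i::int. h [^] i) -` {x \<in> carrier G. len x \<le> r})"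
    using finite_vimageI[OF finite_ball assms(2)] .
  then have "finite (abs ` ((\<lambda>i::int. h [^] i) -` {x \<in> carrier G. len x \<le> r}))" by blast
  then obtain b where b: "\<And>j::int. j \<in> abs ` ((\<lambda>i::int. h [^] i) -` {x \<in> carrier G. len x \<le> r}) \<Longrightarrow> j \<le> b"
    by (meson bdd_above_finite bdd_above.unfold)
  show ?thesis
  proof
    show "nat \<bar>b\<bar> + 1 > 0" by simp
    fix j :: int assume j: "int (nat \<bar>b\<bar> + 1) \<le> \<bar>j\<bar>"
    show "r < len (h [^] j)"
    proof (rule ccontr)
      assume "\<not> r < len (h [^] j)"
      then have "\<bar>j\<bar> \<le> b" using assms(1) by (intro b) auto
      then show False using j by linarith
    qed
  qed
qed

section \<open>Commensuration of a cyclic subgroup\<close>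

definition commensurates :: "'a \<Rightarrow> 'a \<Rightarrow> bool" where
  "commensurates h g \<longleftrightarrow> (\<exists>(a::int) (b::int). a \<noteq> 0 \<and> b \<noteq> 0 \<and> g \<otimes> h [^] b = h [^] a \<otimes> g)"

lemma commute_pow_nat:
  assumes "g \<in> carrier G" "h \<in> carrier G" "g \<otimes> h [^] (b::int) = h [^] (a::int) \<otimes> g"
  shows "g \<otimes> h [^] (b * int n) = h [^] (a * int n) \<otimes> g"
proof (induction n)
  case (Suc n)
  have "g \<otimes> h [^] (b * int (Suc n)) = (g \<otimes> h [^] (b * int n)) \<otimes> h [^] b"
    using assms by (simp add: m_assoc int_pow_mult[symmetric] algebra_simps)
  also have "\<dots> = h [^] (a * int n) \<otimes> (g \<otimes> h [^] b)" using Suc assms by (simp add: m_assoc)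
  also have "\<dots> = h [^] (a * int (Suc n)) \<otimes> g"
    using assms by (simp add: m_assoc[symmetric] int_pow_mult[symmetric] algebra_simps)
  finally show ?case .
qed (use assms in simp)

text \<open>The axis and its translate run parallel; translating far along both axes, the defect in the
  contraction inequality bounds the distance of \<open>g\<close> and of \<open>g\<inverse>\<close> to the axis.\<close>

lemma commensurates_close:
  assumes h: "h \<in> carrier G" "inj (\<lambda>i::int. h [^] i)" and C: "contracting C (cyc h)"
    and g: "g \<in> carrier G" "commensurates h g" and p: "nearest (cyc h) g p"
  shows "rho g p \<le> C"
proof -
  obtain a b :: int where ab: "a \<noteq> 0" "b \<noteq> 0" "g \<otimes> h [^] b = h [^] a \<otimes> g"
    using g by (auto simp: commensurates_def)
  obtain n :: nat where n: "n > 0" "\<And>j::int. int n \<le> \<bar>j\<bar> \<Longrightarrow> C < len (h [^] j)"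
    using large_pow[OF h] by blast
  define A where "A = h [^] (a * int n)"
  define B where "B = h [^] (b * int n)"
  have c: "A \<in> carrier G" "B \<in> carrier G" using h by (auto simp: A_def B_def)
  have "\<bar>a\<bar> \<ge> 1" "\<bar>b\<bar> \<ge> 1" using ab by linarith+
  then have "int n \<le> \<bar>a * int n\<bar>" "int n \<le> \<bar>b * int n\<bar>"
    by (simp_all add: abs_mult mult_le_cancel_right1 n(1))
  then have l: "C < len A" "C < len B" using n by (auto simp: A_def B_def)
  have gB: "g \<otimes> B = A \<otimes> g" unfolding A_def B_def by (rule commute_pow_nat[OF g(1) h(1) ab(3)])
  have iA: "inv g \<otimes> A = B \<otimes> inv g"
  proof -
    have "inv g \<otimes> A = inv g \<otimes> (A \<otimes> g) \<otimes> inv g" using g c by (simp add: m_assoc)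
    also have "\<dots> = B \<otimes> inv g" using g c by (simp add: gB[symmetric] m_assoc[symmetric])
    finally show ?thesis .
  qed
  \<comment> \<open>The points \<open>x\<close> and \<open>x \<otimes> V = U \<otimes> x\<close>
    project to \<open>q\<close> and \<open>U \<otimes> q\<close>, which are \<open>len U\<close>
    apart, and both are at distance \<open>rho x q\<close> from their projections.\<close>
  have key: "2 * rho x q + len U - C \<le> len V"
    if x: "x \<in> carrier G" and q: "nearest (cyc h) x q" and UV: "x \<otimes> V = U \<otimes> x" "U = h [^] (i::int)" "V \<in> carrier G" "C < len U"
    for x q U V i
  proof -
    have qc: "q \<in> carrier G" using q h nearest_carrier cyc_carrier by blast
    obtain j :: int where j: "q = h [^] j" using nearest_in[OF q] cycE by blast
    have q2: "nearest (cyc h) (x \<otimes> V) (U \<otimes> q)"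
      unfolding UV(1) unfolding UV(2) using nearest_cyc_shift[OF q h(1) x] .
    have U: "U \<in> carrier G" using UV h by simp
    have "U \<otimes> q = q \<otimes> U" using j UV h by (simp add: int_pow_mult[symmetric] add.commute)
    then have r1: "rho q (U \<otimes> q) = len U" using qc U by simp
    have "rho x q + rho q (U \<otimes> q) + rho (U \<otimes> q) (x \<otimes> V) - C \<le> rho x (x \<otimes> V)"
      using contractingD[OF C q q2] r1 UV x U by (simp del: rho_translate rho_mult_right)
    moreover have "rho (U \<otimes> q) (x \<otimes> V) = rho x q" using UV(1) U x qc rho_sym by simp
    moreover have "rho x (x \<otimes> V) = len V" using x UV(3) by simp
    ultimately show ?thesis using r1 by simp
  qed
  obtain q where q: "nearest (cyc h) (inv g) q" using nearest_exists[of "cyc h" "inv g"] h g cyc_carrier cyc_nonempty by (metis inv_closed)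
  \<comment> \<open>The lengths of \<open>A\<close> and \<open>B\<close> are not comparable a
    priori. The estimates for \<open>g\<close> and for \<open>inv g\<close> exchange their roles, so
    that they cancel in the sum.\<close>
  have "2 * rho g p + len A - C \<le> len B" using key[OF g(1) p gB A_def] c l by blast
  moreover have "2 * rho (inv g) q + len B - C \<le> len A" using key[OF _ q iA B_def] g c l by blast
  moreover have "0 \<le> rho (inv g) q" using rho_nonneg[of "inv g" q] g q h nearest_carrier cyc_carrier inv_closed by blast
  ultimately show ?thesis by linarith
qed

text \<open>Contraction of \<open>Y\<close> makes the path from \<open>y1\<close> over
  \<open>p1\<close> and \<open>p2\<close> to \<open>y2\<close> almost shortest. Its ends lie in
  \<open>W\<close>, and contraction of \<open>W\<close> makes any path between points of
  \<open>W\<close> that strays far from \<open>W\<close> wasteful; so \<open>p2\<close> is close to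
  \<open>W\<close>.\<close>

lemma fellow_travel:
  assumes C: "contracting C Y" "contracting C W" "0 \<le> C" and Y: "Y \<subseteq> carrier G" and W: "W \<subseteq> carrier G"
    and y: "y1 \<in> W" "y2 \<in> W" and p: "nearest Y y1 p1" "nearest Y y2 p2" and far: "6 * C < rho p1 p2"
  obtains w where "w \<in> W" "rho p2 w \<le> 3 * C"
proof -
  have c: "y1 \<in> carrier G" "y2 \<in> carrier G" "p1 \<in> carrier G" "p2 \<in> carrier G"
    using y W p Y nearest_carrier by blast+
  have W0: "W \<noteq> {}" using y by auto
  note ne = nearest_exists[OF W W0]
  obtain q1 where q1: "nearest W p1 q1" by (rule ne[OF c(3)])
  obtain q2 where q2: "nearest W p2 q2" by (rule ne[OF c(4)])
  have qc: "q1 \<in> carrier G" "q2 \<in> carrier G" using q1 q2 W nearest_carrier by blast+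
  have a: "rho y1 p1 + rho p1 p2 + rho p2 y2 - C \<le> rho y1 y2"
    using contractingD[OF C(1) p] far C(3) c by simp
  \<comment> \<open>Going from \<open>p\<close> to a point \<open>y\<close> of \<open>W\<close> by
    way of the projection \<open>q\<close> wastes at most 2 C.\<close>
  have b: "rho y q \<le> rho y p - rho p q + 2 * C"
    if yW: "y \<in> W" and q: "nearest W p q" and pc: "p \<in> carrier G" for y p q
  proof (cases "C < rho y q")
    case True
    have yc: "y \<in> carrier G" "q \<in> carrier G" using yW W q nearest_carrier by blast+
    have "rho y y + rho y q + rho q p - C \<le> rho y p"
      using contractingD[OF C(2) nearest_self[OF W yW] q True] yc pc by blast
    then show ?thesis using yc rho_sym[OF yc(2) pc] C(3) by simp
  next
    case False
    have "y \<in> carrier G" using yW W by blast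
    then show ?thesis using False nearest_le[OF q yW] rho_sym[of p y] pc C(3) by simp
  qed
  have b1: "rho y1 q1 \<le> rho y1 p1 - rho p1 q1 + 2 * C" using b[OF y(1) q1 c(3)] .
  have b2: "rho y2 q2 \<le> rho y2 p2 - rho p2 q2 + 2 * C" using b[OF y(2) q2 c(4)] .
  have t: "rho y1 y2 \<le> rho y1 q1 + rho q1 q2 + rho y2 q2"
    using rho_triangle[of y1 q1 y2] rho_triangle[of q1 q2 y2] rho_sym[of q2 y2] c qc by linarith
  have s: "rho y2 p2 = rho p2 y2" "rho q2 p2 = rho p2 q2" using rho_sym c qc by blast+
  have n: "0 \<le> rho p1 q1" "0 \<le> rho p2 q2" using rho_nonneg c qc by blast+
  have "rho p2 q2 \<le> 3 * C"
  proof (cases "C < rho q1 q2")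
    case True
    have "rho p1 q1 + rho q1 q2 + rho q2 p2 - C \<le> rho p1 p2"
      using contractingD[OF C(2) q1 q2 True] c by blast
    then show ?thesis using a b1 b2 t s n by linarith
  next
    \<comment> \<open>Here the estimates give \<open>rho p1 p2 \<le> 6 * C\<close>, which
      \<open>far\<close> excludes.\<close>
    case False
    then show ?thesis using a b1 b2 t s n far by linarith
  qed
  then show ?thesis using that nearest_in[OF q2] by blast
qed

text \<open>If the projection of \<open>g\<langle>h\<rangle>\<close> were unbounded, infinitely many points of \<open>\<langle>h\<rangle>\<close> would be
  close to \<open>g\<langle>h\<rangle>\<close>, and two of the connecting elements would agree.\<close>

lemma not_commensurates_bounded:
  assumes h: "h \<in> carrier G" "inj (\<lambda>i::int. h [^] i)" and C: "contracting C (cyc h)" "0 \<le> C"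
    and g: "g \<in> carrier G" "\<not> commensurates h g"
  obtains b where "\<And>y p. \<lbrakk>y \<in> g <# cyc h; nearest (cyc h) y p\<rbrakk> \<Longrightarrow> len p \<le> b"
proof -
  let ?Y = "cyc h" and ?W = "g <# cyc h"
  define Q where "Q = {p \<in> ?Y. \<exists>w\<in>?W. rho p w \<le> 3 * C}"
  have Yc: "?Y \<subseteq> carrier G" and Wc: "?W \<subseteq> carrier G" using h g l_coset_carrier by auto
  have injQ: "inj_on (\<lambda>p. inv p \<otimes> (SOME w. w \<in> ?W \<and> rho p w \<le> 3 * C)) Q"
  proof (rule inj_onI)
    fix p q assume pq: "p \<in> Q" "q \<in> Q"
      and e: "inv p \<otimes> (SOME w. w \<in> ?W \<and> rho p w \<le> 3 * C) = inv q \<otimes> (SOME w. w \<in> ?W \<and> rho q w \<le> 3 * C)"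
    have S: "(SOME w. w \<in> ?W \<and> rho p w \<le> 3 * C) \<in> ?W \<and> rho p (SOME w. w \<in> ?W \<and> rho p w \<le> 3 * C) \<le> 3 * C"
      if "p \<in> Q" for p
      by (rule someI_ex) (use that in \<open>auto simp: Q_def\<close>)
    obtain k l :: int where kl: "(SOME w. w \<in> ?W \<and> rho p w \<le> 3 * C) = g \<otimes> h [^] k"
      "(SOME w. w \<in> ?W \<and> rho q w \<le> 3 * C) = g \<otimes> h [^] l"
      using S[OF pq(1)] S[OF pq(2)] by (auto simp: l_coset_def cyc_def)
    obtain i j :: int where ij: "p = h [^] i" "q = h [^] j" using pq by (auto simp: Q_def cyc_def)
    have e': "h [^] (-i) \<otimes> (g \<otimes> h [^] k) = h [^] (-j) \<otimes> (g \<otimes> h [^] l)"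
      using e kl ij h by (simp add: int_pow_neg)
    have "h [^] j \<otimes> (h [^] (-i) \<otimes> (g \<otimes> h [^] k)) = h [^] j \<otimes> (h [^] (-j) \<otimes> (g \<otimes> h [^] l))"
      by (simp add: e')
    then have eq: "h [^] (j - i) \<otimes> (g \<otimes> h [^] k) = g \<otimes> h [^] l"
      using h g by (simp add: m_assoc[symmetric] int_pow_mult[symmetric])
    \<comment> \<open>Equal connecting elements at two points of the axis yield a relation between
      powers of \<open>h\<close> and their conjugates by \<open>g\<close>; unless the points agree,
      it makes \<open>g\<close> commensurate \<open>h\<close>.\<close>
    have "g \<otimes> h [^] (l - k) = (g \<otimes> h [^] l) \<otimes> h [^] (- k)"
      using h g by (simp add: m_assoc int_pow_mult[symmetric])
    also have "\<dots> = h [^] (j - i) \<otimes> g"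
      unfolding eq[symmetric] using h g by (simp add: m_assoc int_pow_mult[symmetric])
    finally have eq2: "g \<otimes> h [^] (l - k) = h [^] (j - i) \<otimes> g" .
    have "i = j"
    proof (rule ccontr)
      assume n: "i \<noteq> j"
      then have "l - k \<noteq> 0 \<Longrightarrow> commensurates h g" unfolding commensurates_def
        using eq2 by (intro exI[of _ "j - i"] exI[of _ "l - k"]) simp
      then have "l = k" using g(2) by auto
      then have "h [^] (j - i) \<otimes> g = g" using eq2 g by simp
      then have "h [^] (j - i) = h [^] (0::int)" using g h by simp
      then show False using inj_eq[OF h(2), of "j - i" 0] n by simp
    qed
    then show "p = q" using ij by simp
  qed
  have imQ: "(\<lambda>p. inv p \<otimes> (SOME w. w \<in> ?W \<and> rho p w \<le> 3 * C)) ` Q \<subseteq> {x \<in> carrier G. len x \<le> 3 * C}"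
  proof (rule image_subsetI)
    fix p assume p: "p \<in> Q"
    have S: "(SOME w. w \<in> ?W \<and> rho p w \<le> 3 * C) \<in> ?W \<and> rho p (SOME w. w \<in> ?W \<and> rho p w \<le> 3 * C) \<le> 3 * C"
      by (rule someI_ex) (use p in \<open>auto simp: Q_def\<close>)
    then show "inv p \<otimes> (SOME w. w \<in> ?W \<and> rho p w \<le> 3 * C) \<in> {x \<in> carrier G. len x \<le> 3 * C}"
      using p Yc Wc by (auto simp: Q_def rho_def subset_iff)
  qed
  have finQ: "finite Q" by (rule finite_imageD[OF finite_subset[OF imQ finite_ball] injQ])
  obtain p0 where p0: "nearest ?Y g p0" using nearest_exists[OF Yc cyc_nonempty g(1)] by blast
  have gW: "g \<in> ?W" using l_coset_memI[OF one_in_cyc, of g h] g by simp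
  have p0c: "p0 \<in> carrier G" using p0 Yc nearest_carrier by blast
  \<comment> \<open>A projection is either within 6 C of \<open>p0\<close>, the projection of
    \<open>g\<close> itself, or an element of the finite set \<open>Q\<close>; the sum over
    \<open>Q\<close> crudely bounds all lengths in \<open>Q\<close>.\<close>
  define b where "b = len p0 + 6 * C + (\<Sum>q\<in>Q. len q)"
  have Qc: "Q \<subseteq> carrier G" using Yc by (auto simp: Q_def)
  have pos: "0 \<le> (\<Sum>q\<in>Q. len q)" using Qc len_nonneg by (intro sum_nonneg) blast
  have "len p \<le> b" if y: "y \<in> ?W" and p: "nearest ?Y y p" for y p
  proof (cases "6 * C < rho p0 p")
    case True
    obtain w where "w \<in> ?W" "rho p w \<le> 3 * C"
      using fellow_travel[OF C(1) contracting_translate[OF C(1) Yc g(1)] C(2) Yc Wc gW y p0 p True] .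
    then have "p \<in> Q" using nearest_in[OF p] by (auto simp: Q_def)
    then have "len p \<le> (\<Sum>q\<in>Q. len q)" using finQ Qc len_nonneg by (intro member_le_sum) auto
    then show ?thesis using len_nonneg[OF p0c] C(2) by (simp add: b_def)
  next
    case False
    have pc: "p \<in> carrier G" using p Yc nearest_carrier by blast
    have "rho \<one> p \<le> rho \<one> p0 + rho p0 p" using rho_triangle p0c pc by blast
    then show ?thesis using False pos pc p0c by (simp add: b_def)
  qed
  then show ?thesis using that by blast
qed

text \<open>The conjugate lies at distance \<open>len g\<close> from
  \<open>g \<otimes> h [^] m\<close>, a point of the translated axis, and projections are coarsely
  Lipschitz. The bound is uniform in \<open>m\<close>; this permits choosing \<open>m\<close> large
  in terms of \<open>B\<close> afterwards.\<close>

lemma conj_pow_projection_bounded: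
  assumes h: "h \<in> carrier G" "inj (\<lambda>i::int. h [^] i)" and C: "contracting C (cyc h)" "0 \<le> C"
    and g: "g \<in> carrier G" "\<not> commensurates h g"
  obtains B where "0 \<le> B" "\<And>(m::int) p. nearest (cyc h) (g \<otimes> h [^] m \<otimes> inv g) p \<Longrightarrow> len p \<le> B"
proof -
  obtain b where b: "\<And>y p. \<lbrakk>y \<in> g <# cyc h; nearest (cyc h) y p\<rbrakk> \<Longrightarrow> len p \<le> b"
    using not_commensurates_bounded[OF assms] by blast
  have Yc: "cyc h \<subseteq> carrier G" using h by simp
  have "len p \<le> \<bar>b\<bar> + len g + C" if p: "nearest (cyc h) (g \<otimes> h [^] m \<otimes> inv g) p" for m :: int and p
  proof -
    have c: "g \<otimes> h [^] m \<in> carrier G" using g h by simp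
    obtain q where q: "nearest (cyc h) (g \<otimes> h [^] m) q" using nearest_exists[OF Yc cyc_nonempty c] by blast
    have pq: "p \<in> carrier G" "q \<in> carrier G" using p q Yc nearest_carrier by blast+
    have "rho q p \<le> rho (g \<otimes> h [^] m) (g \<otimes> h [^] m \<otimes> inv g) + C"
      using contracting_lipschitz[OF C(1) q p Yc C(2)] c g by simp
    then have "rho q p \<le> len g + C" using c g by (simp add: len_inv del: rho_translate)
    moreover have "len q \<le> b" using b[OF _ q] l_coset_memI by simp
    moreover have "rho \<one> p \<le> rho \<one> q + rho q p" using rho_triangle pq by blast
    ultimately show ?thesis using pq by simp
  qed
  moreover have "0 \<le> \<bar>b\<bar> + len g + C" using len_nonneg[OF g(1)] C(2) by simp
  ultimately show ?thesis using that by blast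
qed

lemma generate_cyc: "h \<in> carrier G \<Longrightarrow> generate G {h} = cyc h"
  by (auto simp: generate_pow cyc_def)

lemma subgroup_cyc: "h \<in> carrier G \<Longrightarrow> subgroup (cyc h) G"
  using generate_is_subgroup[of "{h}"] by (simp add: generate_cyc)

lemma infinite_cyc: "inj (\<lambda>i::int. h [^] i) \<Longrightarrow> infinite (cyc h)"
  unfolding cyc_def using finite_imageD infinite_UNIV_int by blast

text \<open>The remainder \<open>v\<close> leads from a nearest point on the axis to
  \<open>g\<close>. As only finitely many \<open>v\<close> are that short, the commensurating
  elements lie in finitely many cosets of the cyclic subgroup.\<close>

lemma commensurates_decompose:
  assumes h: "h \<in> carrier G" "inj (\<lambda>i::int. h [^] i)" and C: "contracting C (cyc h)"
    and g: "g \<in> carrier G" "commensurates h g"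
  obtains i :: int and v where "v \<in> carrier G" "len v \<le> C" "g = h [^] i \<otimes> v"
proof -
  obtain p where p: "nearest (cyc h) g p"
    using nearest_exists[OF cyc_carrier[OF h(1)] cyc_nonempty g(1)] by blast
  obtain i :: int where i: "p = h [^] i" using nearest_in[OF p] by (rule cycE)
  have "rho g p \<le> C" by (rule commensurates_close[OF assms p])
  then have "len (inv p \<otimes> g) \<le> C" using rho_sym[of g p] g h i by (simp add: rho_def)
  then show ?thesis using that[of "inv p \<otimes> g" i] g h i by simp
qed

text \<open>Otherwise the short remainders would represent all cosets of an infinite cyclic
  subgroup, which would then have finite index.\<close>

lemma not_all_commensurate:
  assumes h: "h \<in> carrier G" "inj (\<lambda>i::int. h [^] i)" and C: "contracting C (cyc h)"
    and ne: "\<not> elementary_group G"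
  obtains g where "g \<in> carrier G" "\<not> commensurates h g"
proof -
  have "\<not> (\<forall>g\<in>carrier G. commensurates h g)"
  proof
    assume all: "\<forall>g\<in>carrier G. commensurates h g"
    have "rcosets (cyc h) \<subseteq> (\<lambda>v. cyc h #> v) ` {v \<in> carrier G. len v \<le> C}"
    proof
      fix A assume "A \<in> rcosets (cyc h)"
      then obtain g where g: "g \<in> carrier G" "A = cyc h #> g" by (auto simp: RCOSETS_def)
      obtain i :: int and v where v: "v \<in> carrier G" "len v \<le> C" "g = h [^] i \<otimes> v"
        using commensurates_decompose[OF h C g(1)] all g by blast
      have "g \<in> cyc h #> v" using v pow_in_cyc by (auto simp: r_coset_def)
      then have "cyc h #> v = A" using repr_independence[OF _ v(1) subgroup_cyc[OF h(1)]] g by blast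
      then show "A \<in> (\<lambda>v. cyc h #> v) ` {v \<in> carrier G. len v \<le> C}" using v by blast
    qed
    then have "finite (rcosets (cyc h))" using finite_ball finite_surj by blast
    then show False using ne h infinite_cyc unfolding elementary_group_def
      by (metis generate_cyc)
  qed
  then show ?thesis using that by blast
qed

text \<open>If all of \<open>N\<close> commensurated \<open>h\<close>, two elements of
  \<open>N\<close> with the same short remainder would show that \<open>N\<close> contains a
  nontrivial power of \<open>h\<close>. For any \<open>g\<close> the conjugates of its powers by
  \<open>g\<close> again lie in \<open>N\<close>, and the same pigeonhole argument, applied to them,
  shows that \<open>g\<close> commensurates \<open>h\<close>. So the whole group would.\<close>

lemma normal_not_commensurate:
  assumes h: "h \<in> carrier G" "inj (\<lambda>i::int. h [^] i)" and C: "contracting C (cyc h)"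
    and ne: "\<not> elementary_group G" and N: "N \<lhd> G" "infinite N"
  obtains f where "f \<in> N" "\<not> commensurates h f"
proof -
  interpret N: normal N G by (rule N(1))
  have powN: "x [^] (i::int) \<in> N" if "x \<in> N" for x i
    using that subgroup_int_pow_closed[OF N.subgroup_axioms] by blast
  have "\<not> (\<forall>f\<in>N. commensurates h f)"
  proof
    assume all: "\<forall>f\<in>N. commensurates h f"
    have pigeon: "\<exists>x y i. x \<in> S \<and> y \<in> S \<and> x \<noteq> y \<and> x \<otimes> inv y = h [^] (i::int)" if S: "infinite S" "S \<subseteq> N" for S
    proof -
      have "\<exists>v. \<exists>i::int. v \<in> {v \<in> carrier G. len v \<le> C} \<and> f = h [^] i \<otimes> v" if "f \<in> S" for f
        using commensurates_decompose[OF h C, of f] all S(2) that N.subset by blast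
      then obtain V where V: "\<And>f. f \<in> S \<Longrightarrow> V f \<in> {v \<in> carrier G. len v \<le> C}"
        "\<And>f. f \<in> S \<Longrightarrow> \<exists>i::int. f = h [^] i \<otimes> V f" by metis
      have "\<not> inj_on V S"
        using V(1) S(1) finite_ball by (meson finite_imageD finite_subset image_subsetI)
      then obtain x y where xy: "x \<in> S" "y \<in> S" "x \<noteq> y" "V x = V y" by (auto simp: inj_on_def)
      obtain i j :: int where ij: "x = h [^] i \<otimes> V x" "y = h [^] j \<otimes> V x" using V(2) xy by metis
      have Vc: "V x \<in> carrier G" using V(1) xy(1) by blast
      have "x \<otimes> inv y = h [^] i \<otimes> V x \<otimes> inv (h [^] j \<otimes> V x)" using ij by simp
      also have "\<dots> = h [^] i \<otimes> inv (h [^] j)" using Vc h by (simp add: inv_mult_group m_assoc)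
      also have "\<dots> = h [^] (i - j)" using h by (simp add: int_pow_diff)
      finally show ?thesis using xy by blast
    qed
    obtain x y a where xy: "x \<in> N" "y \<in> N" "x \<noteq> y" "x \<otimes> inv y = h [^] (a::int)"
      using pigeon[OF N(2)] by blast
    then have aN: "h [^] a \<in> N" using N.m_closed N.m_inv_closed by metis
    have a0: "a \<noteq> 0"
    proof
      assume "a = 0"
      then have "inv (inv y) = x" using xy N.subset by (intro inv_equality) auto
      then show False using xy N.subset by auto
    qed
    have "commensurates h g" if g: "g \<in> carrier G" for g
    proof -
      define q where "q = (\<lambda>n::int. g \<otimes> h [^] (a * n) \<otimes> inv g)"
      have q: "q n \<in> N" for n
        using N.inv_op_closed2[OF g powN[OF aN, of n]] h by (simp add: q_def int_pow_pow)
      have injq: "inj q"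
      proof (rule injI)
        fix m n assume "q m = q n"
        then have "h [^] (a * m) = h [^] (a * n)" using g h by (simp add: q_def)
        then show "m = n" using inj_eq[OF h(2)] a0 by simp
      qed
      then have "infinite (range q)" using finite_imageD infinite_UNIV_int by blast
      then obtain m n i where mn: "q m \<noteq> q n" "q m \<otimes> inv (q n) = h [^] (i::int)"
        using pigeon[of "range q"] q by blast
      have "q m \<otimes> inv (q n) = g \<otimes> (h [^] (a * m) \<otimes> inv (h [^] (a * n))) \<otimes> inv g"
        using g h by (simp add: q_def inv_mult_group m_assoc)
      also have "\<dots> = g \<otimes> h [^] (a * (m - n)) \<otimes> inv g"
        using h by (simp add: int_pow_diff[symmetric] right_diff_distrib)
      finally have "h [^] i = g \<otimes> h [^] (a * (m - n)) \<otimes> inv g" using mn by simp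
      then have e: "g \<otimes> h [^] (a * (m - n)) = h [^] i \<otimes> g" using g h by (simp add: m_assoc)
      have nz: "a * (m - n) \<noteq> 0" using mn a0 by auto
      moreover have "i \<noteq> 0"
      proof
        assume "i = 0"
        then have "h [^] (a * (m - n)) = h [^] (0::int)" using e g h by simp
        then show False using inj_eq[OF h(2), of "a * (m - n)" 0] nz by simp
      qed
      ultimately show ?thesis using e unfolding commensurates_def by blast
    qed
    then show False using not_all_commensurate[OF h C ne] by blast
  qed
  then show ?thesis using that by blast
qed

text \<open>The axis of \<open>w u\<close>, with \<open>w\<close> a long power of \<open>h\<close>, passes through the translates of
  \<open>\<langle>h\<rangle>\<close> by the powers of \<open>w u\<close>. A point is called right of the \<open>k\<close>-th translate if it
  projects near its exit point, left of it if it projects near its entry point. The coarse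
  projection of a point to the axis is where it changes from right to left.\<close>

lemma alternating_contracting:
  fixes m :: int
  assumes h: "h \<in> carrier G" and C: "contracting C (cyc h)" "0 \<le> C" and u: "u \<in> carrier G" and B: "0 \<le> B"
    and pu: "\<And>p. nearest (cyc h) u p \<Longrightarrow> len p \<le> B"
    and pu': "\<And>p. nearest (cyc h) (inv u) p \<Longrightarrow> len p \<le> B"
    and lu: "2 * B + C < len u" and lw: "2 * B + 3 * C < len (h [^] m)"
  shows "inj (\<lambda>i::int. (h [^] m \<otimes> u) [^] i)" "\<exists>K\<ge>0. contracting K (cyc (h [^] m \<otimes> u))"
proof -
  define w where "w = h [^] m"
  define c where "c = w \<otimes> u"
  define Y where "Y = cyc h"
  \<comment> \<open>The axis meets \<open>Z k\<close> from the entry point \<open>c [^] k\<close> to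
    the exit point \<open>ep k\<close>; from there \<open>u\<close> leads to the entry point of
    \<open>Z (k + 1)\<close>. \<open>R\<close> and \<open>L\<close> formalise right and
    left.\<close>
  define Z where "Z = (\<lambda>k::int. (c [^] k) <# Y)"
  define ep where "ep = (\<lambda>k::int. c [^] k \<otimes> w)"
  define B1 where "B1 = B + C"
  define R where "R = (\<lambda>k x. \<forall>p. nearest (Z k) x p \<longrightarrow> rho (ep k) p \<le> B1)"
  define L where "L = (\<lambda>k x. \<forall>p. nearest (Z k) x p \<longrightarrow> rho (c [^] k) p \<le> B1)"
  define D where "D = 4 * B1 + C"
  have B1: "0 \<le> B1" "B \<le> B1" using B C by (auto simp: B1_def)
  have wc: "w \<in> carrier G" using h by (simp add: w_def)
  have cc: "c \<in> carrier G" using wc u by (simp add: c_def)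
  have epc: "ep k \<in> carrier G" for k using cc wc by (simp add: ep_def)
  have Yc: "Y \<subseteq> carrier G" "Y \<noteq> {}" using h by (auto simp: Y_def)
  have Zc: "Z k \<subseteq> carrier G" for k using l_coset_carrier Yc cc by (simp add: Z_def)
  have emZ: "c [^] k \<in> Z k" for k
    using l_coset_memI[OF one_in_cyc, of "c [^] k" h] cc by (simp add: Z_def Y_def)
  have epZ: "ep k \<in> Z k" for k
    using l_coset_memI[OF pow_in_cyc, of "c [^] k" h m] by (simp add: Z_def Y_def ep_def w_def)
  have Zne: "Z k \<noteq> {}" for k using emZ by blast
  have Zcon: "contracting C (Z k)" for k
    using contracting_translate[OF C(1)] h cc by (simp add: Z_def Y_def)
  have em_ep: "rho (c [^] k) (ep k) = len w" for k using cc wc by (simp add: ep_def)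
  have ep_em: "c [^] (k + 1) = ep k \<otimes> u" for k
    using cc wc u by (simp add: int_pow_mult c_def ep_def m_assoc)
  have wY: "w <# Y = Y" using pow_coset_cyc[OF h, of m] by (simp add: w_def Y_def)
  have Zep: "Z k = ep k <# Y" for k
    using l_coset_mult[of "c [^] k" w Y] cc wc Yc wY by (simp add: Z_def ep_def)
  have near1: "rho (ep k) p \<le> B" if "nearest (Z k) (c [^] (k + 1)) p" for k p
  proof -
    have "nearest (ep k <# Y) (ep k \<otimes> u) p" using that by (simp add: Zep ep_em)
    then obtain p' where p': "p = ep k \<otimes> p'" "nearest Y u p'"
      using nearest_translateD[OF _ Yc(1) u epc] by blast
    then have "p' \<in> carrier G" using Yc nearest_carrier by blast
    then show ?thesis using p' pu epc by (simp add: Y_def)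
  qed
  have near2: "rho (c [^] (k + 1)) p \<le> B" if "nearest (Z (k + 1)) (ep k) p" for k p
  proof -
    have "ep k = c [^] (k + 1) \<otimes> inv u" using epc u by (simp add: ep_em m_assoc)
    then have "nearest (c [^] (k + 1) <# Y) (c [^] (k + 1) \<otimes> inv u) p" using that by (simp add: Z_def)
    then obtain p' where p': "p = c [^] (k + 1) \<otimes> p'" "nearest Y (inv u) p'"
      using nearest_translateD[OF _ Yc(1), of "c [^] (k + 1)" "inv u" p] u cc by blast
    then have "p' \<in> carrier G" using Yc nearest_carrier by blast
    then show ?thesis using p' pu' cc by (simp add: Y_def)
  qed
  \<comment> \<open>The Behrstock alternative for the exit point of one translate and the entry
    point of the next; the length of \<open>u\<close> keeps these two points apart.\<close>
  have RL: "R k x \<or> L (k + 1) x" if x: "x \<in> carrier G" for k x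
  proof (rule ccontr)
    assume n: "\<not> (R k x \<or> L (k + 1) x)"
    then obtain q q' where q: "nearest (Z k) x q" "\<not> rho (ep k) q \<le> B1"
      "nearest (Z (k + 1)) x q'" "\<not> rho (c [^] (k + 1)) q' \<le> B1" by (auto simp: R_def L_def)
    have "2 * B + C < rho (ep k) (c [^] (k + 1))" using lu epc u by (simp add: ep_em)
    then have "rho (ep k) q \<le> B + C \<or> rho (c [^] (k + 1)) q' \<le> B + C"
      using behrstock[OF Zcon Zcon C(2) Zc Zne Zc Zne epc _ x near1 near2 _ q(1) q(3)] cc by simp
    then show False using q by (simp add: B1_def)
  qed
  have nRL: "\<not> (R k x \<and> L k x)" if x: "x \<in> carrier G" for k x
  proof
    assume RL: "R k x \<and> L k x"
    obtain p where p: "nearest (Z k) x p" using nearest_exists[OF Zc Zne x] by blast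
    have pc: "p \<in> carrier G" using p Zc nearest_carrier by blast
    have "rho (c [^] k) (ep k) \<le> rho (c [^] k) p + rho (ep k) p"
      using rho_triangle[of "c [^] k" p "ep k"] rho_sym[of p "ep k"] pc epc cc by simp
    then show False using RL p em_ep lw C by (fastforce simp: R_def L_def w_def[symmetric] B1_def)
  qed
  \<comment> \<open>A point left of one translate is not right of it, hence left of the next one by
    \<open>RL\<close>. This makes the position monotone in the index.\<close>
  have Lup: "L j x" if "L k x" "k \<le> j" "x \<in> carrier G" for j k x
    using that(2,1)
  proof (induction j rule: int_ge_induct)
    case (step i)
    then show ?case using RL[of x i] nRL[of x i] that(3) by blast
  qed
  have Rdown: "R j x" if R: "R k x" "j \<le> k" "x \<in> carrier G" for j k x
  proof (rule ccontr)
    assume "\<not> R j x"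
    then have "L (j + 1) x" using RL[of x j] R by blast
    moreover have "j < k" using \<open>\<not> R j x\<close> R by (cases "j = k") auto
    ultimately have "L k x" using Lup[of "j + 1" x k] R by simp
    then show False using nRL R by blast
  qed
  have Lc: "L j (c [^] k)" if "k \<le> j" for j k
  proof -
    have "rho (c [^] k) p \<le> B1" if "nearest (Z k) (c [^] k) p" for p
      using nearest_le[OF that emZ] cc B1 by simp
    then have "L k (c [^] k)" unfolding L_def by blast
    then show ?thesis using Lup that cc by simp
  qed
  have Rc: "R j (c [^] k)" if "j < k" for j k
  proof -
    have "R (k - 1) (c [^] k)" unfolding R_def using near1[of "k - 1"] B1 by fastforce
    then show ?thesis using Rdown that cc by simp
  qed
  have inj: "inj (\<lambda>i::int. c [^] i)"
  proof (rule linorder_injI)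
    fix j k :: int assume "j < k"
    then show "c [^] j \<noteq> c [^] k" using Lc[of j j] Rc[of j k] nRL[of "c [^] j" j] cc by auto
  qed
  have key: "rho x (c [^] k) + len w + rho (ep k) y - D \<le> rho x y"
    if L: "L k x" and R: "R k y" and x: "x \<in> carrier G" "y \<in> carrier G" for k x y
  proof -
    obtain p where p: "nearest (Z k) x p" using nearest_exists[OF Zc Zne x(1)] by blast
    obtain q where q: "nearest (Z k) y q" using nearest_exists[OF Zc Zne x(2)] by blast
    have pq: "p \<in> carrier G" "q \<in> carrier G" "c [^] k \<in> carrier G" using p q Zc nearest_carrier cc by blast+
    have b: "rho (c [^] k) p \<le> B1" "rho (ep k) q \<le> B1" using L R p q by (auto simp: L_def R_def)
    have t: "len w \<le> rho (c [^] k) p + rho p q + rho (ep k) q"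
      using rho_triangle[of "c [^] k" p "ep k"] rho_triangle[of p q "ep k"] rho_sym[of q "ep k"]
        pq epc[of k] em_ep[of k] by linarith
    \<comment> \<open>Entry and exit points are \<open>len w\<close> apart and each projection loses
      \<open>B1 = B + C\<close>; the lower bound 2 B + 3 C on the length of \<open>w\<close> leaves
      more than \<open>C\<close>.\<close>
    then have "C < rho p q" using b lw C by (simp add: w_def[symmetric] B1_def)
    then have "rho x p + rho p q + rho q y - C \<le> rho x y" using contractingD[OF Zcon p q] x by blast
    moreover have "rho x (c [^] k) \<le> rho x p + rho (c [^] k) p" "rho (ep k) y \<le> rho (ep k) q + rho q y"
      using rho_triangle rho_sym pq epc x by metis+
    ultimately show ?thesis using b t unfolding D_def by linarith
  qed
  \<comment> \<open>For a point left of all translates, a path to the identity would have to pass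
    \<open>c [^] k\<close> for every negative \<open>k\<close>, however far away.\<close>
  have ex1: "\<exists>k. R k x" if x: "x \<in> carrier G" for x
  proof (rule ccontr)
    assume n: "\<nexists>k. R k x"
    have L: "L k x" for k using RL[OF x, of "k - 1"] n by simp
    obtain n where n: "n > 0" "\<And>j::int. int n \<le> \<bar>j\<bar> \<Longrightarrow> len x + D + len w < len (c [^] j)"
      using large_pow[OF cc inj] by blast
    let ?k = "- int n"
    have "rho x (c [^] ?k) + len w + rho (ep ?k) \<one> - D \<le> rho x \<one>"
      using key[OF L _ x one_closed, of ?k] Rc[of ?k 0] n by simp
    moreover have "len (c [^] ?k) \<le> rho (ep ?k) \<one> + len w"
      using rho_triangle[of \<one> "ep ?k" "c [^] ?k"] rho_sym[of \<one> "ep ?k"] rho_sym[of "ep ?k" "c [^] ?k"] em_ep[of ?k] epc[of ?k] cc by simp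
    moreover have "len x + D + len w < len (c [^] ?k)" using n by simp
    moreover have "0 \<le> rho x (c [^] ?k)" "rho x \<one> = len x" using rho_nonneg[of x "c [^] ?k"] rho_sym[of x \<one>] x cc by auto
    ultimately show False using len_nonneg[OF wc] by linarith
  qed
  have ex2: "\<exists>k. \<not> R k x" if x: "x \<in> carrier G" for x
  proof (rule ccontr)
    assume n: "\<nexists>k. \<not> R k x"
    obtain n where n': "n > 0" "\<And>j::int. int n \<le> \<bar>j\<bar> \<Longrightarrow> len x + D < len (c [^] j)"
      using large_pow[OF cc inj] by blast
    have "rho \<one> (c [^] int n) + len w + rho (ep (int n)) x - D \<le> rho \<one> x"
      using key[OF _ _ one_closed x, of "int n"] Lc[of 0 "int n"] n by simp
    moreover have "len x + D < len (c [^] int n)" using n' by simp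
    ultimately show False using rho_nonneg[of "ep (int n)" x] len_nonneg[OF wc] epc cc x by simp
  qed
  have ex: "\<exists>i. \<not> R i x \<and> (\<forall>j<i. R j x) \<and> (\<forall>j>i. L j x)" if x: "x \<in> carrier G" for x
  proof -
    obtain k0 k1 where k: "R k0 x" "\<not> R k1 x" using ex1 ex2 x by blast
    have "k0 \<le> k1" using Rdown[OF k(1) _ x, of k1] k(2) by linarith
    have "\<exists>i. R i x \<and> \<not> R (i + 1) x"
    proof (rule ccontr)
      assume "\<nexists>i. R i x \<and> \<not> R (i + 1) x"
      then have s: "R i x \<Longrightarrow> R (i + 1) x" for i by blast
      have "R k1 x" using \<open>k0 \<le> k1\<close> by (induction rule: int_ge_induct) (use k s in auto)
      then show False using k by blast
    qed
    then obtain i where i: "R i x" "\<not> R (i + 1) x" by blast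
    have "L (i + 1 + 1) x" using RL[OF x, of "i + 1"] i by blast
    then have "\<forall>j>i + 1. L j x" using Lup x by simp
    moreover have "\<forall>j<i + 1. R j x" using Rdown i x by simp
    ultimately show ?thesis using i(2) by blast
  qed
  \<comment> \<open>\<open>I x\<close> is the first index whose translate does not have
    \<open>x\<close> on its right, and \<open>c [^] I x\<close> serves as the coarse projection of
    \<open>x\<close>.\<close>
  obtain I where I': "\<And>x. x \<in> carrier G \<Longrightarrow> \<not> R (I x) x \<and> (\<forall>j<I x. R j x) \<and> (\<forall>j>I x. L j x)"
    using ex by metis
  have I: "\<not> R (I x) x" "j < I x \<Longrightarrow> R j x" "j > I x \<Longrightarrow> L j x" if "x \<in> carrier G" for x j
    using I'[OF that] by blast+
  have Ic: "I (c [^] k) = k" for k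
  proof -
    have ck: "c [^] k \<in> carrier G" using cc by simp
    have "\<not> I (c [^] k) < k" using I(1)[OF ck] Rc by blast
    moreover have "\<not> k < I (c [^] k)" using I(2)[OF ck] Lc[of k k] nRL[OF ck] by blast
    ultimately show ?thesis by linarith
  qed
  \<comment> \<open>The crossing estimate \<open>key\<close> is applied to the translates
    \<open>I x + 1\<close> and \<open>I y - 1\<close>, each time losing \<open>D\<close>; passing
    between neighbouring powers of \<open>c\<close> costs \<open>len c\<close> three times and
    \<open>len u\<close> once.\<close>
  define K where "K = 2 * D + 3 * len c + len u"
  have D0: "0 \<le> D" using B1 C by (simp add: D_def)
  have K: "0 \<le> K" "len c \<le> K" using D0 len_nonneg cc u by (simp_all add: K_def)
  have dist1: "rho x (c [^] I x) + rho (c [^] I x) (c [^] I y) + rho (c [^] I y) y - K \<le> rho x y"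
    if lt: "I x + 2 \<le> I y" and xy: "x \<in> carrier G" "y \<in> carrier G" for x y
  proof -
    let ?a = "c [^] I x" and ?a1 = "c [^] (I x + 1)" and ?b = "c [^] I y" and ?b1 = "c [^] (I y - 1)"
    have ac: "?a \<in> carrier G" "?a1 \<in> carrier G" "?b \<in> carrier G" "?b1 \<in> carrier G" using cc by auto
    have ra: "rho ?a ?a1 = len c" "rho ?b1 ?b = len c" using cc by (simp_all add: rho_pow)
    have rb: "rho (ep (I y - 1)) ?b = len u" using ep_em[of "I y - 1"] epc u by simp
    have 1: "rho x ?a1 + len w + rho (ep (I x + 1)) y - D \<le> rho x y"
      using key[OF I(3)[OF xy(1)] I(2)[OF xy(2)] xy, of "I x + 1"] lt by simp
    have 2: "rho ?a ?b1 + len w + rho (ep (I y - 1)) y - D \<le> rho ?a y"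
      using key[OF Lc I(2)[OF xy(2)] ac(1) xy(2), of "I y - 1"] lt by simp
    have 3: "rho x ?a \<le> rho x ?a1 + len c" using rho_triangle[of x ?a1 ?a] rho_sym[of ?a1 ?a] ra xy ac by simp
    have 4: "rho ?a y \<le> len c + len w + rho (ep (I x + 1)) y"
      using rho_triangle[of ?a ?a1 y] rho_triangle[of ?a1 "ep (I x + 1)" y] em_ep[of "I x + 1"] ra xy ac epc by simp
    have 5: "rho ?a ?b \<le> rho ?a ?b1 + len c" using rho_triangle[of ?a ?b1 ?b] ra ac by simp
    have 6: "rho ?b y \<le> len u + rho (ep (I y - 1)) y"
      using rho_triangle[of ?b "ep (I y - 1)" y] rho_sym[of ?b "ep (I y - 1)"] rb xy ac epc by simp
    show ?thesis using 1 2 3 4 5 6 len_nonneg[OF wc] unfolding K_def by linarith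
  qed
  have dist2: "rho x (c [^] I x) + rho (c [^] I x) (c [^] I y) + rho (c [^] I y) y - K \<le> rho x y"
    if far: "K < rho (c [^] I x) (c [^] I y)" and xy: "x \<in> carrier G" "y \<in> carrier G" for x y
  proof -
    have cI: "c [^] I x \<in> carrier G" "c [^] I y \<in> carrier G" using cc by auto
    \<comment> \<open>Neighbouring indices have projections at distance
      \<open>len c \<le> K\<close>, so a larger distance leaves a translate strictly between the two
      indices.\<close>
    have "I y - I x \<noteq> 0" "I y - I x \<noteq> 1" "I y - I x \<noteq> -1"
      using far K cc by (auto simp: rho_pow len_one len_inv int_pow_neg)
    then consider "I x + 2 \<le> I y" | "I y + 2 \<le> I x" by linarith
    then show ?thesis
    proof cases
      case 2
      show ?thesis
        using dist1[OF 2 xy(2,1)] rho_sym[OF xy] rho_sym[OF cI] rho_sym[OF xy(1) cI(1)] rho_sym[OF xy(2) cI(2)]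
        by linarith
    qed (use dist1 xy in blast)
  qed
  have "contracting (9 * K) (cyc c)"
  proof (rule contractingI)
    show "cyc c \<subseteq> carrier G" using cc by simp
    show "0 \<le> K" by (rule K)
    fix x y p q assume xy: "x \<in> carrier G" "y \<in> carrier G" and pq: "p \<in> cyc c" "q \<in> cyc c"
    have pqc: "p \<in> carrier G" "q \<in> carrier G" using pq cyc_carrier[OF cc] by blast+
    have fixp: "c [^] I z = z" if "z \<in> cyc c" for z using that Ic by (auto elim: cycE)
    show "\<exists>\<pi>. \<pi> ` {x, y, p, q} \<subseteq> cyc c \<and> rho p (\<pi> p) \<le> K \<and> rho q (\<pi> q) \<le> K \<and>
        (\<forall>u\<in>{x, y, p, q}. \<forall>w\<in>{x, y, p, q}. K < rho (\<pi> u) (\<pi> w) \<longrightarrow>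
          rho u (\<pi> u) + rho (\<pi> u) (\<pi> w) + rho (\<pi> w) w - K \<le> rho u w)"
    proof (intro exI[of _ "\<lambda>x. c [^] I x"] conjI ballI impI)
      fix v w assume "v \<in> {x, y, p, q}" "w \<in> {x, y, p, q}" "K < rho (c [^] I v) (c [^] I w)"
      then show "rho v (c [^] I v) + rho (c [^] I v) (c [^] I w) + rho (c [^] I w) w - K \<le> rho v w"
        using xy pqc by (intro dist2) auto
    qed (use fixp pq pqc K in auto)
  qed
  then show "\<exists>K\<ge>0. contracting K (cyc (h [^] m \<otimes> u))" using K by (auto simp: c_def w_def intro!: exI[of _ "9 * K"])
  show "inj (\<lambda>i::int. (h [^] m \<otimes> u) [^] i)" using inj by (simp add: c_def w_def)
qed

text \<open>The commutator follows the axis of \<open>h\<close> for a long time and then its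
  translate by \<open>g\<close>, to which it projects boundedly. Conjugation by \<open>g\<close>
  shortens a power by at most \<open>2 * len g\<close>, so one large \<open>m\<close> makes both
  pieces long. The form of the element matters: it lies in every normal subgroup containing
  \<open>g\<close>.\<close>

lemma contracting_commutator:
  assumes h: "h \<in> carrier G" "inj (\<lambda>i::int. h [^] i)" and C: "contracting C (cyc h)" "0 \<le> C"
    and g: "g \<in> carrier G" "\<not> commensurates h g"
  obtains m :: int and K where "0 \<le> K"
    "contracting K (cyc (h [^] m \<otimes> (g \<otimes> inv (h [^] m) \<otimes> inv g)))"
    "inj (\<lambda>i::int. (h [^] m \<otimes> (g \<otimes> inv (h [^] m) \<otimes> inv g)) [^] i)"
proof -
  obtain B where B: "0 \<le> B" "\<And>(m::int) p. nearest (cyc h) (g \<otimes> h [^] m \<otimes> inv g) p \<Longrightarrow> len p \<le> B"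
    using conj_pow_projection_bounded[OF assms] by blast
  obtain n where n: "n > 0" "\<And>j::int. int n \<le> \<bar>j\<bar> \<Longrightarrow> 2 * B + 3 * C + 2 * len g < len (h [^] j)"
    using large_pow[OF h] by blast
  define m where "m = int n"
  define u where "u = g \<otimes> inv (h [^] m) \<otimes> inv g"
  have uc: "u \<in> carrier G" using g h by (simp add: u_def)
  have u: "u = g \<otimes> h [^] (- m) \<otimes> inv g" "inv u = g \<otimes> h [^] m \<otimes> inv g"
    using g h by (simp_all add: u_def int_pow_neg inv_mult_group m_assoc)
  have "len (h [^] m) = len (inv g \<otimes> inv u \<otimes> g)"
    unfolding u(2) using g h by (simp add: m_assoc)
  also have "\<dots> \<le> len g + len u + len g"
    using len_mult[of "inv g \<otimes> inv u" g] len_mult[of "inv g" "inv u"] g uc by (simp add: len_inv)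
  finally have "2 * B + C < len u" "2 * B + 3 * C < len (h [^] m)"
    using n(2)[of m] len_nonneg[OF g(1)] C by (simp_all add: m_def)
  then have "inj (\<lambda>i::int. (h [^] m \<otimes> u) [^] i)" "\<exists>K\<ge>0. contracting K (cyc (h [^] m \<otimes> u))"
    using alternating_contracting[OF h(1) C uc B(1)] B(2)[of "- m", folded u(1)] B(2)[of m, folded u(2)] by blast+
  then show ?thesis using that unfolding u_def by blast
qed

end

section \<open>Growth rates\<close>

text \<open>Convergence of the Poincare series at \<alpha>, expressed by bounded finite partial
  sums.\<close>

definition exp_summable :: "'t set \<Rightarrow> ('t \<Rightarrow> real) \<Rightarrow> real \<Rightarrow> bool" where
  "exp_summable T l \<alpha> \<longleftrightarrow> (\<exists>K. \<forall>F. finite F \<and> F \<subseteq> T \<longrightarrow> (\<Sum>t\<in>F. exp (- \<alpha> * l t)) \<le> K)"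

definition exp_lower :: "'t set \<Rightarrow> ('t \<Rightarrow> real) \<Rightarrow> real \<Rightarrow> bool" where
  "exp_lower T l \<sigma> \<longleftrightarrow> (\<exists>\<kappa>>0. \<forall>r\<ge>0. \<kappa> * exp (\<sigma> * r) \<le> real (card {t \<in> T. l t \<le> r}))"

text \<open>More than a growth exponent: the lower bound is purely exponential at
  \<open>\<delta>\<close> itself, without subexponential loss. For positive \<open>\<delta>\<close>
  this is what makes the series diverge at \<open>\<delta>\<close>.\<close>

definition growth_rate :: "'t set \<Rightarrow> ('t \<Rightarrow> real) \<Rightarrow> real \<Rightarrow> bool" where
  "growth_rate T l \<delta> \<longleftrightarrow> 0 \<le> \<delta> \<and> (\<forall>r. finite {t \<in> T. l t \<le> r}) \<and>
     exp_lower T l \<delta> \<and> (\<forall>\<alpha>>\<delta>. exp_summable T l \<alpha>)"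

text \<open>Grouping by the integer part of \<open>l\<close> compares the series with a geometric
  series of ratio \<open>exp (\<sigma> - \<alpha>)\<close>.\<close>

lemma exp_summableI:
  fixes l :: "'t \<Rightarrow> real"
  assumes fin: "\<And>r. finite {t \<in> T. l t \<le> r}" and l: "\<And>t. t \<in> T \<Longrightarrow> 0 \<le> l t" and s: "\<sigma> < \<alpha>" "0 \<le> \<alpha>"
    and b: "\<And>r. 0 \<le> r \<Longrightarrow> real (card {t \<in> T. l t \<le> r}) \<le> K * exp (\<sigma> * r)"
  shows "exp_summable T l \<alpha>"
  unfolding exp_summable_def
proof (intro exI allI impI, elim conjE)
  fix F assume F: "finite F" "F \<subseteq> T"
  define x where "x = exp (\<sigma> - \<alpha>)"
  have x: "0 < x" "x < 1" using s by (auto simp: x_def)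
  have "0 \<le> K * exp (\<sigma> * 0)" using b[of 0] by (meson of_nat_0_le_iff order_trans order_refl)
  then have K: "0 \<le> K" by simp
  define n where "n = Suc (Max (insert 0 ((\<lambda>t. nat \<lfloor>l t\<rfloor>) ` F)))"
  have im: "(\<lambda>t. nat \<lfloor>l t\<rfloor>) ` F \<subseteq> {..<n}"
    using F by (auto simp: n_def less_Suc_eq_le)
  have "(\<Sum>t\<in>F. exp (- \<alpha> * l t)) = (\<Sum>k<n. \<Sum>t\<in>{t \<in> F. nat \<lfloor>l t\<rfloor> = k}. exp (- \<alpha> * l t))"
    using sum.group[OF F(1) _ im, of "\<lambda>t. exp (- \<alpha> * l t)"] by simp
  also have "\<dots> \<le> (\<Sum>k<n. K * exp \<sigma> * x ^ k)"
  proof (rule sum_mono)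
    fix k assume "k \<in> {..<n}"
    have "(\<Sum>t\<in>{t \<in> F. nat \<lfloor>l t\<rfloor> = k}. exp (- \<alpha> * l t)) \<le> (\<Sum>t\<in>{t \<in> F. nat \<lfloor>l t\<rfloor> = k}. exp (- \<alpha> * real k))"
    proof (rule sum_mono)
      fix t assume t: "t \<in> {t \<in> F. nat \<lfloor>l t\<rfloor> = k}"
      then have "real k \<le> l t" using l F by (auto simp: subset_iff)
      then show "exp (- \<alpha> * l t) \<le> exp (- \<alpha> * real k)" using s by (simp add: mult_left_mono)
    qed
    also have "\<dots> = real (card {t \<in> F. nat \<lfloor>l t\<rfloor> = k}) * exp (- \<alpha> * real k)" by simp
    also have "\<dots> \<le> real (card {t \<in> T. l t \<le> real k + 1}) * exp (- \<alpha> * real k)"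
    proof -
      have "{t \<in> F. nat \<lfloor>l t\<rfloor> = k} \<subseteq> {t \<in> T. l t \<le> real k + 1}" using F l by auto
      then show ?thesis using card_mono[OF fin] by (intro mult_right_mono) auto
    qed
    also have "\<dots> \<le> K * exp (\<sigma> * (real k + 1)) * exp (- \<alpha> * real k)"
      using b[of "real k + 1"] by (intro mult_right_mono) auto
    also have "\<dots> = K * exp \<sigma> * x ^ k"
      by (simp add: x_def exp_of_nat_mult[symmetric] exp_add[symmetric] mult.assoc algebra_simps)
    finally show "(\<Sum>t\<in>{t \<in> F. nat \<lfloor>l t\<rfloor> = k}. exp (- \<alpha> * l t)) \<le> K * exp \<sigma> * x ^ k" .
  qed
  also have "\<dots> = K * exp \<sigma> * (\<Sum>k<n. x ^ k)" by (simp add: sum_distrib_left)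
  also have "\<dots> \<le> K * exp \<sigma> * (1 / (1 - x))"
    using x K by (intro mult_left_mono) (auto simp: sum_gp_strict divide_right_mono)
  finally show "(\<Sum>t\<in>F. exp (- \<alpha> * l t)) \<le> K * exp \<sigma> * (1 / (1 - x))" .
qed

text \<open>Each element of the ball of radius \<open>r\<close> contributes at least
  \<open>exp (- \<alpha> * r)\<close> to the series. The normalisation \<open>1 \<le> K\<close>
  makes \<open>ln K\<close> nonnegative where the logarithm is taken.\<close>

lemma exp_summable_card:
  assumes "exp_summable T l \<alpha>" "0 \<le> \<alpha>" and fin: "\<And>r. finite {t \<in> T. l t \<le> r}"
  obtains K where "1 \<le> K" "\<And>r. real (card {t \<in> T. l t \<le> r}) \<le> K * exp (\<alpha> * r)"
proof -
  obtain K where K: "\<And>F. \<lbrakk>finite F; F \<subseteq> T\<rbrakk> \<Longrightarrow> (\<Sum>t\<in>F. exp (- \<alpha> * l t)) \<le> K"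
    using assms(1) unfolding exp_summable_def by blast
  have "real (card {t \<in> T. l t \<le> r}) \<le> max 1 K * exp (\<alpha> * r)" for r
  proof -
    have "real (card {t \<in> T. l t \<le> r}) * exp (- \<alpha> * r) = (\<Sum>t\<in>{t \<in> T. l t \<le> r}. exp (- \<alpha> * r))" by simp
    also have "\<dots> \<le> (\<Sum>t\<in>{t \<in> T. l t \<le> r}. exp (- \<alpha> * l t))"
      using assms(2) by (intro sum_mono) (auto simp: mult_left_mono)
    also have "\<dots> \<le> max 1 K" using K[OF fin, of r] by fastforce
    finally show ?thesis by (simp add: exp_minus field_simps)
  qed
  then show ?thesis using that[of "max 1 K"] by simp
qed

lemma exp_lower_le_summable:
  assumes "exp_lower T l \<sigma>" "exp_summable T l \<alpha>" "0 \<le> \<alpha>" "\<And>r. finite {t \<in> T. l t \<le> r}"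
  shows "\<sigma> \<le> \<alpha>"
proof (rule ccontr)
  assume "\<not> \<sigma> \<le> \<alpha>"
  then have d: "0 < \<sigma> - \<alpha>" by simp
  obtain K where K: "1 \<le> K" "\<And>r. real (card {t \<in> T. l t \<le> r}) \<le> K * exp (\<alpha> * r)"
    using exp_summable_card[OF assms(2-4)] by blast
  obtain \<kappa> where k: "0 < \<kappa>" "\<And>r. 0 \<le> r \<Longrightarrow> \<kappa> * exp (\<sigma> * r) \<le> real (card {t \<in> T. l t \<le> r})"
    using assms(1) unfolding exp_lower_def by blast
  \<comment> \<open>Chosen so that \<open>(\<sigma> - \<alpha>) * r = K / \<kappa>\<close>; then
    \<open>1 + x \<le> exp x\<close> turns the comparison into \<kappa> + K \<le> K.\<close>
  define r where "r = K / \<kappa> / (\<sigma> - \<alpha>)"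
  have r: "0 \<le> r" using K k d by (simp add: r_def)
  have "\<kappa> * exp (\<sigma> * r) \<le> K * exp (\<alpha> * r)" using K(2)[of r] k(2)[OF r] by linarith
  then have "\<kappa> * exp ((\<sigma> - \<alpha>) * r) \<le> K" by (simp add: left_diff_distrib exp_diff field_simps)
  moreover have "(\<sigma> - \<alpha>) * r = K / \<kappa>" using d by (simp add: r_def)
  ultimately have "\<kappa> * exp (K / \<kappa>) \<le> K" by simp
  moreover have "\<kappa> * (1 + K / \<kappa>) \<le> \<kappa> * exp (K / \<kappa>)" using k by (intro mult_left_mono) auto
  moreover have "\<kappa> * (1 + K / \<kappa>) = \<kappa> + K" using k by (simp add: field_simps)
  ultimately show False using k by linarith
qed

lemma exp_lower_le_rate:
  assumes "exp_lower T l \<sigma>" "growth_rate T l \<delta>"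
  shows "\<sigma> \<le> \<delta>"
proof (rule field_le_epsilon)
  fix e :: real assume "0 < e"
  then show "\<sigma> \<le> \<delta> + e"
    using exp_lower_le_summable[OF assms(1), of "\<delta> + e"] assms(2) by (auto simp: growth_rate_def)
qed

text \<open>For a finite \<open>F0\<close> whose sum is within \<kappa>/2 of the supremum,
  everything outside \<open>F0\<close> weighs at most \<kappa>/2. But every ball has cardinality
  times \<open>exp (- \<delta> * r)\<close> at least \<kappa>, and for large \<open>r\<close> the
  share of \<open>F0\<close> in this is below \<kappa>/2.\<close>

lemma exp_lower_not_summable:
  fixes l :: "'t \<Rightarrow> real"
  assumes "exp_lower T l \<delta>" "0 < \<delta>" "\<And>r. finite {t \<in> T. l t \<le> r}"
  shows "\<not> exp_summable T l \<delta>"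
proof
  assume "exp_summable T l \<delta>"
  then obtain K where K: "\<And>F. \<lbrakk>finite F; F \<subseteq> T\<rbrakk> \<Longrightarrow> (\<Sum>t\<in>F. exp (- \<delta> * l t)) \<le> K"
    unfolding exp_summable_def by blast
  obtain \<kappa> where k: "0 < \<kappa>" "\<And>r. 0 \<le> r \<Longrightarrow> \<kappa> * exp (\<delta> * r) \<le> real (card {t \<in> T. l t \<le> r})"
    using assms(1) unfolding exp_lower_def by blast
  define S where "S = (\<lambda>F. \<Sum>t\<in>F. exp (- \<delta> * l t)) ` {F. finite F \<and> F \<subseteq> T}"
  have S: "S \<noteq> {}" "bdd_above S" using K by (auto simp: S_def bdd_above_def)
  have "Sup S - \<kappa> / 2 < Sup S" using k by simp
  then obtain F0 where F0: "finite F0" "F0 \<subseteq> T" "Sup S - \<kappa> / 2 < (\<Sum>t\<in>F0. exp (- \<delta> * l t))"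
    using less_cSup_iff[OF S, of "Sup S - \<kappa> / 2"] by (auto simp: S_def)
  define r where "r = (2 * card F0 / \<kappa>) / \<delta>"
  have r: "0 \<le> r" using k assms by (simp add: r_def)
  let ?b = "{t \<in> T. l t \<le> r}"
  have "(\<Sum>t\<in>?b - F0. exp (- \<delta> * l t)) + (\<Sum>t\<in>F0. exp (- \<delta> * l t)) = (\<Sum>t\<in>?b \<union> F0. exp (- \<delta> * l t))"
    using sum.union_disjoint[of "?b - F0" F0 "\<lambda>t. exp (- \<delta> * l t)"] F0 assms(3)[of r]
    by (metis Diff_disjoint Int_commute Un_Diff_cancel2 finite_Diff)
  also have "\<dots> \<le> Sup S" using F0 assms(3)[of r] by (intro cSup_upper S) (auto simp: S_def)
  finally have a: "(\<Sum>t\<in>?b - F0. exp (- \<delta> * l t)) \<le> \<kappa> / 2" using F0 by linarith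
  have "card ?b \<le> card (?b - F0) + card F0"
    by (rule order_trans[OF card_mono card_Un_le]) (use F0(1) assms(3)[of r] in auto)
  then have "real (card ?b) * exp (- \<delta> * r) \<le> (real (card (?b - F0)) + real (card F0)) * exp (- \<delta> * r)"
    by (intro mult_right_mono) auto
  moreover have "real (card (?b - F0)) * exp (- \<delta> * r) \<le> (\<Sum>t\<in>?b - F0. exp (- \<delta> * l t))"
  proof -
    have "real (card (?b - F0)) * exp (- \<delta> * r) = (\<Sum>t\<in>?b - F0. exp (- \<delta> * r))" by simp
    also have "\<dots> \<le> (\<Sum>t\<in>?b - F0. exp (- \<delta> * l t))"
      using assms(2) by (intro sum_mono) (auto simp: mult_left_mono)
    finally show ?thesis .
  qed
  ultimately have "real (card ?b) * exp (- \<delta> * r) \<le> \<kappa> / 2 + real (card F0) * exp (- \<delta> * r)"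
    using a unfolding distrib_right by linarith
  moreover have "\<kappa> \<le> real (card ?b) * exp (- \<delta> * r)" using k(2)[OF r] by (simp add: exp_minus field_simps)
  ultimately have "\<kappa> * exp (\<delta> * r) \<le> 2 * real (card F0)" by (simp add: exp_minus field_simps)
  moreover have "\<delta> * r = 2 * card F0 / \<kappa>" using assms(2) by (simp add: r_def)
  ultimately have "\<kappa> * exp (2 * card F0 / \<kappa>) \<le> 2 * real (card F0)" by simp
  moreover have "\<kappa> * (1 + 2 * card F0 / \<kappa>) \<le> \<kappa> * exp (2 * card F0 / \<kappa>)" using k by (intro mult_left_mono) auto
  moreover have "\<kappa> * (1 + 2 * card F0 / \<kappa>) = \<kappa> + 2 * card F0" using k by (simp add: field_simps)
  ultimately show False using k by linarith
qed

text \<open>Fekete's lemma: the logarithm of the shifted growth function is subadditive.\<close>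

lemma growth_rate_exists:
  fixes l :: "'t \<Rightarrow> real"
  assumes fin: "\<And>r. finite {t \<in> T. l t \<le> r}" and l: "\<And>t. t \<in> T \<Longrightarrow> 0 \<le> l t"
    and t0: "t0 \<in> T" "l t0 = 0" and D: "0 \<le> D"
    and split: "\<And>r s x. \<lbrakk>0 \<le> r; 0 \<le> s; x \<in> T; l x \<le> r + s\<rbrakk> \<Longrightarrow>
      \<exists>y\<in>T. \<exists>z\<in>T. l y \<le> r + D \<and> l z \<le> s + D \<and> x = f y z"
  obtains \<delta> where "growth_rate T l \<delta>"
proof -
  define b where "b = (\<lambda>r. real (card {t \<in> T. l t \<le> r}))"
  have mono: "b r \<le> b s" if "r \<le> s" for r s
    unfolding b_def using that fin by (intro of_nat_mono card_mono) auto
  have b1: "1 \<le> b r" if "0 \<le> r" for r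
  proof -
    have "{t \<in> T. l t \<le> r} \<noteq> {}" using t0 that by auto
    then have "0 < card {t \<in> T. l t \<le> r}" using fin by (simp add: card_gt_0_iff)
    then show ?thesis by (simp add: b_def)
  qed
  have sub: "b (r + s) \<le> b (r + D) * b (s + D)" if "0 \<le> r" "0 \<le> s" for r s
  proof -
    have "{t \<in> T. l t \<le> r + s} \<subseteq> (\<lambda>(y, z). f y z) ` ({t \<in> T. l t \<le> r + D} \<times> {t \<in> T. l t \<le> s + D})"
      using split[OF that] by force
    then have "card {t \<in> T. l t \<le> r + s} \<le> card ({t \<in> T. l t \<le> r + D} \<times> {t \<in> T. l t \<le> s + D})"
      by (rule surj_card_le[rotated]) (simp add: fin)
    then show ?thesis unfolding b_def by (simp add: card_cartesian_product flip: of_nat_mult)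
  qed
  \<comment> \<open>Splitting enlarges both radii by \<open>D\<close>; with the shift 2 D on both
    sides of the inequality, this loss is absorbed and \<open>F\<close> is exactly
    subadditive.\<close>
  define F where "F = (\<lambda>r. ln (b (r + 2 * D)))"
  have F0: "0 \<le> F r" if "0 \<le> r" for r using b1[of "r + 2 * D"] that D by (simp add: F_def)
  have Fmono: "F r \<le> F s" if "0 \<le> r" "r \<le> s" for r s
    using b1[of "r + 2 * D"] mono[of "r + 2 * D" "s + 2 * D"] that D by (simp add: F_def)
  have Fsub: "F (r + s) \<le> F r + F s" if "0 \<le> r" "0 \<le> s" for r s
  proof -
    have p: "0 < b (r + 2 * D)" "0 < b (s + 2 * D)" "0 < b (r + s + 2 * D)"
      using b1[of "r + 2 * D"] b1[of "s + 2 * D"] b1[of "r + s + 2 * D"] that D by linarith+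
    have "b (r + s + 2 * D) \<le> b (r + 2 * D) * b (s + 2 * D)"
      using sub[of "r + D" "s + D"] that D by (simp add: algebra_simps)
    then have "ln (b (r + s + 2 * D)) \<le> ln (b (r + 2 * D) * b (s + 2 * D))" using p by simp
    then show ?thesis using p by (simp add: F_def ln_mult)
  qed
  have Fmult: "F (real (Suc n) * r) \<le> real (Suc n) * F r" if "0 \<le> r" for n r
  proof (induction n)
    case (Suc n)
    have "F (real (Suc (Suc n)) * r) = F (real (Suc n) * r + r)" by (simp add: algebra_simps)
    also have "\<dots> \<le> F (real (Suc n) * r) + F r" using that by (intro Fsub) auto
    finally show ?case using Suc by (simp add: algebra_simps)
  qed simp
  \<comment> \<open>Taken as an infimum instead of a limit: \<open>\<delta> * r \<le> F r\<close>
    then holds for every positive \<open>r\<close>, which is the purely exponential lower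
    bound.\<close>
  define \<delta> where "\<delta> = Inf ((\<lambda>r. F r / r) ` {0<..})"
  have bdd: "bdd_below ((\<lambda>r. F r / r) ` {0<..})" by (intro bdd_belowI[of _ 0]) (auto intro!: divide_nonneg_pos F0)
  have d0: "0 \<le> \<delta>" unfolding \<delta>_def by (intro cInf_greatest) (auto intro!: divide_nonneg_pos F0)
  have dF: "\<delta> * r \<le> F r" if "0 < r" for r
  proof -
    have "\<delta> \<le> F r / r" unfolding \<delta>_def using bdd that by (intro cInf_lower) auto
    then show ?thesis using that by (simp add: field_simps)
  qed
  have "exp (- 2 * D * \<delta>) * exp (\<delta> * r) \<le> b r" if r: "0 \<le> r" for r
  proof (cases "r \<le> 2 * D")
    case True
    then have "\<delta> * r \<le> \<delta> * (2 * D)" using d0 by (intro mult_left_mono)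
    then have "exp (- 2 * D * \<delta>) * exp (\<delta> * r) \<le> 1" by (simp flip: exp_add add: algebra_simps)
    then show ?thesis using b1[OF r] by linarith
  next
    case False
    then have "\<delta> * (r - 2 * D) \<le> ln (b r)" using dF[of "r - 2 * D"] by (simp add: F_def)
    then have "exp (\<delta> * (r - 2 * D)) \<le> b r" using b1[OF r] by (simp add: ln_ge_iff)
    then show ?thesis by (simp flip: exp_add add: algebra_simps)
  qed
  then have lower: "exp_lower T l \<delta>" unfolding exp_lower_def b_def by (intro exI[of _ "exp (- 2 * D * \<delta>)"]) simp
  have upper: "exp_summable T l \<alpha>" if a: "\<delta> < \<alpha>" for \<alpha>
  proof -
    define \<sigma> where "\<sigma> = (\<alpha> + \<delta>) / 2"
    have s: "\<delta> < \<sigma>" "\<sigma> < \<alpha>" "0 < \<sigma>" using a d0 by (auto simp: \<sigma>_def)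
    obtain r0 where r0: "0 < r0" "F r0 / r0 < \<sigma>"
      using s(1) cInf_less_iff[OF _ bdd, of \<sigma>] unfolding \<delta>_def by auto
    have "b r \<le> exp (\<sigma> * r0) * exp (\<sigma> * r)" if r: "0 \<le> r" for r
    proof -
      define n where "n = nat \<lfloor>r / r0\<rfloor>"
      have n: "real n \<le> r / r0" "r / r0 < real n + 1" using r r0 by (auto simp: n_def)
      have rn: "r \<le> real (Suc n) * r0" using n(2) r0 by (simp add: field_simps)
      have "ln (b r) \<le> F r" unfolding F_def using b1[OF r] mono[of r "r + 2 * D"] D by simp
      also have "\<dots> \<le> F (real (Suc n) * r0)" using Fmono[OF r rn] .
      also have "\<dots> \<le> real (Suc n) * F r0" using Fmult r0 by simp
      also have "\<dots> \<le> (r / r0 + 1) * F r0" using n F0[of r0] r0 by (intro mult_right_mono) auto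
      also have "\<dots> \<le> (r / r0 + 1) * (\<sigma> * r0)"
        using r0 r by (intro mult_left_mono) (auto simp: field_simps)
      also have "\<dots> = \<sigma> * r + \<sigma> * r0" using r0 by (simp add: field_simps)
      finally have "exp (ln (b r)) \<le> exp (\<sigma> * r + \<sigma> * r0)" by simp
      then have "b r \<le> exp (\<sigma> * r + \<sigma> * r0)" using b1[OF r] by simp
      then show ?thesis by (simp add: exp_add mult.commute)
    qed
    then show ?thesis using exp_summableI[OF fin l s(2)] a d0 unfolding b_def by force
  qed
  show ?thesis using that d0 fin lower upper unfolding growth_rate_def by blast
qed

text \<open>A renewal inequality: with weights satisfying \<Sum> exp(- s \<omega>) \<ge> 1 the bound
  at the radii \<open>r - \<omega> x\<close> reproduces itself at \<open>r\<close>. The induction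
  proceeds in steps of the smallest weight, and the shift by \<open>L\<close> makes the bound at
  most 1 for \<open>r \<le> L\<close>, where no recursion is available.\<close>

lemma exp_recursion_lower:
  fixes b :: "real \<Rightarrow> real"
  assumes S: "finite S" "\<And>x. x \<in> S \<Longrightarrow> 0 < \<omega> x" "\<And>x. x \<in> S \<Longrightarrow> \<omega> x \<le> L"
    and s: "0 \<le> s" "1 \<le> (\<Sum>x\<in>S. exp (- s * \<omega> x))"
    and b1: "\<And>r. 0 \<le> r \<Longrightarrow> 1 \<le> b r"
    and rec: "\<And>r. L < r \<Longrightarrow> (\<Sum>x\<in>S. b (r - \<omega> x)) \<le> b r"
    and r: "0 \<le> r"
  shows "exp (s * (r - L)) \<le> b r"
proof -
  have Sne: "S \<noteq> {}" using s by auto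
  define w where "w = Min (\<omega> ` S)"
  have w: "0 < w" "\<And>x. x \<in> S \<Longrightarrow> w \<le> \<omega> x" using S Sne by (auto simp: w_def)
  have "\<forall>r. 0 \<le> r \<longrightarrow> r \<le> real n * w \<longrightarrow> exp (s * (r - L)) \<le> b r" for n
  proof (induction n)
    case 0
    show ?case
    proof (intro allI impI)
      fix r :: real assume "0 \<le> r" "r \<le> real 0 * w"
      moreover have "0 \<le> L" using S Sne by (meson all_not_in_conv less_le_trans less_imp_le)
      ultimately have "s * (r - L) \<le> 0" using s by (simp add: mult_nonneg_nonpos)
      then have "exp (s * (r - L)) \<le> 1" by simp
      then show "exp (s * (r - L)) \<le> b r" using b1[OF \<open>0 \<le> r\<close>] by linarith
    qed
  next
    case (Suc n)
    show ?case
    proof (intro allI impI)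
      fix r :: real assume r: "0 \<le> r" "r \<le> real (Suc n) * w"
      show "exp (s * (r - L)) \<le> b r"
      proof (cases "r \<le> L")
        case True
        then have "s * (r - L) \<le> 0" using s by (simp add: mult_nonneg_nonpos)
        then have "exp (s * (r - L)) \<le> 1" by simp
        then show ?thesis using b1[OF r(1)] by linarith
      next
        case False
        have "exp (s * (r - L)) \<le> exp (s * (r - L)) * (\<Sum>x\<in>S. exp (- s * \<omega> x))" using s by simp
        also have "\<dots> = (\<Sum>x\<in>S. exp (s * (r - \<omega> x - L)))"
          unfolding sum_distrib_left by (intro sum.cong) (auto simp: algebra_simps simp flip: exp_add)
        also have "\<dots> \<le> (\<Sum>x\<in>S. b (r - \<omega> x))"
        proof (rule sum_mono)
          fix x assume x: "x \<in> S"
          have "0 \<le> r - \<omega> x" using S(3)[OF x] False by simp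
          moreover have "r - \<omega> x \<le> real n * w" using w(2)[OF x] r by (simp add: algebra_simps)
          ultimately show "exp (s * (r - \<omega> x - L)) \<le> b (r - \<omega> x)" using Suc by blast
        qed
        also have "\<dots> \<le> b r" using rec False by simp
        finally show ?thesis .
      qed
    qed
  qed
  moreover obtain n where "r / w \<le> real n" using real_arch_simple by blast
  ultimately show ?thesis using r w by (simp add: divide_le_eq)
qed

text \<open>Raising the exponent by \<open>e\<close> shrinks each term at most by the factor
  \<open>exp (- e * L)\<close>, and \<open>e\<close> is small enough for this to be at least 1/2.
  Dividing by \<open>L + 1\<close> instead of \<open>L\<close> covers \<open>L = 0\<close>.\<close>

lemma raise_exponent:
  fixes \<omega> :: "'l \<Rightarrow> real"
  assumes S: "finite S" and L: "\<And>x. x \<in> S \<Longrightarrow> \<omega> x \<le> L" and d: "2 \<le> (\<Sum>x\<in>S. exp (- \<delta> * \<omega> x))" "0 \<le> L"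
  obtains s where "\<delta> < s" "1 \<le> (\<Sum>x\<in>S. exp (- s * \<omega> x))"
proof -
  define e where "e = ln 2 / (L + 1)"
  have e: "0 < e" using d by (simp add: e_def)
  have eL: "e * L \<le> ln 2"
  proof -
    have "ln 2 * L \<le> ln 2 * (L + 1)" by (intro mult_left_mono) auto
    then show ?thesis using d by (simp add: e_def field_simps)
  qed
  have "1 \<le> (1 / 2) * (\<Sum>x\<in>S. exp (- \<delta> * \<omega> x))" using d by simp
  also have "\<dots> \<le> (\<Sum>x\<in>S. exp (- (\<delta> + e) * \<omega> x))"
    unfolding sum_distrib_left
  proof (rule sum_mono)
    fix x assume x: "x \<in> S"
    have "e * \<omega> x \<le> ln 2" using mult_left_mono[OF L[OF x], of e] e eL by linarith
    then have "exp (- ln 2) * exp (- \<delta> * \<omega> x) \<le> exp (- (\<delta> + e) * \<omega> x)"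
      by (simp flip: exp_add add: algebra_simps)
    then show "1 / 2 * exp (- \<delta> * \<omega> x) \<le> exp (- (\<delta> + e) * \<omega> x)" by (simp add: exp_minus field_simps)
  qed
  finally show ?thesis using that[of "\<delta> + e"] e by simp
qed

section \<open>Free words and their growth\<close>

context length_group begin

definition word :: "('l \<Rightarrow> 'a) \<Rightarrow> 'l list \<Rightarrow> 'a" where
  "word e xs = foldr (\<lambda>x g. e x \<otimes> g) xs \<one>"

lemma word_Nil [simp]: "word e [] = \<one>" and word_Cons [simp]: "word e (x # xs) = e x \<otimes> word e xs"
  by (simp_all add: word_def)

lemma word_closed: "\<lbrakk>e ` S \<subseteq> carrier G; xs \<in> lists S\<rbrakk> \<Longrightarrow> word e xs \<in> carrier G"
  by (induction xs) auto

text \<open>Words of weight at most \<open>r\<close>, sorted by their first letter, satisfy the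
  renewal inequality. Injectivity of evaluation turns a count of words into a count of group
  elements.\<close>

lemma free_words_growth:
  fixes e :: "'l \<Rightarrow> 'a"
  assumes S: "finite S" "e ` S \<subseteq> carrier G" "inj_on (word e) (lists S)"
    and \<omega>: "\<And>x. x \<in> S \<Longrightarrow> 0 < \<omega> x" "\<And>x. x \<in> S \<Longrightarrow> len (e x) \<le> \<omega> x"
    and s: "0 \<le> s" "1 \<le> (\<Sum>x\<in>S. exp (- s * \<omega> x))"
  shows "exp_lower (carrier G) len s"
proof -
  define W where "W = (\<lambda>r. {xs \<in> lists S. sum_list (map \<omega> xs) \<le> r})"
  have len_word: "len (word e xs) \<le> sum_list (map \<omega> xs)" if "xs \<in> lists S" for xs
    using that
  proof (induction xs)
    case (Cons x xs)
    then have "len (word e (x # xs)) \<le> len (e x) + len (word e xs)"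
      using S(2) word_closed[OF S(2)] by (auto intro!: len_mult)
    then show ?case using Cons \<omega>(2)[of x] by auto
  qed (simp add: len_one)
  have im: "word e ` W r \<subseteq> {g \<in> carrier G. len g \<le> r}" for r
    using len_word word_closed[OF S(2)] by (fastforce simp: W_def)
  have injW: "inj_on (word e) (W r)" for r using S(3) by (rule inj_on_subset) (auto simp: W_def)
  have finW: "finite (W r)" for r using finite_imageD[OF finite_subset[OF im finite_ball] injW] .
  have cardW: "card (W r) \<le> card {g \<in> carrier G. len g \<le> r}" for r
    using card_inj_on_le[OF injW im finite_ball] .
  define L where "L = Max (\<omega> ` S)"
  have L: "\<And>x. x \<in> S \<Longrightarrow> \<omega> x \<le> L" using S by (simp add: L_def)
  have low: "exp (s * (r - L)) \<le> real (card (W r))" if "0 \<le> r" for r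
  proof (rule exp_recursion_lower[OF S(1) \<omega>(1) L s _ _ that])
    fix r :: real assume "0 \<le> r"
    then have "[] \<in> W r" by (simp add: W_def)
    then have "0 < card (W r)" using finW by (auto simp: card_gt_0_iff)
    then show "1 \<le> real (card (W r))" by simp
  next
    fix r assume "L < r"
    have "(\<Union>x\<in>S. (#) x ` W (r - \<omega> x)) \<subseteq> W r" by (auto simp: W_def)
    then have "card (\<Union>x\<in>S. (#) x ` W (r - \<omega> x)) \<le> card (W r)" using finW by (rule card_mono[rotated])
    moreover have "card (\<Union>x\<in>S. (#) x ` W (r - \<omega> x)) = (\<Sum>x\<in>S. card ((#) x ` W (r - \<omega> x)))"
      using finW S(1) by (intro card_UN_disjoint) auto
    moreover have "card ((#) x ` W (r - \<omega> x)) = card (W (r - \<omega> x))" for x by (intro card_image) simp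
    ultimately show "(\<Sum>x\<in>S. real (card (W (r - \<omega> x)))) \<le> real (card (W r))" by (simp flip: of_nat_sum)
  qed
  have "exp (- s * L) * exp (s * r) \<le> real (card {g \<in> carrier G. len g \<le> r})" if "0 \<le> r" for r
    using low[OF that] cardW[of r] by (simp flip: exp_add add: algebra_simps)
  then show ?thesis unfolding exp_lower_def by (intro exI[of _ "exp (- s * L)"]) simp
qed

text \<open>A word can be decoded from its value by projections. The part after the first letter
  \<open>a \<otimes> c [^] m\<close> projects near the identity on the axis of \<open>c\<close>, so
  the value projects to the axis translated by \<open>a\<close> near
  \<open>a \<otimes> c [^] m\<close>, far from \<open>a\<close>. By \<open>behrstock\<close> this
  cannot happen for two separated choices of \<open>a\<close>, and the position of the projection
  then determines \<open>m\<close>.\<close>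

lemma words_inj:
  fixes A :: "'a set" and E :: "int set"
  assumes c: "c \<in> carrier G" and C: "contracting C (cyc c)" "0 \<le> C" and B: "0 \<le> B" and A: "A \<subseteq> carrier G"
    and p1: "\<And>a p. \<lbrakk>a \<in> A; nearest (cyc c) a p\<rbrakk> \<Longrightarrow> len p \<le> B"
    and p2: "\<And>a p. \<lbrakk>a \<in> A; nearest (a <# cyc c) \<one> p\<rbrakk> \<Longrightarrow> rho a p \<le> B"
    and p3: "\<And>a a' p. \<lbrakk>a \<in> A; a' \<in> A; nearest (a <# cyc c) a' p\<rbrakk> \<Longrightarrow> rho a p \<le> B"
    and long: "\<And>a. a \<in> A \<Longrightarrow> 2 * B + C < len a"
    and sep: "\<And>a a'. \<lbrakk>a \<in> A; a' \<in> A; a \<noteq> a'\<rbrakk> \<Longrightarrow> 2 * B + C < rho a a'"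
    and E: "\<And>m. m \<in> E \<Longrightarrow> 2 * B + 2 * C < len (c [^] m)"
      "\<And>m m'. \<lbrakk>m \<in> E; m' \<in> E; m \<noteq> m'\<rbrakk> \<Longrightarrow> 2 * B + 2 * C < len (c [^] (m' - m))"
  shows "inj_on (word (\<lambda>(a, m). a \<otimes> c [^] m)) (lists (A \<times> E))"
proof -
  let ?e = "\<lambda>(a, m). a \<otimes> c [^] (m::int)" and ?Y = "cyc c"
  define w where "w = word ?e"
  have eS: "?e ` (A \<times> E) \<subseteq> carrier G" using A c by auto
  have wc: "w l \<in> carrier G" if "l \<in> lists (A \<times> E)" for l using word_closed[OF eS that] by (simp add: w_def)
  have w0: "w [] = \<one>" by (simp add: w_def)
  have w1: "w ((a, m) # l) = a \<otimes> (c [^] m \<otimes> w l)" if "a \<in> A" "l \<in> lists (A \<times> E)" for a m l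
    using wc[OF that(2)] that(1) A c by (auto simp: w_def m_assoc)
  have Yc: "?Y \<subseteq> carrier G" using c by simp
  have Zc: "a <# ?Y \<subseteq> carrier G" and Zne: "a <# ?Y \<noteq> {}" and Zcon: "contracting C (a <# ?Y)" if "a \<in> A" for a
    using that A l_coset_carrier[OF _ Yc] l_coset_memI[OF one_in_cyc] contracting_translate[OF C(1) Yc] by blast+
  have nY: "rho (a \<otimes> c [^] m) p \<le> B + C"
    if near: "\<And>p. nearest ?Y x p \<Longrightarrow> len p \<le> B + C" and a: "a \<in> A" and x: "x \<in> carrier G"
      and p: "nearest (a <# ?Y) (a \<otimes> (c [^] m \<otimes> x)) p" for a x p and m :: int
  proof -
    have ac: "a \<in> carrier G" using a A by blast
    have cx: "c [^] m \<otimes> x \<in> carrier G" using c x by simp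
    obtain p' where p': "p = a \<otimes> p'" "nearest ?Y (c [^] m \<otimes> x) p'"
      by (rule nearest_translateD[OF p Yc cx ac])
    have n': "nearest (c [^] m <# ?Y) (c [^] m \<otimes> x) p'" using p'(2) c by (simp add: pow_coset_cyc)
    obtain p'' where p'': "p' = c [^] m \<otimes> p''" "nearest ?Y x p''"
      by (rule nearest_translateD[OF n' Yc x int_pow_closed[OF c]])
    have "p'' \<in> carrier G" using p''(2) Yc nearest_carrier by blast
    then show ?thesis using near[OF p''(2)] p' p'' ac c by simp
  qed
  have apart: "False" if "rho (a \<otimes> c [^] m) p \<le> B + C" "rho a p \<le> B + C" "m \<in> E" "a \<in> A" "p \<in> carrier G" for a m p
  proof -
    have "len (c [^] m) \<le> rho a p + rho (a \<otimes> c [^] m) p"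
      using rho_triangle[of a p "a \<otimes> c [^] m"] rho_sym[of p "a \<otimes> c [^] m"] A c that by auto
    moreover have "2 * B + 2 * C < len (c [^] m)" using E(1) that by blast
    ultimately show False using that(1,2) by linarith
  qed
  have near_w: "len p \<le> B + C" if "l \<in> lists (A \<times> E)" "nearest ?Y (w l) p" for l p
    using that
  proof (induction l arbitrary: p rule: list.induct)
    case Nil
    then have "nearest ?Y \<one> p" by (simp add: w0)
    then have "rho \<one> p \<le> rho \<one> \<one>" using nearest_le one_in_cyc by blast
    moreover have "p \<in> carrier G" using Nil Yc nearest_carrier by blast
    ultimately show ?case using B C by simp
  next
    case (Cons x l)
    obtain a m where x: "x = (a, m)" by fastforce
    have am: "a \<in> A" "m \<in> E" "l \<in> lists (A \<times> E)" using Cons.prems x by auto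
    have ac: "a \<in> carrier G" using am A by blast
    have wcx: "w (x # l) \<in> carrier G" using wc Cons.prems(1) by blast
    have pc: "p \<in> carrier G" using Cons.prems(2) Yc nearest_carrier by blast
    obtain q where q: "nearest (a <# ?Y) (w (x # l)) q" using nearest_exists[OF Zc[OF am(1)] Zne[OF am(1)] wcx] by blast
    have qc: "q \<in> carrier G" using q Zc[OF am(1)] nearest_carrier by blast
    have q1: "rho (a \<otimes> c [^] m) q \<le> B + C"
      using nY[OF Cons.IH[OF am(3)] am(1) wc[OF am(3)], of m q] q w1[OF am(1,3)] x by simp
    \<comment> \<open>The alternative compares the axis with base point \<one> and its translate
      with base point \<open>a\<close>. The second case is impossible, as the value projects to the
      translate near \<open>a \<otimes> c [^] m\<close>.\<close>
    have "rho \<one> p \<le> B + C \<or> rho a q \<le> B + C"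
    proof (rule behrstock[OF C(1) Zcon[OF am(1)] C(2) Yc cyc_nonempty Zc[OF am(1)] Zne[OF am(1)] one_closed ac wcx _ _ _ Cons.prems(2) q])
      show "rho \<one> p \<le> B" if "nearest ?Y a p" for p
        using p1[OF am(1) that] that Yc nearest_carrier by (metis rho_one_left)
      show "rho a p \<le> B" if "nearest (a <# ?Y) \<one> p" for p using p2[OF am(1) that] .
      show "2 * B + C < rho \<one> a" using long[OF am(1)] ac by simp
    qed
    moreover have "\<not> rho a q \<le> B + C" using apart[OF q1 _ am(2,1) qc] by blast
    ultimately show ?case using pc by simp
  qed
  have near_first: "rho (a \<otimes> c [^] m) p \<le> B + C"
    if "a \<in> A" "l \<in> lists (A \<times> E)" "nearest (a <# ?Y) (w ((a, m) # l)) p" for a m l p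
    using nY[OF near_w[OF that(2)] that(1) wc[OF that(2)], of m p] that(3) w1[OF that(1,2)] by simp
  have not_one: "w ((a, m) # l) \<noteq> \<one>" if "a \<in> A" "m \<in> E" "l \<in> lists (A \<times> E)" for a m l
  proof
    assume e: "w ((a, m) # l) = \<one>"
    note ne = nearest_exists[OF Zc[OF that(1)] Zne[OF that(1)] one_closed]
    obtain p where p: "nearest (a <# ?Y) \<one> p" by (rule ne)
    have "p \<in> carrier G" using p Zc[OF that(1)] nearest_carrier by blast
    moreover have "rho a p \<le> B + C" using p2[OF that(1) p] C by linarith
    moreover have "rho (a \<otimes> c [^] m) p \<le> B + C" using near_first[OF that(1,3), of m p] p e by simp
    ultimately show False using apart that by blast
  qed
  have "l = l'" if "l \<in> lists (A \<times> E)" "l' \<in> lists (A \<times> E)" "w l = w l'" for l l'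
    using that
  proof (induction l arbitrary: l' rule: list.induct)
    case Nil
    show ?case
    proof (cases l')
      case (Cons y k)
      then show ?thesis using Nil not_one[of "fst y" "snd y" k] w0 by auto
    qed simp
  next
    case (Cons x l)
    obtain a m where x: "x = (a, m)" by fastforce
    have am: "a \<in> A" "m \<in> E" "l \<in> lists (A \<times> E)" using Cons.prems x by auto
    obtain y k where y: "l' = y # k"
      using Cons.prems not_one[OF am] w0 x by (cases l') auto
    obtain a' m' where y': "y = (a', m')" by fastforce
    have am': "a' \<in> A" "m' \<in> E" "k \<in> lists (A \<times> E)" using Cons.prems y y' by auto
    have ac: "a \<in> carrier G" "a' \<in> carrier G" using am am' A by auto
    define z where "z = w ((a, m) # l)"
    have z': "z = w ((a', m') # k)" using Cons.prems x y y' by (simp add: z_def)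
    have zc: "z \<in> carrier G" using wc[of "(a, m) # l"] am by (simp add: z_def)
    obtain q where q: "nearest (a <# ?Y) z q" using nearest_exists[OF Zc[OF am(1)] Zne[OF am(1)] zc] by blast
    obtain q' where q': "nearest (a' <# ?Y) z q'" using nearest_exists[OF Zc[OF am'(1)] Zne[OF am'(1)] zc] by blast
    have qc: "q \<in> carrier G" "q' \<in> carrier G" using q q' Zc am(1) am'(1) nearest_carrier by blast+
    have n: "rho (a \<otimes> c [^] m) q \<le> B + C" "rho (a' \<otimes> c [^] m') q' \<le> B + C"
      using near_first[OF am(1,3) q[unfolded z_def]] near_first[OF am'(1,3) q'[unfolded z']] by blast+
    \<comment> \<open>Two different first letters would make the value project far from
      \<open>a\<close> and far from \<open>a'\<close> on the respective translates at the same
      time.\<close>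
    have aa: "a = a'"
    proof (rule ccontr)
      assume ne: "a \<noteq> a'"
      have "rho a q \<le> B + C \<or> rho a' q' \<le> B + C"
        by (rule behrstock[OF Zcon[OF am(1)] Zcon[OF am'(1)] C(2) Zc[OF am(1)] Zne[OF am(1)] Zc[OF am'(1)] Zne[OF am'(1)]
              ac zc p3[OF am(1) am'(1)] p3[OF am'(1) am(1)] sep[OF am(1) am'(1) ne] q q'])
      then show False using apart n am am' qc by blast
    qed
    have mm: "m = m'"
    proof (rule ccontr)
      assume ne: "m \<noteq> m'"
      have "nearest (a <# ?Y) z q" "rho (a \<otimes> c [^] m') q \<le> B + C"
        using q near_first[OF am'(1,3), of m' q] z' aa by auto
      moreover have "rho (a \<otimes> c [^] m) (a \<otimes> c [^] m') = len (c [^] (m' - m))" using ac c by (simp add: rho_pow)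
      moreover have "rho (a \<otimes> c [^] m) (a \<otimes> c [^] m') \<le> rho (a \<otimes> c [^] m) q + rho (a \<otimes> c [^] m') q"
        using rho_triangle[of "a \<otimes> c [^] m" q "a \<otimes> c [^] m'"] rho_sym[of q "a \<otimes> c [^] m'"] ac c qc by simp
      ultimately show False using n(1) E(2)[OF am(2) am'(2) ne] by linarith
    qed
    have "c [^] m \<otimes> w l = c [^] m' \<otimes> w k"
      using z_def z' w1[OF am(1,3)] w1[OF am'(1,3)] aa ac c wc[OF am(3)] wc[OF am'(3)] by simp
    then have "w l = w k" using mm c wc[OF am(3)] wc[OF am'(3)] by simp
    then show ?case using Cons.IH[OF am(3) am'(3)] x y y' aa mm by simp
  qed
  then show ?thesis unfolding w_def by (intro inj_onI) blast
qed

end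

section \<open>Lengths of cosets\<close>

definition coset_len :: "('a \<Rightarrow> real) \<Rightarrow> 'a set \<Rightarrow> real" where
  "coset_len L A = Inf (L ` A)"

lemma coset_len_attained:
  fixes L :: "'a \<Rightarrow> real"
  assumes fin: "\<And>r. finite {a \<in> A. L a \<le> r}" and ne: "A \<noteq> {}"
  obtains a where "a \<in> A" "L a = coset_len L A" "\<And>b. b \<in> A \<Longrightarrow> L a \<le> L b"
proof -
  obtain a0 where a0: "a0 \<in> A" using ne by blast
  let ?F = "{a \<in> A. L a \<le> L a0}"
  have Fne: "?F \<noteq> {}" using a0 by auto
  define a where "a = arg_min_on L ?F"
  have a: "a \<in> ?F" "\<And>b. b \<in> ?F \<Longrightarrow> L a \<le> L b"
    using arg_min_if_finite(1)[OF fin Fne] arg_min_least[OF fin Fne] by (auto simp: a_def)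
  have min: "L a \<le> L b" if "b \<in> A" for b using a that by (cases "L b \<le> L a0") auto
  have "coset_len L A = L a" unfolding coset_len_def
    by (rule cInf_eq_minimum) (use a min in auto)
  then show ?thesis using that a min by auto
qed

lemma (in normal) coset_rep:
  fixes L :: "'a \<Rightarrow> real"
  assumes fin: "\<And>r. finite {g \<in> carrier G. L g \<le> r}" and A: "A \<in> carrier (G Mod H)"
  obtains a where "a \<in> carrier G" "A = H #> a" "L a = coset_len L A" "\<And>n. n \<in> H \<Longrightarrow> L a \<le> L (n \<otimes> a)"
proof -
  obtain g where g: "g \<in> carrier G" "A = H #> g" using A by (auto simp: carrier_FactGroup)
  have Ac: "A \<subseteq> carrier G" using g r_coset_subset_G subset by blast
  have finA: "finite {a \<in> A. L a \<le> r}" for r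
    by (rule finite_subset[OF _ fin[of r]]) (use Ac in auto)
  have ne: "A \<noteq> {}" using g rcos_self[OF g(1) subgroup_axioms] by auto
  obtain a where a: "a \<in> A" "L a = coset_len L A" "\<And>b. b \<in> A \<Longrightarrow> L a \<le> L b"
    using coset_len_attained[OF finA ne] by blast
  have ac: "a \<in> carrier G" using a Ac by blast
  have Aa: "A = H #> a" using repr_independence[OF _ g(1) subgroup_axioms] a g by blast
  have "n \<otimes> a \<in> A" if "n \<in> H" for n using Aa that by (auto simp: r_coset_def)
  then show ?thesis using that a ac Aa by blast
qed

lemma (in normal) finite_coset_ball:
  fixes L :: "'a \<Rightarrow> real"
  assumes fin: "\<And>r. finite {g \<in> carrier G. L g \<le> r}"
  shows "finite {A \<in> carrier (G Mod H). coset_len L A \<le> r}"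
proof -
  have "{A \<in> carrier (G Mod H). coset_len L A \<le> r} \<subseteq> (\<lambda>g. H #> g) ` {g \<in> carrier G. L g \<le> r}"
  proof
    fix A assume "A \<in> {A \<in> carrier (G Mod H). coset_len L A \<le> r}"
    then have A: "A \<in> carrier (G Mod H)" "coset_len L A \<le> r" by auto
    obtain a where "a \<in> carrier G" "A = H #> a" "L a = coset_len L A" by (rule coset_rep[OF fin A(1)])
    then show "A \<in> (\<lambda>g. H #> g) ` {g \<in> carrier G. L g \<le> r}" using A(2) by auto
  qed
  then show ?thesis using fin finite_surj by blast
qed

text \<open>For \<open>a\<close> in the subgroup and \<open>b\<close> in the coset,
  \<open>inv a \<otimes> b\<close> runs exactly through the coset, so the infimum over pairs
  collapses to one over the coset.\<close>

lemma (in normal) quotient_dist_eq_coset_len: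
  assumes d: "\<And>a b. \<lbrakk>a \<in> carrier G; b \<in> carrier G\<rbrakk> \<Longrightarrow> d (\<phi> a bp) (\<phi> b bp) = L (inv a \<otimes> b)"
    and A: "A \<in> carrier (G Mod H)"
  shows "quotient_dist d \<phi> bp H A = coset_len L A"
proof -
  obtain g where g: "g \<in> carrier G" "A = H #> g" using A by (auto simp: carrier_FactGroup)
  have Ac: "A \<subseteq> carrier G" using g r_coset_subset_G subset by blast
  have HA: "inv a \<otimes> b \<in> A" if "a \<in> H" "b \<in> A" for a b
  proof -
    have "b \<in> H #> g" using that g by simp
    then obtain k where "k \<in> H" "b = k \<otimes> g" by (auto simp: r_coset_def)
    then have "inv a \<otimes> b = (inv a \<otimes> k) \<otimes> g" "inv a \<otimes> k \<in> H" using that g subset by (auto simp: m_assoc)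
    then show ?thesis using g by (auto simp: r_coset_def)
  qed
  have "{d (\<phi> a bp) (\<phi> b bp) | a b. a \<in> H \<and> b \<in> A} = L ` A"
  proof (intro equalityI subsetI)
    fix t assume "t \<in> {d (\<phi> a bp) (\<phi> b bp) | a b. a \<in> H \<and> b \<in> A}"
    then obtain a b where ab: "a \<in> H" "b \<in> A" "t = d (\<phi> a bp) (\<phi> b bp)" by blast
    then have "t = L (inv a \<otimes> b)" using d[of a b] subset Ac by blast
    then show "t \<in> L ` A" using HA[OF ab(1,2)] by blast
  next
    fix t assume "t \<in> L ` A"
    then obtain b where b: "b \<in> A" "t = L b" by blast
    then have "t = d (\<phi> \<one> bp) (\<phi> b bp)" using d[of \<one> b] Ac by auto
    then show "t \<in> {d (\<phi> a bp) (\<phi> b bp) | a b. a \<in> H \<and> b \<in> A}" using b(1) subgroup.one_closed[OF subgroup_axioms] by blast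
  qed
  then show ?thesis by (simp add: quotient_dist_def coset_len_def)
qed

section \<open>Growth of quotients\<close>

context length_group begin

text \<open>The trace that geodesics of the space leave in the orbit: \<open>g1\<close> is an orbit
  point near the point at distance \<open>r\<close> on a geodesic to \<open>g\<close>. It provides
  the splitting of elements behind subadditivity.\<close>

definition coarsely_geodesic :: "real \<Rightarrow> bool" where
  "coarsely_geodesic D \<longleftrightarrow> 0 \<le> D \<and> (\<forall>g\<in>carrier G. \<forall>r. 0 \<le> r \<and> r \<le> len g \<longrightarrow>
     (\<exists>g1\<in>carrier G. len g1 \<le> r + D \<and> rho g1 g \<le> len g - r + D))"

lemma coarsely_geodesic_split:
  assumes "coarsely_geodesic D" "g \<in> carrier G" "len g \<le> r + s" "0 \<le> r" "0 \<le> s"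
  obtains g1 g2 where "g1 \<in> carrier G" "g2 \<in> carrier G" "g = g1 \<otimes> g2" "len g1 \<le> r + D" "len g2 \<le> s + D"
proof (cases "len g \<le> r")
  case True
  then show ?thesis using that[of g \<one>] assms by (simp add: len_one coarsely_geodesic_def)
next
  case False
  then obtain g1 where "g1 \<in> carrier G" "len g1 \<le> r + D" "rho g1 g \<le> len g - r + D"
    using assms unfolding coarsely_geodesic_def by (meson linear)
  then show ?thesis using that[of g1 "inv g1 \<otimes> g"] assms by (simp add: rho_def)
qed

lemma group_growth_rate_exists:
  assumes "coarsely_geodesic D"
  obtains \<delta> where "growth_rate (carrier G) len \<delta>"
proof (rule growth_rate_exists[OF finite_ball len_nonneg one_closed len_one])
  show "0 \<le> D" using assms by (simp add: coarsely_geodesic_def)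
  show "\<exists>y\<in>carrier G. \<exists>z\<in>carrier G. len y \<le> r + D \<and> len z \<le> s + D \<and> x = y \<otimes> z"
    if "0 \<le> r" "0 \<le> s" "x \<in> carrier G" "len x \<le> r + s" for r s x
    using coarsely_geodesic_split[OF assms that(3,4,1,2)] by metis
qed (use that in auto)

lemma coset_min:
  assumes N: "N \<lhd> G" and A: "A \<in> carrier (G Mod N)"
  obtains a where "a \<in> carrier G" "A = N #> a" "len a = coset_len len A" "\<And>n. n \<in> N \<Longrightarrow> len a \<le> len (n \<otimes> a)"
  using normal.coset_rep[OF N finite_ball A] by metis

lemma coset_len_le:
  assumes "N \<lhd> G" "g \<in> carrier G"
  shows "coset_len len (N #> g) \<le> len g"
proof -
  interpret N: normal N G by (rule assms(1))
  have "g \<in> N #> g" using rcos_self[OF assms(2) N.subgroup_axioms] .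
  moreover have "N #> g \<subseteq> carrier G" using r_coset_subset_G[OF N.subset assms(2)] .
  ultimately show ?thesis unfolding coset_len_def using len_nonneg
    by (intro cInf_lower) (auto intro!: bdd_belowI[of _ 0])
qed

lemma coset_len_nonneg:
  assumes "N \<lhd> G" "A \<in> carrier (G Mod N)"
  shows "0 \<le> coset_len len A"
  using coset_min[OF assms] len_nonneg by metis

text \<open>A shortest representative is split in the group; the cosets of its two parts multiply to
  the given coset and are at most as long as the parts.\<close>

lemma coset_growth_rate_exists:
  assumes cg: "coarsely_geodesic D" and N: "N \<lhd> G"
  obtains \<delta> where "growth_rate (carrier (G Mod N)) (coset_len len) \<delta>"
proof -
  interpret N: normal N G by (rule N)
  have mem: "N #> g \<in> carrier (G Mod N)" if "g \<in> carrier G" for g using that by (auto simp: carrier_FactGroup)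
  have N1: "N #> \<one> \<in> carrier (G Mod N)" using mem by simp
  have "coset_len len (N #> \<one>) = 0"
    using coset_len_le[OF N one_closed] coset_len_nonneg[OF N N1] len_one by simp
  show ?thesis
  proof (rule growth_rate_exists[OF normal.finite_coset_ball[OF N finite_ball] coset_len_nonneg[OF N] N1 \<open>coset_len len (N #> \<one>) = 0\<close>])
    show "0 \<le> D" using cg by (simp add: coarsely_geodesic_def)
    show "\<exists>y\<in>carrier (G Mod N). \<exists>z\<in>carrier (G Mod N).
        coset_len len y \<le> r + D \<and> coset_len len z \<le> s + D \<and> A = y <#> z"
      if h: "0 \<le> r" "0 \<le> s" "A \<in> carrier (G Mod N)" "coset_len len A \<le> r + s" for r s A
    proof -
      obtain a where a: "a \<in> carrier G" "A = N #> a" "len a = coset_len len A" by (rule coset_min[OF N h(3)])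
      then have la: "len a \<le> r + s" using h(4) by simp
      obtain g1 g2 where g: "g1 \<in> carrier G" "g2 \<in> carrier G" "a = g1 \<otimes> g2" "len g1 \<le> r + D" "len g2 \<le> s + D"
        by (rule coarsely_geodesic_split[OF cg a(1) la h(1,2)])
      have "A = (N #> g1) <#> (N #> g2)" using N.rcos_sum g a by simp
      moreover have "coset_len len (N #> g1) \<le> r + D" "coset_len len (N #> g2) \<le> s + D"
        using coset_len_le[OF N g(1)] coset_len_le[OF N g(2)] g(4,5) by linarith+
      ultimately show ?thesis using mem[OF g(1)] mem[OF g(2)] by blast
    qed
  qed (use that in auto)
qed

text \<open>A long projection of a shortest coset representative to a translate of \<open>\<langle>c\<rangle>\<close> with
  \<open>c \<in> N\<close> could be cut out by an element of \<open>N\<close>.\<close>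

lemma minimal_projection:
  assumes N: "N \<lhd> G" and c: "c \<in> carrier G" "cyc c \<subseteq> N" "contracting C (cyc c)"
    and a: "a \<in> carrier G" "\<And>n. n \<in> N \<Longrightarrow> len a \<le> len (n \<otimes> a)" and g: "g \<in> carrier G"
    and p: "nearest (g <# cyc c) \<one> p" and q: "nearest (g <# cyc c) a q"
  shows "rho p q \<le> C"
proof (rule ccontr)
  assume "\<not> rho p q \<le> C"
  then have far: "C < rho p q" by simp
  interpret N: normal N G by (rule N)
  have Yc: "cyc c \<subseteq> carrier G" using c by simp
  have 1: "rho \<one> p + rho p q + rho q a - C \<le> rho \<one> a"
    using contractingD[OF contracting_translate[OF c(3) Yc g] p q far] a by blast
  obtain i j :: int where ij: "p = g \<otimes> c [^] i" "q = g \<otimes> c [^] j"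
    using nearest_in[OF p] nearest_in[OF q] by (auto simp: l_coset_def cyc_def)
  \<comment> \<open>Conjugation by \<open>g\<close> turns a power of \<open>c\<close> into the
    element of \<open>N\<close> that slides \<open>q\<close> to \<open>p\<close> along the
    translate; applied to \<open>a\<close>, it removes the stretch between \<open>p\<close> and
    \<open>q\<close>.\<close>
  define n where "n = g \<otimes> c [^] (i - j) \<otimes> inv g"
  have "c [^] (i - j) \<in> N" using c(2) pow_in_cyc by blast
  then have n: "n \<in> N" using N.inv_op_closed2[OF g] by (simp add: n_def)
  then have nc: "n \<in> carrier G" using N.subset by blast
  have pq: "p \<in> carrier G" "q \<in> carrier G" using ij g c by auto
  have nq: "n \<otimes> q = p" using ij g c by (simp add: n_def m_assoc int_pow_mult[symmetric])
  have "len (n \<otimes> a) = rho \<one> (n \<otimes> a)" using nc a by simp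
  also have "\<dots> \<le> rho \<one> p + rho p (n \<otimes> a)" using rho_triangle[of \<one> p "n \<otimes> a"] pq nc a by blast
  also have "rho p (n \<otimes> a) = rho q a" unfolding nq[symmetric] using nc pq a by simp
  finally have "len a \<le> rho \<one> p + rho q a" using a(2)[OF n] by linarith
  then show False using 1 far a by simp
qed

text \<open>Every element of \<open>A\<close> is within \<open>T\<close> of a maximal separated
  subset. Over each of its points lie at most as many elements as a ball of radius \<open>T\<close>
  contains, and weights change there at most by \<open>exp (\<delta> * T)\<close>. Thinning thus
  costs a constant independent of \<open>A\<close>, which divergence outweighs.\<close>

lemma separated_subset:
  assumes A: "finite A" "A \<subseteq> carrier G" and T: "0 \<le> T" and d: "0 \<le> \<delta>"
  obtains A' where "A' \<subseteq> A" "\<And>a b. \<lbrakk>a \<in> A'; b \<in> A'; a \<noteq> b\<rbrakk> \<Longrightarrow> T < rho a b"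
    "(\<Sum>a\<in>A. exp (- \<delta> * len a)) \<le> card {g \<in> carrier G. len g \<le> T} * exp (\<delta> * T) * (\<Sum>a\<in>A'. exp (- \<delta> * len a))"
proof -
  define P where "P = (\<lambda>B. B \<subseteq> A \<and> (\<forall>a\<in>B. \<forall>b\<in>B. a \<noteq> b \<longrightarrow> T < rho a b))"
  have "P {}" by (simp add: P_def)
  moreover have "\<forall>B. P B \<longrightarrow> card B < Suc (card A)" using A card_mono by (fastforce simp: P_def less_Suc_eq_le)
  ultimately obtain A' where A': "P A'" "\<And>B. P B \<Longrightarrow> card B \<le> card A'"
    using ex_has_greatest_nat[of P "{}" card "Suc (card A)"] by blast
  have sub: "A' \<subseteq> A" and finA': "finite A'" using A' A finite_subset by (auto simp: P_def)
  have ex: "\<exists>b\<in>A'. rho b a \<le> T" if a: "a \<in> A" for a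
  proof (cases "a \<in> A'")
    case True
    then show ?thesis using A T a by (auto intro!: bexI[of _ a])
  next
    case False
    have "\<not> P (insert a A')" using A'(2)[of "insert a A'"] False finA' by auto
    then obtain b where "b \<in> A'" "\<not> T < rho a b \<or> \<not> T < rho b a" using A'(1) a unfolding P_def by auto
    moreover have "rho a b = rho b a" using rho_sym A sub a \<open>b \<in> A'\<close> by blast
    ultimately show ?thesis by (intro bexI[of _ b]) auto
  qed
  then obtain n where n: "\<And>a. a \<in> A \<Longrightarrow> n a \<in> A'" "\<And>a. a \<in> A \<Longrightarrow> rho (n a) a \<le> T" by metis
  have im: "n ` A \<subseteq> A'" using n by blast
  have "(\<Sum>a\<in>A. exp (- \<delta> * len a)) = (\<Sum>b\<in>A'. \<Sum>a\<in>{a \<in> A. n a = b}. exp (- \<delta> * len a))"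
    using sum.group[OF A(1) finA' im, of "\<lambda>a. exp (- \<delta> * len a)"] by simp
  also have "\<dots> \<le> (\<Sum>b\<in>A'. card {g \<in> carrier G. len g \<le> T} * exp (\<delta> * T) * exp (- \<delta> * len b))"
  proof (rule sum_mono)
    fix b assume b: "b \<in> A'"
    then have bc: "b \<in> carrier G" using sub A by blast
    have "(\<Sum>a\<in>{a \<in> A. n a = b}. exp (- \<delta> * len a)) \<le> (\<Sum>a\<in>{a \<in> A. n a = b}. exp (\<delta> * T) * exp (- \<delta> * len b))"
    proof (rule sum_mono)
      fix a assume a: "a \<in> {a \<in> A. n a = b}"
      then have ac: "a \<in> carrier G" and r: "rho b a \<le> T" using A n by auto
      have "len b \<le> len a + rho b a" using rho_triangle[of \<one> a b] rho_sym[of a b] ac bc by simp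
      then have "\<delta> * (len b - T) \<le> \<delta> * len a" using r d by (intro mult_left_mono) auto
      then show "exp (- \<delta> * len a) \<le> exp (\<delta> * T) * exp (- \<delta> * len b)"
        by (simp flip: exp_add add: algebra_simps)
    qed
    also have "\<dots> = card {a \<in> A. n a = b} * (exp (\<delta> * T) * exp (- \<delta> * len b))" by simp
    also have "\<dots> \<le> card {g \<in> carrier G. len g \<le> T} * (exp (\<delta> * T) * exp (- \<delta> * len b))"
    proof -
      have "(\<lambda>a. inv b \<otimes> a) ` {a \<in> A. n a = b} \<subseteq> {g \<in> carrier G. len g \<le> T}"
        using A n bc by (force simp: rho_def)
      moreover have "inj_on (\<lambda>a. inv b \<otimes> a) {a \<in> A. n a = b}"
        using A bc by (auto simp: inj_on_def subset_iff)
      ultimately have "card {a \<in> A. n a = b} \<le> card {g \<in> carrier G. len g \<le> T}"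
        using card_inj_on_le finite_ball by blast
      then show ?thesis by (intro mult_right_mono) auto
    qed
    finally show "(\<Sum>a\<in>{a \<in> A. n a = b}. exp (- \<delta> * len a)) \<le> card {g \<in> carrier G. len g \<le> T} * exp (\<delta> * T) * exp (- \<delta> * len b)"
      by (simp add: mult.assoc)
  qed
  also have "\<dots> = card {g \<in> carrier G. len g \<le> T} * exp (\<delta> * T) * (\<Sum>a\<in>A'. exp (- \<delta> * len a))"
    by (simp add: sum_distrib_left)
  finally show ?thesis using that[of A'] A'(1) unfolding P_def by blast
qed

text \<open>Freeness of the words and a weight of at least 2 at \<delta> combine to an exponent
  beyond \<delta>: the surplus factor 2 is spent on raising \<delta>.\<close>

lemma exp_lower_exceeds:
  assumes c: "c \<in> carrier G" and C: "contracting C (cyc c)" "0 \<le> C" and B: "0 \<le> B" and A: "A \<subseteq> carrier G" "finite A"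
    and p1: "\<And>a p. \<lbrakk>a \<in> A; nearest (cyc c) a p\<rbrakk> \<Longrightarrow> len p \<le> B"
    and p2: "\<And>a p. \<lbrakk>a \<in> A; nearest (a <# cyc c) \<one> p\<rbrakk> \<Longrightarrow> rho a p \<le> B"
    and p3: "\<And>a a' p. \<lbrakk>a \<in> A; a' \<in> A; nearest (a <# cyc c) a' p\<rbrakk> \<Longrightarrow> rho a p \<le> B"
    and long: "\<And>a. a \<in> A \<Longrightarrow> 2 * B + C < len a"
    and sep: "\<And>a a'. \<lbrakk>a \<in> A; a' \<in> A; a \<noteq> a'\<rbrakk> \<Longrightarrow> 2 * B + C < rho a a'"
    and E: "finite E" "\<And>m::int. m \<in> E \<Longrightarrow> 2 * B + 2 * C < len (c [^] m)"
      "\<And>m m'. \<lbrakk>m \<in> E; m' \<in> E; m \<noteq> m'\<rbrakk> \<Longrightarrow> 2 * B + 2 * C < len (c [^] (m' - m))"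
    and d: "0 \<le> \<delta>" and big: "2 \<le> (\<Sum>x\<in>A \<times> E. exp (- \<delta> * (len (fst x) + len (c [^] snd x))))"
  obtains s where "\<delta> < s" "exp_lower (carrier G) len s"
proof -
  let ?S = "A \<times> E" and ?\<omega> = "\<lambda>x. len (fst x) + len (c [^] snd x)"
  have fin: "finite ?S" using A E by simp
  have pos: "0 < len (fst x)" "0 < len (c [^] snd x)" if "x \<in> ?S" for x
    using that long[of "fst x"] E(2)[of "snd x"] B C by auto
  define L where "L = Max (insert 0 (?\<omega> ` ?S))"
  have L: "?\<omega> x \<le> L" if "x \<in> ?S" for x using that fin unfolding L_def by (intro Max_ge) auto
  have L0: "0 \<le> L" unfolding L_def using fin by (intro Max_ge) auto
  obtain s where s: "\<delta> < s" "1 \<le> (\<Sum>x\<in>?S. exp (- s * ?\<omega> x))"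
    using raise_exponent[OF fin, of ?\<omega> L \<delta>] L L0 big by blast
  have "exp_lower (carrier G) len s"
  proof (rule free_words_growth[OF fin _ words_inj[OF c C B A(1) p1 p2 p3 long sep E(2,3)], where \<omega> = ?\<omega>])
    show "(\<lambda>(a, m). a \<otimes> c [^] m) ` ?S \<subseteq> carrier G" using A c by auto
    show "0 < ?\<omega> x" if "x \<in> ?S" for x using pos[OF that] by linarith
    show "len (case x of (a, m) \<Rightarrow> a \<otimes> c [^] m) \<le> ?\<omega> x" if "x \<in> ?S" for x
      using that A c len_mult by auto
  qed (use s d in auto)
  then show ?thesis using that s by blast
qed

text \<open>The free words have as letters two powers of \<open>h\<close>, each multiplied by a fixed conjugate of
  another power of \<open>h\<close>.\<close>

lemma growth_positive:
  assumes h: "h \<in> carrier G" "inj (\<lambda>i::int. h [^] i)" and C: "contracting C (cyc h)" "0 \<le> C"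
    and ne: "\<not> elementary_group G"
  obtains s where "0 < s" "exp_lower (carrier G) len s"
proof -
  obtain g where g: "g \<in> carrier G" "\<not> commensurates h g" using not_all_commensurate[OF h C(1) ne] by blast
  obtain B where B: "0 \<le> B" "\<And>(m::int) p. nearest (cyc h) (g \<otimes> h [^] m \<otimes> inv g) p \<Longrightarrow> len p \<le> B"
    using conj_pow_projection_bounded[OF h C g] by blast
  obtain n where n: "n > 0" "\<And>j::int. int n \<le> \<bar>j\<bar> \<Longrightarrow> 2 * B + 2 * C + 2 * len g < len (h [^] j)"
    using large_pow[OF h] by blast
  define u where "u = g \<otimes> h [^] int n \<otimes> inv g"
  have uc: "u \<in> carrier G" using g h by (simp add: u_def)
  have iu: "inv u = g \<otimes> h [^] (- int n) \<otimes> inv g"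
    unfolding u_def using g h by (simp add: inv_mult_group m_assoc int_pow_neg)
  have "len (h [^] int n) = len (inv g \<otimes> u \<otimes> g)" unfolding u_def using g h by (simp add: m_assoc)
  also have "\<dots> \<le> len g + len u + len g"
    using len_mult[of "inv g \<otimes> u" g] len_mult[of "inv g" u] g uc by (simp add: len_inv)
  finally have lu: "2 * B + C < len u" using n(2)[of "int n"] C by simp
  have Yc: "cyc h \<subseteq> carrier G" using h by simp
  \<comment> \<open>Both exponents and their difference have absolute value at least
    \<open>n\<close>, so all the powers required to be long are long.\<close>
  let ?E = "{int n, 2 * int n}"
  have lE: "2 * B + 2 * C < len (h [^] j)" if "int n \<le> \<bar>j\<bar>" for j :: int
    using n(2)[OF that] len_nonneg[OF g(1)] by linarith
  show ?thesis
  proof (rule exp_lower_exceeds[OF h(1) C B(1), of "{u}" ?E 0])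
    show "len p \<le> B" if "a \<in> {u}" "nearest (cyc h) a p" for a p using B(2) that by (auto simp: u_def)
    show "rho a p \<le> B" if "a \<in> {u}" "nearest (a <# cyc h) \<one> p" for a p
    proof -
      have au: "nearest (u <# cyc h) \<one> p" "a = u" using that by auto
      obtain p' where p': "p = u \<otimes> p'" "nearest (cyc h) (inv u \<otimes> \<one>) p'"
        by (rule nearest_translateE[OF au(1) Yc one_closed uc])
      have "p' \<in> carrier G" using p'(2) Yc nearest_carrier by blast
      moreover have "nearest (cyc h) (inv u) p'" using p'(2) uc by simp
      then have "len p' \<le> B" unfolding iu by (rule B(2))
      ultimately show ?thesis using p'(1) uc au(2) by simp
    qed
    show "rho a p \<le> B" if "a \<in> {u}" "a' \<in> {u}" "nearest (a <# cyc h) a' p" for a a' p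
    proof -
      have "rho u p \<le> rho u u" using that nearest_le[OF _ l_coset_memI[OF one_in_cyc]] uc by fastforce
      then show ?thesis using that B uc by simp
    qed
    show "2 * B + 2 * C < len (h [^] m)" if "m \<in> ?E" for m using that by (intro lE) auto
    show "2 * B + 2 * C < len (h [^] (m' - m))" if "m \<in> ?E" "m' \<in> ?E" "m \<noteq> m'" for m m'
      using that by (intro lE) auto
    \<comment> \<open>At exponent 0 every letter has weight 1, and there are two letters.\<close>
    show "2 \<le> (\<Sum>x\<in>{u} \<times> ?E. exp (- 0 * (len (fst x) + len (h [^] snd x))))"
      using n(1) by (simp add: card_cartesian_product)
  qed (use uc lu that in auto)
qed

text \<open>The series of the quotient diverges at \<open>\<delta>'\<close>, so finitely many
  shortest representatives outweigh every constant lost on the way to free words. For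
  \<open>\<delta>' = 0\<close> the divergence argument is replaced by positivity of the growth of
  the group.\<close>

theorem quotient_growth_gap:
  assumes h: "h \<in> carrier G" "inj (\<lambda>i::int. h [^] i)" and C: "contracting C (cyc h)" "0 \<le> C"
    and ne: "\<not> elementary_group G" and N: "N \<lhd> G" "infinite N"
    and \<delta>: "growth_rate (carrier G) len \<delta>" and \<delta>': "growth_rate (carrier (G Mod N)) (coset_len len) \<delta>'"
  shows "\<delta>' < \<delta>"
proof (cases "\<delta>' = 0")
  case True
  obtain s where "0 < s" "exp_lower (carrier G) len s" by (rule growth_positive[OF h C ne])
  then show ?thesis using exp_lower_le_rate[OF _ \<delta>, of s] True by simp
next
  case False
  then have d0: "0 < \<delta>'" using \<delta>' by (simp add: growth_rate_def)
  interpret N: normal N G by (rule N(1))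
  obtain f where f: "f \<in> N" "\<not> commensurates h f" using normal_not_commensurate[OF h C(1) ne N] by blast
  have fc: "f \<in> carrier G" using f N.subset by blast
  obtain m :: int and K where K: "0 \<le> K" and con: "contracting K (cyc (h [^] m \<otimes> (f \<otimes> inv (h [^] m) \<otimes> inv f)))"
    and inj: "inj (\<lambda>i::int. (h [^] m \<otimes> (f \<otimes> inv (h [^] m) \<otimes> inv f)) [^] i)"
    by (rule contracting_commutator[OF h C fc f(2)])
  define c where "c = h [^] m \<otimes> (f \<otimes> inv (h [^] m) \<otimes> inv f)"
  have con: "contracting K (cyc c)" and inj: "inj (\<lambda>i::int. c [^] i)" using con inj by (simp_all add: c_def)
  have cc: "c \<in> carrier G" using h fc by (simp add: c_def)
  have "c = (h [^] m \<otimes> f \<otimes> inv (h [^] m)) \<otimes> inv f" using h fc by (simp add: c_def m_assoc)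
  then have "c \<in> N" using N.inv_op_closed2[of "h [^] m" f] h f by simp
  then have cN: "cyc c \<subseteq> N" using subgroup_int_pow_closed[OF N.subgroup_axioms] by (auto simp: cyc_def)
  have Yc: "cyc c \<subseteq> carrier G" using cc by simp
  have proj: "rho p q \<le> K"
    if "a \<in> carrier G" "\<And>n. n \<in> N \<Longrightarrow> len a \<le> len (n \<otimes> a)" "g \<in> carrier G"
      "nearest (g <# cyc c) \<one> p" "nearest (g <# cyc c) a q" for a g p q
    by (rule minimal_projection[OF N(1) cc cN con that])
  have "\<forall>A\<in>carrier (G Mod N). \<exists>a. a \<in> carrier G \<and> A = N #> a \<and> len a = coset_len len A \<and> (\<forall>n\<in>N. len a \<le> len (n \<otimes> a))"
  proof
    fix A assume "A \<in> carrier (G Mod N)"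
    then obtain a where "a \<in> carrier G" "A = N #> a" "len a = coset_len len A" "\<And>n. n \<in> N \<Longrightarrow> len a \<le> len (n \<otimes> a)"
      by (rule coset_min[OF N(1)]) blast
    then show "\<exists>a. a \<in> carrier G \<and> A = N #> a \<and> len a = coset_len len A \<and> (\<forall>n\<in>N. len a \<le> len (n \<otimes> a))" by blast
  qed
  then have "\<exists>\<mu>. \<forall>A\<in>carrier (G Mod N). \<mu> A \<in> carrier G \<and> A = N #> \<mu> A \<and> len (\<mu> A) = coset_len len A \<and> (\<forall>n\<in>N. len (\<mu> A) \<le> len (n \<otimes> \<mu> A))"
    by (rule bchoice)
  then obtain \<mu> where \<mu>: "\<And>A. A \<in> carrier (G Mod N) \<Longrightarrow> \<mu> A \<in> carrier G" "\<And>A. A \<in> carrier (G Mod N) \<Longrightarrow> A = N #> \<mu> A"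
    "\<And>A. A \<in> carrier (G Mod N) \<Longrightarrow> len (\<mu> A) = coset_len len A"
    "\<And>A n. \<lbrakk>A \<in> carrier (G Mod N); n \<in> N\<rbrakk> \<Longrightarrow> len (\<mu> A) \<le> len (n \<otimes> \<mu> A)" by blast
  have inj\<mu>: "inj_on \<mu> (carrier (G Mod N))" using \<mu>(2) by (metis inj_onI)
  obtain n :: nat where n: "n > 0" "\<And>j::int. int n \<le> \<bar>j\<bar> \<Longrightarrow> 6 * K < len (c [^] j)"
    using large_pow[OF cc inj] by blast
  define l where "l = len (c [^] int n)"
  \<comment> \<open>Projections to translates are bounded by 2 K, one \<open>K\<close> for each of
    two comparisons with the identity. With \<open>B = 2 * K\<close> the separation 2 B + C of
    \<open>words_inj\<close> is 5 K, and the length 2 B + 2 C required of the power of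
    \<open>c\<close> is 6 K.\<close>
  define T where "T = 5 * K"
  define \<beta> where "\<beta> = real (card {g \<in> carrier G. len g \<le> T})"
  have T0: "0 \<le> T" using K by (simp add: T_def)
  have "\<one> \<in> {g \<in> carrier G. len g \<le> T}" using T0 by (simp add: len_one)
  then have \<beta>: "0 < \<beta>" unfolding \<beta>_def using finite_ball[of T] by (auto simp: card_gt_0_iff)
  \<comment> \<open>Collects all losses: \<beta> for the representatives of length at most
    \<open>T\<close>, \<open>\<beta> * exp (\<delta>' * T)\<close> for thinning,
    \<open>exp (\<delta>' * l)\<close> for the appended power of \<open>c\<close>, and the surplus
    2.\<close>
  define Q where "Q = \<beta> + \<beta> * exp (\<delta>' * T) * (2 * exp (\<delta>' * l))"
  have "\<not> exp_summable (carrier (G Mod N)) (coset_len len) \<delta>'"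
    by (rule exp_lower_not_summable[OF _ d0 normal.finite_coset_ball[OF N(1) finite_ball]]) (use \<delta>' in \<open>simp add: growth_rate_def\<close>)
  then obtain F where F: "finite F" "F \<subseteq> carrier (G Mod N)" "Q < (\<Sum>A\<in>F. exp (- \<delta>' * coset_len len A))"
    unfolding exp_summable_def by (metis not_le)
  define A0 where "A0 = \<mu> ` F"
  have A0: "finite A0" "A0 \<subseteq> carrier G" using F \<mu>(1) by (auto simp: A0_def)
  have sumA0: "Q < (\<Sum>a\<in>A0. exp (- \<delta>' * len a))"
    unfolding A0_def using F \<mu>(3) inj_on_subset[OF inj\<mu> F(2)] by (subst sum.reindex) (auto simp: subset_iff)
  have minA0: "len a \<le> len (n \<otimes> a)" if "a \<in> A0" "n \<in> N" for a n using that F \<mu>(4) by (auto simp: A0_def)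
  define A1 where "A1 = {a \<in> A0. T < len a}"
  have A1: "finite A1" "A1 \<subseteq> carrier G" using A0 by (auto simp: A1_def)
  have "(\<Sum>a\<in>A0. exp (- \<delta>' * len a)) = (\<Sum>a\<in>A1. exp (- \<delta>' * len a)) + (\<Sum>a\<in>A0 - A1. exp (- \<delta>' * len a))"
    using A0 by (subst sum.subset_diff[of A1 A0]) (auto simp: A1_def)
  moreover have "(\<Sum>a\<in>A0 - A1. exp (- \<delta>' * len a)) \<le> \<beta>"
  proof -
    have "(\<Sum>a\<in>A0 - A1. exp (- \<delta>' * len a)) \<le> (\<Sum>a\<in>A0 - A1. 1)"
      using d0 A0 len_nonneg by (intro sum_mono) (auto simp: subset_iff)
    also have "\<dots> = real (card (A0 - A1))" by simp
    also have "\<dots> \<le> \<beta>" unfolding \<beta>_def using A0 by (intro of_nat_mono card_mono finite_ball) (auto simp: A1_def)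
    finally show ?thesis .
  qed
  ultimately have sumA1: "\<beta> * exp (\<delta>' * T) * (2 * exp (\<delta>' * l)) < (\<Sum>a\<in>A1. exp (- \<delta>' * len a))"
    using sumA0 by (simp add: Q_def)
  obtain A where A: "A \<subseteq> A1" "\<And>a b. \<lbrakk>a \<in> A; b \<in> A; a \<noteq> b\<rbrakk> \<Longrightarrow> T < rho a b"
    "(\<Sum>a\<in>A1. exp (- \<delta>' * len a)) \<le> card {g \<in> carrier G. len g \<le> T} * exp (\<delta>' * T) * (\<Sum>a\<in>A. exp (- \<delta>' * len a))"
    by (rule separated_subset[OF A1 T0 less_imp_le[OF d0]]) (rule that)
  have "\<beta> * exp (\<delta>' * T) * (2 * exp (\<delta>' * l)) < \<beta> * exp (\<delta>' * T) * (\<Sum>a\<in>A. exp (- \<delta>' * len a))"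
    using sumA1 A(3) unfolding \<beta>_def by linarith
  then have sumA: "2 * exp (\<delta>' * l) < (\<Sum>a\<in>A. exp (- \<delta>' * len a))" using \<beta> by simp
  have Afin: "finite A" by (rule finite_subset[OF A(1) A1(1)])
  have Ac: "a \<in> carrier G" if "a \<in> A" for a using A(1) A1(2) that by blast
  have Amin: "len a \<le> len (n \<otimes> a)" if "a \<in> A" "n \<in> N" for a n using A(1) minA0 that by (auto simp: A1_def)
  have one_near: "nearest (cyc c) \<one> \<one>" using nearest_self[OF Yc one_in_cyc] .
  have near_one: "rho a p \<le> K" if a: "a \<in> A" and p: "nearest (a <# cyc c) \<one> p" for a p
  proof -
    have "a \<in> a <# cyc c" using l_coset_memI[OF one_in_cyc, of a c] Ac[OF a] by simp
    then have "nearest (a <# cyc c) a a" using nearest_self[OF l_coset_carrier[OF Ac[OF a] Yc]] by blast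
    then have "rho p a \<le> K" using proj[OF Ac[OF a] Amin[OF a] Ac[OF a] p] by blast
    moreover have "p \<in> carrier G" using p l_coset_carrier[OF Ac[OF a] Yc] nearest_carrier by blast
    ultimately show ?thesis using rho_sym[of p a] Ac[OF a] by simp
  qed
  obtain s where s: "\<delta>' < s" "exp_lower (carrier G) len s"
  proof (rule exp_lower_exceeds[OF cc con K, of "2 * K" A "{int n}" \<delta>'])
    show "len p \<le> 2 * K" if a: "a \<in> A" and p: "nearest (cyc c) a p" for a p
    proof -
      have "\<one> <# cyc c = cyc c" using Yc by (rule lcos_mult_one)
      then have "rho \<one> p \<le> K" using proj[OF Ac[OF a] Amin[OF a] one_closed, of \<one> p] one_near p by simp
      moreover have "p \<in> carrier G" using p Yc nearest_carrier by blast
      ultimately show ?thesis using K by simp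
    qed
    show "rho a p \<le> 2 * K" if "a \<in> A" "nearest (a <# cyc c) \<one> p" for a p
      using near_one[OF that] K by linarith
    show "rho a p \<le> 2 * K" if a: "a \<in> A" "a' \<in> A" and p: "nearest (a <# cyc c) a' p" for a a' p
    proof -
      have Zc: "a <# cyc c \<subseteq> carrier G" using l_coset_carrier[OF Ac[OF a(1)] Yc] .
      have Zne: "a <# cyc c \<noteq> {}" using l_coset_memI[OF one_in_cyc] by blast
      obtain q where q: "nearest (a <# cyc c) \<one> q" using nearest_exists[OF Zc Zne one_closed] by blast
      have "rho q p \<le> K" using proj[OF Ac[OF a(2)] Amin[OF a(2)] Ac[OF a(1)] q p] .
      moreover have "rho a q \<le> K" using near_one[OF a(1) q] .
      moreover have "rho a p \<le> rho a q + rho q p"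
        using rho_triangle Ac[OF a(1)] nearest_carrier[OF q Zc] nearest_carrier[OF p Zc] by blast
      ultimately show ?thesis by linarith
    qed
    show "2 * (2 * K) + K < len a" if "a \<in> A" for a using A(1) that by (auto simp: A1_def T_def)
    show "2 * (2 * K) + K < rho a a'" if "a \<in> A" "a' \<in> A" "a \<noteq> a'" for a a' using A(2)[OF that] by (simp add: T_def)
    show "2 * (2 * K) + 2 * K < len (c [^] m)" if "m \<in> {int n}" for m using that n(2)[of "int n"] by simp
    have "2 = 2 * exp (\<delta>' * l) * exp (- \<delta>' * l)" by (simp add: exp_minus)
    also have "\<dots> \<le> (\<Sum>a\<in>A. exp (- \<delta>' * len a)) * exp (- \<delta>' * l)" using sumA by (intro mult_right_mono) auto
    also have "\<dots> = (\<Sum>a\<in>A. exp (- \<delta>' * (len a + l)))"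
      by (simp add: sum_distrib_right distrib_left flip: exp_add)
    also have "\<dots> = (\<Sum>x\<in>A \<times> {int n}. exp (- \<delta>' * (len (fst x) + len (c [^] snd x))))"
      by (simp add: sum.cartesian_product' l_def)
    finally show "2 \<le> (\<Sum>x\<in>A \<times> {int n}. exp (- \<delta>' * (len (fst x) + len (c [^] snd x))))" .
  qed (use Ac Afin K d0 in auto)
  have "s \<le> \<delta>" using exp_lower_le_rate[OF s(2) \<delta>] .
  then show ?thesis using s by linarith
qed

end

section \<open>From strongly contracting elements to contracting subgroups\<close>

lemma geodesic_segmentD:
  assumes "geodesic_segment X d x y P"
  shows "P \<subseteq> X" "P \<noteq> {}" "\<And>w. w \<in> P \<Longrightarrow> d x y = d x w + d w y"
proof -
  obtain \<gamma> L where g: "0 \<le> L" "\<gamma> ` {0..L} \<subseteq> X" "\<And>s t. \<lbrakk>s \<in> {0..L}; t \<in> {0..L}\<rbrakk> \<Longrightarrow> d (\<gamma> s) (\<gamma> t) = \<bar>s - t\<bar>"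
    "\<gamma> 0 = x" "\<gamma> L = y" "P = \<gamma> ` {0..L}"
    using assms unfolding geodesic_segment_def by blast
  show "P \<subseteq> X" "P \<noteq> {}" using g by auto
  fix w assume "w \<in> P"
  then obtain t where t: "t \<in> {0..L}" "w = \<gamma> t" using g by blast
  show "d x y = d x w + d w y"
    using g(3)[of 0 L] g(3)[of 0 t] g(3)[of t L] t g(1) by (simp flip: g(4,5))
qed

lemma geodesic_segment_ends:
  assumes "geodesic_segment X d x y P"
  shows "x \<in> P" "y \<in> P"
proof -
  obtain \<gamma> and L :: real where "0 \<le> L" "\<gamma> 0 = x" "\<gamma> L = y" "P = \<gamma> ` {0..L}"
    using assms unfolding geodesic_segment_def by blast
  then show "x \<in> P" "y \<in> P" by auto
qed

text \<open>The distance to \<open>P\<close> is an infimum; a point of \<open>P\<close> realising it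
  up to 1 suffices, and this slack accounts for the summand 2.\<close>

lemma (in Metric_space) near_geodesic:
  assumes P: "geodesic_segment M d x y P" and z: "z \<in> M" "dist_to_set d z P \<le> C" and xy: "x \<in> M" "y \<in> M"
  shows "d x z + d z y \<le> d x y + 2 * C + 2"
proof -
  have "Inf (d z ` P) < C + 1" using z unfolding dist_to_set_def by linarith
  moreover have "bdd_below (d z ` P)" by (intro bdd_belowI[of _ 0]) auto
  ultimately obtain w where w: "w \<in> P" "d z w < C + 1"
    using cInf_less_iff[of "d z ` P" "C + 1"] geodesic_segmentD(2)[OF P] by auto
  have wM: "w \<in> M" using w geodesic_segmentD(1)[OF P] by blast
  have "d x y = d x w + d w y" using geodesic_segmentD(3)[OF P w(1)] .
  moreover have "d x z \<le> d x w + d z w" "d z y \<le> d z w + d w y"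
    using triangle[of x w z] triangle[of z w y] commute wM z xy by (metis, simp)
  ultimately show ?thesis using w by linarith
qed

text \<open>The geodesic condition is used twice: a geodesic from \<open>x\<close> to
  \<open>y\<close> passes near \<open>\<pi> y\<close>, and one from \<open>x\<close> to
  \<open>\<pi> y\<close> passes near \<open>\<pi> x\<close>, because \<open>\<pi>\<close> almost
  fixes \<open>\<pi> y\<close>. Each use costs 2 C + 2.\<close>

lemma (in Metric_space) strongly_contracting_ineq:
  assumes geo: "geodesic_metric_space M d" and \<pi>: "strongly_contracting_projection M d C P \<pi>"
    and P: "P \<subseteq> M" and C: "0 < C" and xy: "x \<in> M" "y \<in> M" and far: "4 * C + 4 < d (\<pi> x) (\<pi> y)"
  shows "d x (\<pi> x) + d (\<pi> x) (\<pi> y) + d (\<pi> y) y - (4 * C + 4) \<le> d x y"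
proof -
  have im: "\<pi> u \<in> P" "\<pi> u \<in> M" if "u \<in> M" for u using \<pi> P that unfolding strongly_contracting_projection_def by blast+
  have near: "d u (\<pi> u) + d (\<pi> u) v \<le> d u v + 2 * C + 2" "d u (\<pi> v) + d (\<pi> v) v \<le> d u v + 2 * C + 2"
    if uv: "u \<in> M" "v \<in> M" "C < d (\<pi> u) (\<pi> v)" for u v
  proof -
    obtain Q where Q: "geodesic_segment M d u v Q" using geo uv unfolding geodesic_metric_space_def by blast
    have "dist_to_set d (\<pi> u) Q \<le> C" "dist_to_set d (\<pi> v) Q \<le> C"
      using \<pi> uv Q unfolding strongly_contracting_projection_def by blast+
    then show "d u (\<pi> u) + d (\<pi> u) v \<le> d u v + 2 * C + 2" "d u (\<pi> v) + d (\<pi> v) v \<le> d u v + 2 * C + 2"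
      using near_geodesic[OF Q] im uv by blast+
  qed
  let ?z = "\<pi> y"
  have z: "d ?z (\<pi> ?z) \<le> C" using \<pi> im xy unfolding strongly_contracting_projection_def by blast
  have m: "\<pi> x \<in> M" "?z \<in> M" "\<pi> ?z \<in> M" using im xy by auto
  have "d (\<pi> x) ?z \<le> d (\<pi> x) (\<pi> ?z) + d ?z (\<pi> ?z)" using triangle[of "\<pi> x" "\<pi> ?z" ?z] commute m by metis
  then have "C < d (\<pi> x) (\<pi> ?z)" using z far C by linarith
  then have "d x (\<pi> x) + d (\<pi> x) ?z \<le> d x ?z + 2 * C + 2" using near(1)[OF xy(1) m(2)] by blast
  moreover have "d x ?z + d ?z y \<le> d x y + 2 * C + 2" using near(2)[OF xy] far C by simp
  ultimately show ?thesis by linarith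
qed

text \<open>A quasi-geodesic running far from the image of a contracting projection advances much
  faster than its projection, so it can do so only for a bounded time.\<close>

lemma (in Metric_space) quasi_geodesic_near:
  fixes x :: "int \<Rightarrow> 'a"
  assumes x: "\<And>i. x i \<in> M" and step: "\<And>i. d (x i) (x (i + 1)) \<le> s" and s: "0 \<le> s"
    and quasi: "\<And>i j. \<bar>real_of_int (i - j)\<bar> / L - A \<le> d (x i) (x j)" and L: "1 \<le> L" and A: "0 \<le> A" and K: "0 < K"
  shows "\<exists>D. \<forall>\<pi> a b i. \<pi> ` M \<subseteq> M \<and>
     (\<forall>u\<in>M. \<forall>v\<in>M. K < d (\<pi> u) (\<pi> v) \<longrightarrow> d u (\<pi> u) + d (\<pi> u) (\<pi> v) + d (\<pi> v) v - K \<le> d u v) \<and>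
     d (x a) (\<pi> (x a)) \<le> K \<and> d (x b) (\<pi> (x b)) \<le> K \<and> a \<le> i \<and> i \<le> b \<longrightarrow> d (x i) (\<pi> (x i)) \<le> D"
proof -
  \<comment> \<open>Far from the image the projection advances at most \<open>K\<close> per
    \<open>b0\<close> steps. This choice makes its speed at most 1/(2 L), half of the lower speed
    1/L of the quasi-geodesic.\<close>
  define b0 where "b0 = nat \<lceil>2 * L * K\<rceil> + 1"
  have b0: "2 * L * K \<le> real b0" "0 < b0" unfolding b0_def by linarith+
  have Kb: "K / real b0 \<le> 1 / (2 * L)" using b0 L by (simp add: field_simps)
  have Kb1: "K / real b0 \<le> K" using b0 K by (simp add: field_simps)
  \<comment> \<open>In \<open>b0\<close> steps the path moves at most \<open>s * real b0\<close>; if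
    one of two such points is farther than \<open>D0\<close> from its projection, the contraction
    inequality leaves no room for projections more than \<open>K\<close> apart.\<close>
  define D0 where "D0 = s * real b0 + K"
  have D0: "K \<le> D0" "0 \<le> D0" using s K by (auto simp: D0_def)
  \<comment> \<open>Bounds the duration of an excursion beyond \<open>D0\<close>: over
    \<open>j - i\<close> steps the endpoints are at least (j - i)/L - A apart, but at most 2 D0 + 2
    K + (j - i)/(2 L).\<close>
  define W where "W = 2 * L * (A + 2 * D0 + 2 * K)"
  define D where "D = s * W + D0 + 2 * K + K * W"
  have W0: "0 \<le> W" using L A D0 K by (simp add: W_def)
  have steps: "d (x i) (x (i + int n)) \<le> s * real n" for i n
  proof (induction n)
    case (Suc n)
    have "d (x i) (x (i + int (Suc n))) \<le> d (x i) (x (i + int n)) + d (x (i + int n)) (x (i + int n + 1))"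
      using triangle[OF x[of i] x[of "i + int n"] x[of "i + int n + 1"]] by (simp add: add.assoc add.commute[of 1])
    then show ?case using Suc step[of "i + int n"] by (simp add: algebra_simps)
  qed (use x in simp)
  have dist: "d (x i) (x j) \<le> s * real_of_int (j - i)" if "i \<le> j" for i j
    using steps[of i "nat (j - i)"] that by simp
  have main: "d (x i0) (\<pi> (x i0)) \<le> D"
    if im: "\<pi> ` M \<subseteq> M" and con: "\<And>u v. \<lbrakk>u \<in> M; v \<in> M; K < d (\<pi> u) (\<pi> v)\<rbrakk> \<Longrightarrow> d u (\<pi> u) + d (\<pi> u) (\<pi> v) + d (\<pi> v) v - K \<le> d u v"
      and ea: "d (x a) (\<pi> (x a)) \<le> K" and eb: "d (x b) (\<pi> (x b)) \<le> K" and ab: "a \<le> i0" "i0 \<le> b" for \<pi> a b i0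
  proof (cases "d (x i0) (\<pi> (x i0)) \<le> D0")
    case True
    moreover have "0 \<le> s * W" "0 \<le> K * W" using s W0 K by auto
    ultimately show ?thesis using K unfolding D_def by linarith
  next
    case False
    define e where "e = (\<lambda>i. d (x i) (\<pi> (x i)))"
    have px: "\<pi> (x i) \<in> M" for i using im x by blast
    have near: "d (\<pi> (x i)) (\<pi> (x j)) \<le> K" if "i \<le> j" "j \<le> i + int b0" "D0 < e i \<or> D0 < e j" for i j
    proof (rule ccontr)
      assume n: "\<not> d (\<pi> (x i)) (\<pi> (x j)) \<le> K"
      then have "e i + d (\<pi> (x i)) (\<pi> (x j)) + e j - K \<le> d (x i) (x j)"
        using con[OF x x, of i j] commute unfolding e_def by (metis not_le)
      moreover have "d (x i) (x j) \<le> s * real b0"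
      proof -
        have "real_of_int (j - i) \<le> real b0" using that by linarith
        then show ?thesis using dist[OF that(1)] s by (meson mult_left_mono order_trans)
      qed
      moreover have "0 \<le> e i" "0 \<le> e j" by (auto simp: e_def)
      ultimately show False using that(3) n K by (auto simp: D0_def)
    qed
    have chain: "d (\<pi> (x i)) (\<pi> (x (i + int n))) \<le> K * (real n / real b0 + 1)"
      if "\<And>m. i \<le> m \<Longrightarrow> m < i + int n \<Longrightarrow> D0 < e m" for i n
      using that
    proof (induction n arbitrary: i rule: less_induct)
      case (less n)
      consider "n = 0" | "0 < n" "n \<le> b0" | "b0 < n" by linarith
      then show ?case
      proof cases
        case 1
        then show ?thesis using px K by simp
      next
        case 2
        then have "d (\<pi> (x i)) (\<pi> (x (i + int n))) \<le> K" using near[of i "i + int n"] less.prems[of i] by simp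
        moreover have "0 \<le> K * (real n / real b0)" using K by simp
        ultimately show ?thesis by (simp add: distrib_left)
      next
        case 3
        let ?i = "i + int b0"
        have 1: "d (\<pi> (x i)) (\<pi> (x ?i)) \<le> K" using near[of i ?i] less.prems[of i] 3 by simp
        have "d (\<pi> (x ?i)) (\<pi> (x (?i + int (n - b0)))) \<le> K * (real (n - b0) / real b0 + 1)"
          using less.IH[of "n - b0" ?i] less.prems 3 b0(2) by simp
        then have 2: "d (\<pi> (x ?i)) (\<pi> (x (i + int n))) \<le> K * (real n / real b0)"
          using 3 b0(2) by (simp add: of_nat_diff diff_divide_distrib)
        show ?thesis using triangle[OF px[of i] px[of ?i] px[of "i + int n"]] 1 2 by (simp add: distrib_left)
      qed
    qed
    let ?S = "{m \<in> {a..i0}. e m \<le> D0}" and ?T = "{m \<in> {i0..b}. e m \<le> D0}"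
    \<comment> \<open>\<open>i\<close> and \<open>j\<close> delimit the excursion around
      \<open>i0\<close>: the last index before it and the first one after it at which the path is
      within \<open>D0\<close> of its projection.\<close>
    define i where "i = Max ?S"
    define j where "j = Min ?T"
    have fin: "finite ?S" "finite ?T" by (rule finite_subset[of _ "{a..b}"], use ab in auto)+
    have "a \<in> ?S" "b \<in> ?T" using ab ea eb D0 by (auto simp: e_def)
    then have i: "i \<in> ?S" and j: "j \<in> ?T" unfolding i_def j_def using Max_in[OF fin(1)] Min_in[OF fin(2)] by blast+
    have iS: "m \<le> i" if "m \<in> ?S" for m using Max_ge[OF fin(1) that] by (simp add: i_def)
    have jT: "j \<le> m" if "m \<in> ?T" for m using Min_le[OF fin(2) that] by (simp add: j_def)
    have e0: "D0 < e i0" using False by (simp add: e_def)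
    have ij: "i < i0" "i0 < j" using i j e0 by (auto simp: order.order_iff_strict)
    have far: "D0 < e m" if "i < m" "m < j" for m
    proof (rule ccontr)
      assume n: "\<not> D0 < e m"
      show False
      proof (cases "m \<le> i0")
        case True
        then have "m \<in> ?S" using n that i by auto
        then show False using iS that by fastforce
      next
        case False
        then have "m \<in> ?T" using n that j by auto
        then show False using jT that by fastforce
      qed
    qed
    have first: "d (\<pi> (x i)) (\<pi> (x (i + 1))) \<le> K" using near[of i "i + 1"] far[of "i + 1"] ij b0 by simp
    have rest: "d (\<pi> (x (i + 1))) (\<pi> (x m)) \<le> K * (real_of_int (m - i) / real b0 + 1)" if "i < m" "m \<le> j" for m
    proof -
      have "d (\<pi> (x (i + 1))) (\<pi> (x (i + 1 + int (nat (m - i - 1))))) \<le> K * (real (nat (m - i - 1)) / real b0 + 1)"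
        using far that by (intro chain) auto
      also have "\<dots> \<le> K * (real_of_int (m - i) / real b0 + 1)"
        using K that by (intro mult_left_mono add_mono divide_right_mono) auto
      finally show ?thesis using that by simp
    qed
    have "d (x i) (x j) \<le> e i + d (\<pi> (x i)) (\<pi> (x (i + 1))) + d (\<pi> (x (i + 1))) (\<pi> (x j)) + e j"
      using triangle[OF x[of i] px[of i] x[of j]] triangle[OF px[of i] px[of "i + 1"] x[of j]] triangle[OF px[of "i + 1"] px[of j] x[of j]]
        commute[of "\<pi> (x j)" "x j"] unfolding e_def by linarith
    then have "d (x i) (x j) \<le> 2 * D0 + 2 * K + K * (real_of_int (j - i) / real b0)"
      using first rest[of j] i j ij by (simp add: distrib_left)
    also have "K * (real_of_int (j - i) / real b0) \<le> real_of_int (j - i) / (2 * L)"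
      using mult_right_mono[OF Kb, of "real_of_int (j - i)"] ij by simp
    finally have "\<bar>real_of_int (i - j)\<bar> / L - A \<le> 2 * D0 + 2 * K + real_of_int (j - i) / (2 * L)"
      using quasi[of i j] by linarith
    then have "real_of_int (j - i) / L - real_of_int (j - i) / (2 * L) \<le> A + 2 * D0 + 2 * K" using ij by simp
    moreover have "real_of_int (j - i) / L - real_of_int (j - i) / (2 * L) = real_of_int (j - i) / (2 * L)"
      using L by (simp add: field_simps)
    ultimately have "real_of_int (j - i) / (2 * L) \<le> A + 2 * D0 + 2 * K" by linarith
    then have W: "real_of_int (j - i) \<le> W" using L by (simp add: W_def pos_divide_le_eq mult.commute)
    have 1: "d (x i) (x i0) \<le> s * W"
    proof -
      have "s * real_of_int (i0 - i) \<le> s * W" using W ij s by (intro mult_left_mono) auto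
      then show ?thesis using dist[of i i0] ij by linarith
    qed
    have 2: "d (\<pi> (x (i + 1))) (\<pi> (x i0)) \<le> K + K * W"
    proof -
      have "K * (real_of_int (i0 - i) / real b0) \<le> K * real_of_int (i0 - i)"
        using mult_right_mono[OF Kb1, of "real_of_int (i0 - i)"] ij by simp
      also have "\<dots> \<le> K * W" using W ij K by (intro mult_left_mono) auto
      finally show ?thesis using rest[of i0] ij by (simp add: distrib_left)
    qed
    have "e i0 \<le> d (x i) (x i0) + e i + d (\<pi> (x i)) (\<pi> (x (i + 1))) + d (\<pi> (x (i + 1))) (\<pi> (x i0))"
      using triangle[OF x[of i0] x[of i] px[of i0]] triangle[OF x[of i] px[of i] px[of i0]] triangle[OF px[of i] px[of "i + 1"] px[of i0]]
        commute[of "x i0" "x i"] unfolding e_def by linarith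
    then show ?thesis using 1 2 first i unfolding D_def e_def by auto
  qed
  show ?thesis
  proof (intro exI[of _ D] allI impI, elim conjE)
    fix \<pi> a b i
    assume "\<pi> ` M \<subseteq> M" "d (x a) (\<pi> (x a)) \<le> K" "d (x b) (\<pi> (x b)) \<le> K" "a \<le> i" "i \<le> b"
      and "\<forall>u\<in>M. \<forall>v\<in>M. K < d (\<pi> u) (\<pi> v) \<longrightarrow> d u (\<pi> u) + d (\<pi> u) (\<pi> v) + d (\<pi> v) v - K \<le> d u v"
    then show "d (x i) (\<pi> (x i)) \<le> D" using main[of \<pi> a b i] by simp
  qed
qed

text \<open>A discrete intermediate value argument: the projected points run along \<open>P\<close>
  from near one end to near the other in jumps of at most 2 D + s, so they come that close to each
  point of \<open>P\<close> between them.\<close>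

lemma (in Metric_space) geodesic_near_sequence:
  fixes x :: "int \<Rightarrow> 'a"
  assumes x: "\<And>i. x i \<in> M" and step: "\<And>i. d (x i) (x (i + 1)) \<le> s" and ab: "a \<le> b"
    and P: "geodesic_segment M d (x a) (x b) P"
    and near: "\<And>i. \<lbrakk>a \<le> i; i \<le> b\<rbrakk> \<Longrightarrow> \<pi> (x i) \<in> P \<and> d (x i) (\<pi> (x i)) \<le> D" and w: "w \<in> P"
  shows "\<exists>i. d w (x i) \<le> 3 * D + s"
proof -
  obtain \<gamma> L where g: "0 \<le> L" "\<gamma> ` {0..L} \<subseteq> M" "\<And>s t. \<lbrakk>s \<in> {0..L}; t \<in> {0..L}\<rbrakk> \<Longrightarrow> d (\<gamma> s) (\<gamma> t) = \<bar>s - t\<bar>"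
    "\<gamma> 0 = x a" "\<gamma> L = x b" "P = \<gamma> ` {0..L}"
    using P unfolding geodesic_segment_def by blast
  obtain t where t: "t \<in> {0..L}" "w = \<gamma> t" using w g by blast
  have "\<forall>i\<in>{a..b}. \<exists>u. u \<in> {0..L} \<and> \<pi> (x i) = \<gamma> u" using near g(6) by fastforce
  then obtain \<tau> where \<tau>: "\<And>i. i \<in> {a..b} \<Longrightarrow> \<tau> i \<in> {0..L}" "\<And>i. i \<in> {a..b} \<Longrightarrow> \<pi> (x i) = \<gamma> (\<tau> i)" by metis
  have D0: "0 \<le> D" using near[of a] ab nonneg[of "x a" "\<pi> (x a)"] by linarith
  have s0: "0 \<le> s" using step[of a] nonneg[of "x a" "x (a + 1)"] by linarith
  have ends: "\<tau> a \<le> D" "L - \<tau> b \<le> D"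
    using near[of a] near[of b] g(3)[of 0 "\<tau> a"] g(3)[of L "\<tau> b"] g(1,4,5) \<tau> ab by auto
  consider "t \<le> \<tau> a" | "\<tau> b \<le> t" | "\<tau> a < t" "t < \<tau> b" by linarith
  then show ?thesis
  proof cases
    case 1
    have "d w (x a) = t" using g(3)[of t 0] t g(1,4) by simp
    then show ?thesis using 1 ends D0 s0 by (intro exI[of _ a]) linarith
  next
    case 2
    have "d w (x b) = L - t" using g(3)[of t L] t g(1,5) by simp
    then show ?thesis using 2 ends D0 s0 by (intro exI[of _ b]) linarith
  next
    case 3
    have "\<exists>i. a \<le> i \<and> i < b \<and> \<tau> i \<le> t \<and> t < \<tau> (i + 1)"
    proof (rule ccontr)
      assume n: "\<nexists>i. a \<le> i \<and> i < b \<and> \<tau> i \<le> t \<and> t < \<tau> (i + 1)"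
      have "j \<le> b \<longrightarrow> \<tau> j \<le> t" if "a \<le> j" for j
        using that
      proof (induction j rule: int_ge_induct)
        case (step i)
        then show ?case using n by force
      qed (use 3 in simp)
      then show False using 3 ab by fastforce
    qed
    then obtain i where i: "a \<le> i" "i < b" "\<tau> i \<le> t" "t < \<tau> (i + 1)" by blast
    have m: "i \<in> {a..b}" "i + 1 \<in> {a..b}" using i by auto
    have pM: "\<pi> (x i) \<in> M" "\<pi> (x (i + 1)) \<in> M" using \<tau> m g(2) by (auto simp: image_subset_iff)
    have "\<tau> (i + 1) - \<tau> i \<le> d (\<pi> (x i)) (\<pi> (x (i + 1)))" using g(3)[OF \<tau>(1)[OF m(1)] \<tau>(1)[OF m(2)]] \<tau>(2) m by simp
    also have "\<dots> \<le> d (x i) (\<pi> (x i)) + d (x i) (x (i + 1)) + d (x (i + 1)) (\<pi> (x (i + 1)))"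
      using triangle[OF pM(1) x[of i] pM(2)] triangle[OF x[of i] x[of "i + 1"] pM(2)] commute[of "\<pi> (x i)" "x i"] by linarith
    also have "\<dots> \<le> 2 * D + s" using near[of i] near[of "i + 1"] step[of i] m by simp
    finally have "t - \<tau> i \<le> 2 * D + s" using i by linarith
    then have "d w (\<pi> (x i)) \<le> 2 * D + s" using g(3)[OF t(1) \<tau>(1)[OF m(1)]] \<tau>(2)[OF m(1)] t i by simp
    moreover have "w \<in> M" using w geodesic_segmentD(1)[OF P] by blast
    ultimately have "d w (x i) \<le> 3 * D + s"
      using triangle[OF _ pM(1) x[of i], of w] commute[of "\<pi> (x i)" "x i"] near[of i] m by simp
    then show ?thesis by blast
  qed
qed

section \<open>Orbits of an action\<close>

lemma orbit_length_group:
  assumes act: "isometric_action G X d \<phi>" and proper: "proper_metric_space X d"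
    and disc: "properly_discontinuous G X d \<phi>" and base: "bp \<in> X"
  shows "length_group G (\<lambda>g. d bp (\<phi> g bp))"
    and "\<And>g. g \<in> carrier G \<Longrightarrow> \<phi> g bp \<in> X"
    and "\<And>x y. \<lbrakk>x \<in> carrier G; y \<in> carrier G\<rbrakk> \<Longrightarrow> d bp (\<phi> (inv\<^bsub>G\<^esub> x \<otimes>\<^bsub>G\<^esub> y) bp) = d (\<phi> x bp) (\<phi> y bp)"
    and "\<phi> \<one>\<^bsub>G\<^esub> bp = bp"
proof -
  interpret act: group_action G X \<phi> using act by (simp add: isometric_action_def)
  interpret G: group G using act.group_hom by (simp add: group_hom_def)
  interpret M: Metric_space X d using proper by (simp add: proper_metric_space_def)
  have iso: "d (\<phi> g x) (\<phi> g y) = d x y" if "g \<in> carrier G" "x \<in> X" "y \<in> X" for g x y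
    using act that by (simp add: isometric_action_def)
  show X: "\<phi> g bp \<in> X" if "g \<in> carrier G" for g using act.element_image[OF that base] by blast
  have "\<phi> \<one>\<^bsub>G\<^esub> bp = (\<lambda>x\<in>X. x) bp" by (simp only: act.id_eq_one)
  then show one: "\<phi> \<one>\<^bsub>G\<^esub> bp = bp" using base by simp
  show rho: "d bp (\<phi> (inv\<^bsub>G\<^esub> x \<otimes>\<^bsub>G\<^esub> y) bp) = d (\<phi> x bp) (\<phi> y bp)" if "x \<in> carrier G" "y \<in> carrier G" for x y
  proof -
    have "\<phi> x (\<phi> (inv\<^bsub>G\<^esub> x \<otimes>\<^bsub>G\<^esub> y) bp) = \<phi> (x \<otimes>\<^bsub>G\<^esub> (inv\<^bsub>G\<^esub> x \<otimes>\<^bsub>G\<^esub> y)) bp"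
      using act.composition_rule[OF base that(1)] that by simp
    also have "\<dots> = \<phi> y bp" using that by (simp add: G.m_assoc[symmetric])
    finally show ?thesis using iso[OF that(1) base X[of "inv\<^bsub>G\<^esub> x \<otimes>\<^bsub>G\<^esub> y"]] that by simp
  qed
  show "length_group G (\<lambda>g. d bp (\<phi> g bp))"
  proof
    show "d bp (\<phi> \<one>\<^bsub>G\<^esub> bp) = 0" using one base by simp
    show "d bp (\<phi> (inv\<^bsub>G\<^esub> x) bp) = d bp (\<phi> x bp)" if "x \<in> carrier G" for x
      using rho[OF that G.one_closed] that one M.commute by simp
    show "d bp (\<phi> (x \<otimes>\<^bsub>G\<^esub> y) bp) \<le> d bp (\<phi> x bp) + d bp (\<phi> y bp)" if "x \<in> carrier G" "y \<in> carrier G" for x y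
    proof -
      have "\<phi> (x \<otimes>\<^bsub>G\<^esub> y) bp = \<phi> x (\<phi> y bp)" using act.composition_rule[OF base that] .
      then have "d (\<phi> x bp) (\<phi> (x \<otimes>\<^bsub>G\<^esub> y) bp) = d bp (\<phi> y bp)" using iso[OF that(1) base X[OF that(2)]] by simp
      then show ?thesis using M.triangle[of bp "\<phi> x bp" "\<phi> (x \<otimes>\<^bsub>G\<^esub> y) bp"] base X that by simp
    qed
    show "finite {x \<in> carrier G. d bp (\<phi> x bp) \<le> r}" for r
    proof -
      let ?K = "M.mcball bp r"
      have "finite {g \<in> carrier G. \<phi> g ` ?K \<inter> ?K \<noteq> {}}"
        using proper disc base unfolding proper_metric_space_def properly_discontinuous_def by blast
      moreover have "{x \<in> carrier G. d bp (\<phi> x bp) \<le> r} \<subseteq> {g \<in> carrier G. \<phi> g ` ?K \<inter> ?K \<noteq> {}}"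
      proof
        fix x assume x: "x \<in> {x \<in> carrier G. d bp (\<phi> x bp) \<le> r}"
        then have "0 \<le> r" using M.nonneg[of bp "\<phi> x bp"] by (simp del: M.nonneg)
        then have "bp \<in> ?K" "\<phi> x bp \<in> ?K" using x base X by auto
        then show "x \<in> {g \<in> carrier G. \<phi> g ` ?K \<inter> ?K \<noteq> {}}" using x by blast
      qed
      ultimately show ?thesis using finite_subset by blast
    qed
  qed
qed

text \<open>By cocompactness every point of the space is within a fixed distance of the orbit;
  points on a geodesic are replaced by orbit points.\<close>

lemma orbit_coarsely_geodesic:
  assumes act: "isometric_action G X d \<phi>" and proper: "proper_metric_space X d"
    and geo: "geodesic_metric_space X d" and disc: "properly_discontinuous G X d \<phi>"
    and coc: "cocompact G X d \<phi>" and base: "bp \<in> X"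
  shows "\<exists>D. length_group.coarsely_geodesic G (\<lambda>g. d bp (\<phi> g bp)) D"
proof -
  note orb = orbit_length_group[OF act proper disc base]
  interpret L: length_group G "\<lambda>g. d bp (\<phi> g bp)" by (rule orb(1))
  interpret M: Metric_space X d using proper by (simp add: proper_metric_space_def)
  obtain K where K: "compactin M.mtopology K" "(\<Union>g\<in>carrier G. \<phi> g ` K) = X"
    using coc unfolding cocompact_def by blast
  have KX: "K \<subseteq> X" using K(1) compactin_subset_topspace by fastforce
  obtain R where R: "\<And>k. k \<in> K \<Longrightarrow> d bp k \<le> R"
  proof -
    have "M.mbounded (insert bp K)" using M.compactin_imp_mbounded[OF K(1)] base by (simp add: M.mbounded_insert)
    then obtain B where "\<And>x y. \<lbrakk>x \<in> insert bp K; y \<in> insert bp K\<rbrakk> \<Longrightarrow> d x y \<le> B"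
      unfolding M.mbounded_alt by blast
    then show ?thesis using that[of B] by blast
  qed
  have near: "\<exists>g\<in>carrier G. d x (\<phi> g bp) \<le> max 0 R" if "x \<in> X" for x
  proof -
    have "x \<in> (\<Union>g\<in>carrier G. \<phi> g ` K)" using that by (simp add: K(2))
    then obtain g k where g: "g \<in> carrier G" "k \<in> K" "x = \<phi> g k" by blast
    have "k \<in> X" using g(2) KX by blast
    then have "d (\<phi> g k) (\<phi> g bp) = d k bp" using act g(1) base by (simp add: isometric_action_def)
    then have "d x (\<phi> g bp) \<le> max 0 R" using g(3) R[OF g(2)] M.commute[of k bp] by simp
    then show ?thesis using g(1) by blast
  qed
  have "L.coarsely_geodesic (max 0 R)"
    unfolding L.coarsely_geodesic_def
  proof (intro conjI ballI allI impI)
    fix g r assume g: "g \<in> carrier G" and r: "0 \<le> r \<and> r \<le> d bp (\<phi> g bp)"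
    obtain P where "geodesic_segment X d bp (\<phi> g bp) P"
      using geo base orb(2)[OF g] unfolding geodesic_metric_space_def by blast
    then obtain \<gamma> l where \<gamma>: "0 \<le> l" "\<gamma> ` {0..l} \<subseteq> X" "\<And>s t. \<lbrakk>s \<in> {0..l}; t \<in> {0..l}\<rbrakk> \<Longrightarrow> d (\<gamma> s) (\<gamma> t) = \<bar>s - t\<bar>"
      "\<gamma> 0 = bp" "\<gamma> l = \<phi> g bp"
      unfolding geodesic_segment_def by blast
    have l: "d bp (\<phi> g bp) = l" using \<gamma>(3)[of 0 l] \<gamma>(1,4,5) by simp
    then have rl: "r \<in> {0..l}" using r by simp
    then have "\<gamma> r \<in> X" using \<gamma>(2) by blast
    then obtain g1 where g1: "g1 \<in> carrier G" "d (\<gamma> r) (\<phi> g1 bp) \<le> max 0 R" using near by blast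
    have "d bp (\<gamma> r) = r" "d (\<gamma> r) (\<phi> g bp) = l - r"
      using \<gamma>(3)[of 0 r] \<gamma>(3)[of r l] \<gamma>(1,4,5) rl by auto
    then have "d bp (\<phi> g1 bp) \<le> r + max 0 R" "d (\<phi> g1 bp) (\<phi> g bp) \<le> l - r + max 0 R"
      using M.triangle[OF base \<open>\<gamma> r \<in> X\<close> orb(2)[OF g1(1)]] M.triangle[OF orb(2)[OF g1(1)] \<open>\<gamma> r \<in> X\<close> orb(2)[OF g]]
        M.commute[of "\<phi> g1 bp" "\<gamma> r"] g1(2) by linarith+
    then show "\<exists>g1\<in>carrier G. d bp (\<phi> g1 bp) \<le> r + max 0 R \<and> L.rho g1 g \<le> d bp (\<phi> g bp) - r + max 0 R"
      using g1(1) g l unfolding L.rho_def by (intro bexI[of _ g1]) (simp_all add: orb(3))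
  qed simp
  then show ?thesis by blast
qed

text \<open>The hypothesis supplies projections to geodesic segments, not to the orbit of the cyclic
  group. The segment from \<open>x (- int n)\<close> to \<open>x (int n)\<close> and this stretch of
  the orbit stay close uniformly in \<open>n\<close>, so moving the projections to the orbit costs a
  constant; \<open>n\<close> is adapted to the points in question.\<close>

lemma strongly_contracting_imp_contracting:
  assumes act: "isometric_action G X d \<phi>" and proper: "proper_metric_space X d"
    and geo: "geodesic_metric_space X d" and disc: "properly_discontinuous G X d \<phi>"
    and base: "bp \<in> X" and sc: "strongly_contracting G X d \<phi> bp h"
  shows "h \<in> carrier G" "inj (\<lambda>i::int. h [^]\<^bsub>G\<^esub> i)"
    "\<exists>C\<ge>0. length_group.contracting G (\<lambda>g. d bp (\<phi> g bp)) C (length_group.cyc G h)"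
proof -
  note orb = orbit_length_group[OF act proper disc base]
  interpret L: length_group G "\<lambda>g. d bp (\<phi> g bp)" by (rule orb(1))
  interpret M: Metric_space X d using proper by (simp add: proper_metric_space_def)
  obtain C where C: "0 < C" and CC: "C_strongly_contracting G X d \<phi> bp C h"
    using sc unfolding strongly_contracting_def by blast
  show h: "h \<in> carrier G" using CC by (simp add: C_strongly_contracting_def)
  define x where "x = (\<lambda>i::int. \<phi> (h [^]\<^bsub>G\<^esub> i) bp)"
  have xX: "x i \<in> X" for i using orb(2) h by (simp add: x_def)
  have rho: "L.rho a b = d (\<phi> a bp) (\<phi> b bp)" if "a \<in> carrier G" "b \<in> carrier G" for a b
    using orb(3)[OF that] by (simp add: L.rho_def)
  obtain Q A where Q: "1 \<le> Q" "0 \<le> A" "\<And>i j. \<bar>real_of_int (i - j)\<bar> / Q - A \<le> d (x i) (x j)"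
    using CC unfolding C_strongly_contracting_def quasi_geodesic_def x_def by blast
  show "inj (\<lambda>i::int. h [^]\<^bsub>G\<^esub> i)"
  proof (rule injI, rule ccontr)
    \<comment> \<open>A coincidence of powers makes the orbit periodic; points with arbitrarily
      distant indices then agree, against the lower quasi-geodesic bound.\<close>
    fix i j :: int assume e: "h [^]\<^bsub>G\<^esub> i = h [^]\<^bsub>G\<^esub> j" and ne: "i \<noteq> j"
    define k where "k = i - j"
    have k: "h [^]\<^bsub>G\<^esub> k = \<one>\<^bsub>G\<^esub>" using e h by (simp add: k_def L.int_pow_diff)
    obtain n :: nat where n: "Q * A < real n" using reals_Archimedean2 by blast
    have "h [^]\<^bsub>G\<^esub> (k * int n) = \<one>\<^bsub>G\<^esub>" using L.int_pow_pow[OF h, of k "int n"] k by simp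
    then have "x (k * int n) = x 0" by (simp add: x_def)
    then have "real_of_int \<bar>k * int n\<bar> / Q - A \<le> 0" using Q(3)[of "k * int n" 0] xX by simp
    then have "real_of_int \<bar>k * int n\<bar> \<le> Q * A" using Q(1) by (simp add: field_simps)
    moreover have "1 \<le> \<bar>k\<bar>" using ne by (simp add: k_def)
    then have "int n \<le> \<bar>k * int n\<bar>" by (simp add: abs_mult mult_le_cancel_right1)
    ultimately show False using n by linarith
  qed
  define s where "s = d bp (\<phi> h bp)"
  have step: "d (x i) (x (i + 1)) \<le> s" for i
    using L.rho_pow[OF h, of i "i + 1"] h by (simp add: rho x_def s_def)
  have s0: "0 \<le> s" by (simp add: s_def)
  define K where "K = 4 * C + 4"
  have K: "0 < K" "C \<le> K" using C by (simp_all add: K_def)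
  obtain D where D: "\<forall>\<pi> a b i. \<pi> ` X \<subseteq> X \<and>
     (\<forall>u\<in>X. \<forall>v\<in>X. K < d (\<pi> u) (\<pi> v) \<longrightarrow> d u (\<pi> u) + d (\<pi> u) (\<pi> v) + d (\<pi> v) v - K \<le> d u v) \<and>
     d (x a) (\<pi> (x a)) \<le> K \<and> d (x b) (\<pi> (x b)) \<le> K \<and> a \<le> i \<and> i \<le> b \<longrightarrow> d (x i) (\<pi> (x i)) \<le> D"
    using M.quasi_geodesic_near[OF xX step s0 Q(3) Q(1,2) K(1)] ..
  define E where "E = 3 * \<bar>D\<bar> + s"
  \<comment> \<open>\<open>E\<close> bounds the distance from the segment to the orbit. Moving both
    projections to orbit points changes the contraction inequality by at most 4 E, and points of the
    axis are displaced by at most \<open>\<bar>D\<bar> + E\<close>.\<close>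
  define K' where "K' = K + 4 * E + \<bar>D\<bar>"
  have E0: "0 \<le> E" using s0 by (simp add: E_def)
  have coarse: "\<exists>\<psi>. (\<forall>g\<in>carrier G. \<psi> g \<in> L.cyc h) \<and> (\<forall>i. - int n \<le> i \<and> i \<le> int n \<longrightarrow> L.rho (h [^]\<^bsub>G\<^esub> i) (\<psi> (h [^]\<^bsub>G\<^esub> i)) \<le> K') \<and>
      (\<forall>u\<in>carrier G. \<forall>w\<in>carrier G. K' < L.rho (\<psi> u) (\<psi> w) \<longrightarrow>
          L.rho u (\<psi> u) + L.rho (\<psi> u) (\<psi> w) + L.rho (\<psi> w) w - K' \<le> L.rho u w)" for n :: nat
  proof -
    let ?a = "- int n" and ?b = "int n"
    obtain P where P: "geodesic_segment X d (x ?a) (x ?b) P"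
      using geo xX unfolding geodesic_metric_space_def by blast
    have "x ?a \<in> (\<lambda>g. \<phi> g bp) ` generate G {h}" "x ?b \<in> (\<lambda>g. \<phi> g bp) ` generate G {h}"
      by (auto simp: x_def L.generate_cyc[OF h])
    then obtain \<pi> where \<pi>: "strongly_contracting_projection X d C P \<pi>"
      using CC P unfolding C_strongly_contracting_def by blast
    have PX: "P \<subseteq> X" using geodesic_segmentD(1)[OF P] .
    have \<pi>P: "\<pi> u \<in> P" if "u \<in> X" for u using \<pi> that unfolding strongly_contracting_projection_def by blast
    have \<pi>X: "\<pi> u \<in> X" if "u \<in> X" for u using \<pi>P PX that by blast
    have con: "d u (\<pi> u) + d (\<pi> u) (\<pi> v) + d (\<pi> v) v - K \<le> d u v" if "u \<in> X" "v \<in> X" "K < d (\<pi> u) (\<pi> v)" for u v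
      using M.strongly_contracting_ineq[OF geo \<pi> PX C that(1,2)] that(3) by (simp add: K_def)
    have "x ?a \<in> P" "x ?b \<in> P" using geodesic_segment_ends[OF P] by auto
    then have "d (x ?a) (\<pi> (x ?a)) \<le> C" "d (x ?b) (\<pi> (x ?b)) \<le> C"
      using \<pi> unfolding strongly_contracting_projection_def by blast+
    then have ends: "d (x ?a) (\<pi> (x ?a)) \<le> K" "d (x ?b) (\<pi> (x ?b)) \<le> K" using K(2) by linarith+
    have nearx: "d (x i) (\<pi> (x i)) \<le> \<bar>D\<bar>" if "?a \<le> i" "i \<le> ?b" for i
    proof -
      have "d (x i) (\<pi> (x i)) \<le> D"
        by (rule D[rule_format, of \<pi> ?a ?b i], intro conjI ballI impI) (use \<pi>X con ends that in auto)
      then show ?thesis by linarith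
    qed
    have "\<exists>i. d (\<pi> (\<phi> g bp)) (x i) \<le> E" if "g \<in> carrier G" for g
      unfolding E_def
      by (rule M.geodesic_near_sequence[OF xX step _ P, of \<pi>]) (use \<pi>P xX nearx orb(2) that in auto)
    then obtain k where k: "\<And>g. g \<in> carrier G \<Longrightarrow> d (\<pi> (\<phi> g bp)) (x (k g)) \<le> E" by metis
    let ?\<psi> = "\<lambda>g. h [^]\<^bsub>G\<^esub> (k g)"
    have "L.rho (h [^]\<^bsub>G\<^esub> i) (?\<psi> (h [^]\<^bsub>G\<^esub> i)) \<le> K'" if "?a \<le> i" "i \<le> ?b" for i
    proof -
      let ?j = "k (h [^]\<^bsub>G\<^esub> i)"
      have "d (x i) (x ?j) \<le> \<bar>D\<bar> + E"
        using M.triangle[OF xX[of i] \<pi>X[OF xX[of i]] xX[of ?j]] nearx[OF that] k[of "h [^]\<^bsub>G\<^esub> i"] h by (simp add: x_def)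
      then show ?thesis using rho h E0 K(1) by (simp add: x_def K'_def)
    qed
    moreover have "L.rho u (?\<psi> u) + L.rho (?\<psi> u) (?\<psi> w) + L.rho (?\<psi> w) w - K' \<le> L.rho u w"
      if uw: "u \<in> carrier G" "w \<in> carrier G" and far: "K' < L.rho (?\<psi> u) (?\<psi> w)" for u w
    proof -
      let ?u = "\<phi> u bp" and ?w = "\<phi> w bp"
      have X: "?u \<in> X" "?w \<in> X" "\<pi> ?u \<in> X" "\<pi> ?w \<in> X" using orb(2) \<pi>X uw by auto
      have r: "L.rho u (?\<psi> u) = d ?u (x (k u))" "L.rho (?\<psi> u) (?\<psi> w) = d (x (k u)) (x (k w))"
        "L.rho (?\<psi> w) w = d (x (k w)) ?w" "L.rho u w = d ?u ?w" using rho uw h by (simp_all add: x_def)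
      have t: "d ?u (x (k u)) \<le> d ?u (\<pi> ?u) + E" "d (x (k w)) ?w \<le> E + d (\<pi> ?w) ?w"
        "d (x (k u)) (x (k w)) \<le> E + d (\<pi> ?u) (\<pi> ?w) + E"
        using M.triangle[OF X(1,3) xX[of "k u"]] M.triangle[OF xX[of "k w"] X(4,2)]
          M.triangle[OF xX[of "k u"] X(3) xX[of "k w"]] M.triangle[OF X(3,4) xX[of "k w"]]
          k[OF uw(1)] k[OF uw(2)] M.commute[of "x (k w)" "\<pi> ?w"] M.commute[of "x (k u)" "\<pi> ?u"] by linarith+
      then have "K < d (\<pi> ?u) (\<pi> ?w)" using far E0 unfolding r K'_def by linarith
      then show ?thesis using con[OF X(1,2)] t unfolding r K'_def by linarith
    qed
    ultimately show ?thesis by (intro exI[of _ ?\<psi>]) simp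
  qed
  have "L.contracting (9 * K') (L.cyc h)"
  proof (rule L.contractingI)
    show "L.cyc h \<subseteq> carrier G" using h by simp
    show "0 \<le> K'" using K E0 by (simp add: K'_def)
    fix u v p q assume uv: "u \<in> carrier G" "v \<in> carrier G" and pq: "p \<in> L.cyc h" "q \<in> L.cyc h"
    obtain i j :: int where ij: "p = h [^]\<^bsub>G\<^esub> i" "q = h [^]\<^bsub>G\<^esub> j" using pq by (meson L.cycE)
    define n where "n = nat (max \<bar>i\<bar> \<bar>j\<bar>)"
    obtain \<psi> where \<psi>: "\<And>g. g \<in> carrier G \<Longrightarrow> \<psi> g \<in> L.cyc h"
      "\<And>i. \<lbrakk>- int n \<le> i; i \<le> int n\<rbrakk> \<Longrightarrow> L.rho (h [^]\<^bsub>G\<^esub> i) (\<psi> (h [^]\<^bsub>G\<^esub> i)) \<le> K'"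
      "\<And>u w. \<lbrakk>u \<in> carrier G; w \<in> carrier G; K' < L.rho (\<psi> u) (\<psi> w)\<rbrakk> \<Longrightarrow>
          L.rho u (\<psi> u) + L.rho (\<psi> u) (\<psi> w) + L.rho (\<psi> w) w - K' \<le> L.rho u w"
      using coarse[of n] by blast
    have "- int n \<le> i" "i \<le> int n" "- int n \<le> j" "j \<le> int n" unfolding n_def by linarith+
    then have pq': "L.rho p (\<psi> p) \<le> K'" "L.rho q (\<psi> q) \<le> K'" using \<psi>(2) ij by auto
    have c: "{u, v, p, q} \<subseteq> carrier G" using uv ij h by auto
    show "\<exists>\<pi>. \<pi> ` {u, v, p, q} \<subseteq> L.cyc h \<and> L.rho p (\<pi> p) \<le> K' \<and> L.rho q (\<pi> q) \<le> K' \<and>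
        (\<forall>a\<in>{u, v, p, q}. \<forall>b\<in>{u, v, p, q}. K' < L.rho (\<pi> a) (\<pi> b) \<longrightarrow>
          L.rho a (\<pi> a) + L.rho (\<pi> a) (\<pi> b) + L.rho (\<pi> b) b - K' \<le> L.rho a b)"
    proof (intro exI[of _ \<psi>] conjI ballI impI pq')
      show "\<psi> ` {u, v, p, q} \<subseteq> L.cyc h" using \<psi>(1) c by blast
      fix a b assume "a \<in> {u, v, p, q}" "b \<in> {u, v, p, q}" "K' < L.rho (\<psi> a) (\<psi> b)"
      then show "L.rho a (\<psi> a) + L.rho (\<psi> a) (\<psi> b) + L.rho (\<psi> b) b - K' \<le> L.rho a b" using \<psi>(3) c by blast
    qed
  qed
  moreover have "0 \<le> 9 * K'" using K E0 by (simp add: K'_def)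
  ultimately show "\<exists>C\<ge>0. L.contracting C (L.cyc h)" by blast
qed

section \<open>Growth exponents\<close>

lemma growth_exponent_le:
  assumes s: "exp_summable T l \<alpha>" "0 \<le> \<alpha>" and fin: "\<And>r. finite {t \<in> T. l t \<le> r}"
    and l: "\<And>t. t \<in> T \<Longrightarrow> d a0 t = l t"
  shows "growth_exponent T d a0 \<le> ereal \<alpha>"
proof -
  obtain K where K: "1 \<le> K" "\<And>r. real (card {t \<in> T. l t \<le> r}) \<le> K * exp (\<alpha> * r)"
    using exp_summable_card[OF s fin] by blast
  have eq: "{a \<in> T. d a0 a \<le> r} = {t \<in> T. l t \<le> r}" for r using l by auto
  have "Limsup at_top (\<lambda>r. ereal (1 / r) * log_card {a \<in> T. d a0 a \<le> r}) \<le> Limsup at_top (\<lambda>r. ereal (ln K / r + \<alpha>))"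
  proof (rule Limsup_mono, rule eventually_mono[OF eventually_gt_at_top[of 0]])
    fix r :: real assume r: "0 < r"
    have "ln (real (card {t \<in> T. l t \<le> r})) \<le> ln K + \<alpha> * r"
    proof (cases "card {t \<in> T. l t \<le> r} = 0")
      \<comment> \<open>Here \<open>ln 0 = 0\<close>, so the claim rests on \<open>ln K\<close>
        being nonnegative.\<close>
      case True
      then show ?thesis using K(1) s(2) r by simp
    next
      case False
      then have "ln (real (card {t \<in> T. l t \<le> r})) \<le> ln (K * exp (\<alpha> * r))"
        using K(1) K(2)[of r] by simp
      also have "\<dots> = ln K + \<alpha> * r" using K(1) by (simp add: ln_mult)
      finally show ?thesis .
    qed
    then have "1 / r * ln (real (card {t \<in> T. l t \<le> r})) \<le> 1 / r * (ln K + \<alpha> * r)"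
      using r by (intro mult_left_mono) auto
    also have "\<dots> = ln K / r + \<alpha>" using r by (simp add: field_simps)
    finally show "ereal (1 / r) * log_card {a \<in> T. d a0 a \<le> r} \<le> ereal (ln K / r + \<alpha>)"
      using fin by (simp add: eq log_card_def)
  qed
  also have "\<dots> = ereal \<alpha>"
  proof (rule lim_imp_Limsup)
    have "((\<lambda>r. ln K / r + \<alpha>) \<longlongrightarrow> 0 + \<alpha>) at_top"
      by (intro tendsto_add tendsto_const tendsto_divide_0[OF tendsto_const] filterlim_at_top_imp_at_infinity filterlim_ident)
    then show "((\<lambda>r. ereal (ln K / r + \<alpha>)) \<longlongrightarrow> ereal \<alpha>) at_top" by simp
  qed simp
  finally show ?thesis by (simp add: growth_exponent_def)
qed

lemma growth_exponent_ge:
  assumes s: "exp_lower T l \<sigma>" and fin: "\<And>r. finite {t \<in> T. l t \<le> r}"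
    and l: "\<And>t. t \<in> T \<Longrightarrow> d a0 t = l t"
  shows "ereal \<sigma> \<le> growth_exponent T d a0"
proof -
  obtain \<kappa> where k: "0 < \<kappa>" "\<And>r. 0 \<le> r \<Longrightarrow> \<kappa> * exp (\<sigma> * r) \<le> real (card {t \<in> T. l t \<le> r})"
    using s unfolding exp_lower_def by blast
  have eq: "{a \<in> T. d a0 a \<le> r} = {t \<in> T. l t \<le> r}" for r using l by auto
  have "ereal \<sigma> = Limsup at_top (\<lambda>r. ereal (ln \<kappa> / r + \<sigma>))"
  proof (rule lim_imp_Limsup[symmetric])
    have "((\<lambda>r. ln \<kappa> / r + \<sigma>) \<longlongrightarrow> 0 + \<sigma>) at_top"
      by (intro tendsto_add tendsto_const tendsto_divide_0[OF tendsto_const] filterlim_at_top_imp_at_infinity filterlim_ident)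
    then show "((\<lambda>r. ereal (ln \<kappa> / r + \<sigma>)) \<longlongrightarrow> ereal \<sigma>) at_top" by simp
  qed simp
  also have "\<dots> \<le> Limsup at_top (\<lambda>r. ereal (1 / r) * log_card {a \<in> T. d a0 a \<le> r})"
  proof (rule Limsup_mono, rule eventually_mono[OF eventually_gt_at_top[of 0]])
    fix r :: real assume r: "0 < r"
    have "ln \<kappa> + \<sigma> * r = ln (\<kappa> * exp (\<sigma> * r))" using k(1) by (simp add: ln_mult)
    also have "\<dots> \<le> ln (real (card {t \<in> T. l t \<le> r}))"
    proof -
      have "0 < \<kappa> * exp (\<sigma> * r)" using k(1) by simp
      then show ?thesis using k(2)[of r] r by (subst ln_le_cancel_iff) linarith+
    qed
    finally have "1 / r * (ln \<kappa> + \<sigma> * r) \<le> 1 / r * ln (real (card {t \<in> T. l t \<le> r}))"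
      using r by (intro mult_left_mono) auto
    moreover have "1 / r * (ln \<kappa> + \<sigma> * r) = ln \<kappa> / r + \<sigma>" using r by (simp add: field_simps)
    ultimately show "ereal (ln \<kappa> / r + \<sigma>) \<le> ereal (1 / r) * log_card {a \<in> T. d a0 a \<le> r}"
      using fin by (simp add: eq log_card_def)
  qed
  finally show ?thesis by (simp add: growth_exponent_def)
qed

lemma exp_lower_inj:
  assumes s: "exp_lower T l \<sigma>" and f: "inj_on f T" "f ` T \<subseteq> S" "\<And>t. t \<in> T \<Longrightarrow> l' (f t) \<le> l t"
    and fin: "\<And>r. finite {t \<in> S. l' t \<le> r}"
  shows "exp_lower S l' \<sigma>"
proof -
  obtain \<kappa> where k: "0 < \<kappa>" "\<And>r. 0 \<le> r \<Longrightarrow> \<kappa> * exp (\<sigma> * r) \<le> real (card {t \<in> T. l t \<le> r})"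
    using s unfolding exp_lower_def by blast
  have "card {t \<in> T. l t \<le> r} \<le> card {t \<in> S. l' t \<le> r}" for r
  proof (rule card_inj_on_le[OF _ _ fin])
    show "inj_on f {t \<in> T. l t \<le> r}" using f(1) by (rule inj_on_subset) auto
    show "f ` {t \<in> T. l t \<le> r} \<subseteq> {t \<in> S. l' t \<le> r}" using f by fastforce
  qed
  then have "\<kappa> * exp (\<sigma> * r) \<le> real (card {t \<in> S. l' t \<le> r})" if "0 \<le> r" for r
    using k(2)[OF that] by (meson of_nat_mono order_trans)
  then show ?thesis using k(1) unfolding exp_lower_def by blast
qed

lemma exp_summable_inj:
  assumes T: "exp_summable T l \<alpha>" and f: "f ` S \<subseteq> T" "inj_on f S" and eq: "\<And>s. s \<in> S \<Longrightarrow> l' s = l (f s)"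
  shows "exp_summable S l' \<alpha>"
proof -
  obtain K where K: "\<And>F. \<lbrakk>finite F; F \<subseteq> T\<rbrakk> \<Longrightarrow> (\<Sum>t\<in>F. exp (- \<alpha> * l t)) \<le> K"
    using T unfolding exp_summable_def by blast
  have "(\<Sum>s\<in>F. exp (- \<alpha> * l' s)) \<le> K" if F: "finite F" "F \<subseteq> S" for F
  proof -
    have "(\<Sum>s\<in>F. exp (- \<alpha> * l' s)) = (\<Sum>t\<in>f ` F. exp (- \<alpha> * l t))"
      unfolding sum.reindex[OF inj_on_subset[OF f(2) F(2)]] using eq F(2) by (intro sum.cong) auto
    also have "\<dots> \<le> K" using F f(1) by (intro K) auto
    finally show ?thesis .
  qed
  then show ?thesis unfolding exp_summable_def by blast
qed

text \<open>Over a box the sum of a product of exponentials is the product of the sums. The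
  injection \<Psi> makes this available for sets such as quotients, which are not products
  themselves.\<close>

lemma exp_summable_prod:
  assumes I: "finite I" and s: "\<And>i. i \<in> I \<Longrightarrow> exp_summable (T i) (l i) (\<beta> i)"
    and \<Psi>: "\<Psi> ` S \<subseteq> Pi\<^sub>E I T" "inj_on \<Psi> S" and le: "\<And>s. s \<in> S \<Longrightarrow> (\<Sum>i\<in>I. \<beta> i * l i (\<Psi> s i)) \<le> \<tau> * L s"
  shows "exp_summable S L \<tau>"
proof -
  have "\<forall>i\<in>I. \<exists>K. \<forall>F. finite F \<and> F \<subseteq> T i \<longrightarrow> (\<Sum>t\<in>F. exp (- \<beta> i * l i t)) \<le> K"
    using s unfolding exp_summable_def by blast
  then obtain K where K: "\<And>i F. \<lbrakk>i \<in> I; finite F; F \<subseteq> T i\<rbrakk> \<Longrightarrow> (\<Sum>t\<in>F. exp (- \<beta> i * l i t)) \<le> K i" by metis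
  have "(\<Sum>s\<in>F. exp (- \<tau> * L s)) \<le> (\<Prod>i\<in>I. K i)" if F: "finite F" "F \<subseteq> S" for F
  proof -
    define R where "R = (\<lambda>i. (\<lambda>s. \<Psi> s i) ` F)"
    have R: "finite (R i)" for i using F by (simp add: R_def)
    have \<Psi>F: "\<Psi> s \<in> Pi\<^sub>E I T" if "s \<in> F" for s using that F \<Psi>(1) by blast
    have RT: "R i \<subseteq> T i" if "i \<in> I" for i using PiE_mem[OF \<Psi>F that] by (auto simp: R_def)
    have sub: "\<Psi> ` F \<subseteq> Pi\<^sub>E I R"
    proof (rule image_subsetI)
      fix s assume "s \<in> F"
      then show "\<Psi> s \<in> Pi\<^sub>E I R" using \<Psi>F[of s] by (auto simp: R_def PiE_iff)
    qed
    have "(\<Sum>s\<in>F. exp (- \<tau> * L s)) \<le> (\<Sum>s\<in>F. \<Prod>i\<in>I. exp (- \<beta> i * l i (\<Psi> s i)))"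
    proof (rule sum_mono)
      fix s assume "s \<in> F"
      then have "(\<Sum>i\<in>I. \<beta> i * l i (\<Psi> s i)) \<le> \<tau> * L s" using le F by blast
      then show "exp (- \<tau> * L s) \<le> (\<Prod>i\<in>I. exp (- \<beta> i * l i (\<Psi> s i)))"
        using I by (simp add: sum_negf flip: exp_sum)
    qed
    also have "\<dots> = (\<Sum>g\<in>\<Psi> ` F. \<Prod>i\<in>I. exp (- \<beta> i * l i (g i)))"
      using inj_on_subset[OF \<Psi>(2) F(2)] by (simp add: sum.reindex)
    also have "\<dots> \<le> (\<Sum>g\<in>Pi\<^sub>E I R. \<Prod>i\<in>I. exp (- \<beta> i * l i (g i)))"
      by (intro sum_mono2 finite_PiE I R sub) (auto intro: prod_nonneg)
    also have "\<dots> = (\<Prod>i\<in>I. \<Sum>t\<in>R i. exp (- \<beta> i * l i t))"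
      using prod_sum_PiE[OF I, of R "\<lambda>i t. exp (- \<beta> i * l i t)"] R by simp
    also have "\<dots> \<le> (\<Prod>i\<in>I. K i)" using K R RT by (intro prod_mono) (auto intro: sum_nonneg)
    finally show ?thesis .
  qed
  then show ?thesis unfolding exp_summable_def by blast
qed

text \<open>The box with sides \<xi> i r is contained in the ball of radius \<open>r\<close>, and
  its cardinality is the product of those of the balls in the factors. The vector \<xi> is the
  direction in which the count is to be maximised.\<close>

lemma exp_lower_prod:
  assumes I: "finite I" and s: "\<And>i. i \<in> I \<Longrightarrow> exp_lower (T i) (l i) (\<delta> i)"
    and fin: "\<And>r. finite {t \<in> Pi\<^sub>E I T. L t \<le> r}" and \<xi>: "\<And>i. i \<in> I \<Longrightarrow> 0 \<le> \<xi> i"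
    and le: "\<And>t r. \<lbrakk>t \<in> Pi\<^sub>E I T; 0 \<le> r; \<And>i. i \<in> I \<Longrightarrow> l i (t i) \<le> \<xi> i * r\<rbrakk> \<Longrightarrow> L t \<le> r"
  shows "exp_lower (Pi\<^sub>E I T) L (\<Sum>i\<in>I. \<delta> i * \<xi> i)"
proof -
  have "\<forall>i\<in>I. \<exists>\<kappa>>0. \<forall>r\<ge>0. \<kappa> * exp (\<delta> i * r) \<le> real (card {t \<in> T i. l i t \<le> r})"
    using s unfolding exp_lower_def by blast
  then obtain \<kappa> where k: "\<And>i. i \<in> I \<Longrightarrow> 0 < \<kappa> i"
    "\<And>i r. \<lbrakk>i \<in> I; 0 \<le> r\<rbrakk> \<Longrightarrow> \<kappa> i * exp (\<delta> i * r) \<le> real (card {t \<in> T i. l i t \<le> r})" by metis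
  have "(\<Prod>i\<in>I. \<kappa> i) * exp ((\<Sum>i\<in>I. \<delta> i * \<xi> i) * r) \<le> real (card {t \<in> Pi\<^sub>E I T. L t \<le> r})" if r: "0 \<le> r" for r
  proof -
    have "(\<Prod>i\<in>I. \<kappa> i) * exp ((\<Sum>i\<in>I. \<delta> i * \<xi> i) * r) = (\<Prod>i\<in>I. \<kappa> i * exp (\<delta> i * (\<xi> i * r)))"
      using I by (simp add: prod.distrib sum_distrib_right exp_sum mult.assoc)
    also have "\<dots> \<le> (\<Prod>i\<in>I. real (card {t \<in> T i. l i t \<le> \<xi> i * r}))"
    proof (rule prod_mono)
      fix i assume i: "i \<in> I"
      have "0 \<le> \<xi> i * r" using \<xi>[OF i] r by simp
      then show "0 \<le> \<kappa> i * exp (\<delta> i * (\<xi> i * r)) \<and> \<kappa> i * exp (\<delta> i * (\<xi> i * r)) \<le> real (card {t \<in> T i. l i t \<le> \<xi> i * r})"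
        using k(1)[OF i] k(2)[OF i] by simp
    qed
    also have "\<dots> = real (card (Pi\<^sub>E I (\<lambda>i. {t \<in> T i. l i t \<le> \<xi> i * r})))" using I by (simp add: card_PiE)
    also have "\<dots> \<le> real (card {t \<in> Pi\<^sub>E I T. L t \<le> r})"
    proof (intro of_nat_mono card_mono fin subsetI)
      fix t assume t: "t \<in> Pi\<^sub>E I (\<lambda>i. {t \<in> T i. l i t \<le> \<xi> i * r})"
      then have "t \<in> Pi\<^sub>E I T" by (auto simp: PiE_iff)
      moreover have "L t \<le> r" by (rule le[OF \<open>t \<in> Pi\<^sub>E I T\<close> r]) (use t in \<open>auto simp: PiE_iff\<close>)
      ultimately show "t \<in> {t \<in> Pi\<^sub>E I T. L t \<le> r}" by simp
    qed
    finally show ?thesis .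
  qed
  moreover have "0 < (\<Prod>i\<in>I. \<kappa> i)" using k(1) by (intro prod_pos) blast
  ultimately show ?thesis unfolding exp_lower_def by blast
qed

section \<open>The \<open>L\<^sup>p\<close> norm\<close>

definition Lp_norm :: "ereal \<Rightarrow> 'i set \<Rightarrow> ('i \<Rightarrow> real) \<Rightarrow> real" where
  "Lp_norm p I v = (if p = \<infinity> then (MAX i\<in>I. v i)
     else (\<Sum>i\<in>I. v i powr real_of_ereal p) powr (1 / real_of_ereal p))"

lemma Lp_metric_eq_norm: "Lp_metric p I d x y = Lp_norm p I (\<lambda>i. d i (x i) (y i))"
  by (simp add: Lp_metric_def Lp_norm_def)

lemma Lp_norm_cong: "(\<And>i. i \<in> I \<Longrightarrow> v i = w i) \<Longrightarrow> Lp_norm p I v = Lp_norm p I w"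
  unfolding Lp_norm_def by (auto intro!: arg_cong[where f = Max] image_cong sum.cong arg_cong[where f = "\<lambda>s. s powr _"])

lemma Lp_norm_coord_le:
  assumes "finite I" "1 \<le> p" "\<And>i. i \<in> I \<Longrightarrow> 0 \<le> v i" "i \<in> I"
  shows "v i \<le> Lp_norm p I v"
proof (cases p)
  case (real r)
  then have r: "1 \<le> r" using assms by simp
  have "v i = (v i powr r) powr (1 / r)" using r assms by (simp add: powr_powr)
  also have "\<dots> \<le> (\<Sum>i\<in>I. v i powr r) powr (1 / r)"
    using r assms by (intro powr_mono2 member_le_sum) auto
  finally show ?thesis using real by (simp add: Lp_norm_def)
qed (use assms in \<open>auto simp: Lp_norm_def\<close>)

lemma Lp_norm_singleton: "\<lbrakk>1 \<le> p; 0 \<le> v i\<rbrakk> \<Longrightarrow> Lp_norm p {i} v = v i"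
  by (cases p) (auto simp: Lp_norm_def powr_powr)

lemma Lp_norm_one: "(\<And>i. i \<in> I \<Longrightarrow> 0 \<le> v i) \<Longrightarrow> Lp_norm 1 I v = (\<Sum>i\<in>I. v i)"
  unfolding Lp_norm_def by (simp add: sum_nonneg)

text \<open>Young's inequality is summed for the two vectors divided by their norms; a vanishing
  norm means a vanishing vector.\<close>

lemma holder:
  fixes p q :: real
  assumes pq: "1 < p" "1 < q" "1 / p + 1 / q = 1" and I: "finite I"
    and b: "\<And>i. i \<in> I \<Longrightarrow> 0 \<le> b i" and v: "\<And>i. i \<in> I \<Longrightarrow> 0 \<le> v i"
  shows "(\<Sum>i\<in>I. b i * v i) \<le> (\<Sum>i\<in>I. b i powr q) powr (1 / q) * (\<Sum>i\<in>I. v i powr p) powr (1 / p)"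
proof -
  let ?B = "\<Sum>i\<in>I. b i powr q" and ?V = "\<Sum>i\<in>I. v i powr p"
  have nn: "0 \<le> ?B" "0 \<le> ?V" by (auto intro: sum_nonneg)
  show ?thesis
  proof (cases "?B = 0 \<or> ?V = 0")
    case True
    then have "(\<forall>i\<in>I. b i = 0) \<or> (\<forall>i\<in>I. v i = 0)"
      using I by (auto simp: sum_nonneg_eq_0_iff)
    then have "(\<Sum>i\<in>I. b i * v i) = 0" by (auto intro: sum.neutral)
    then show ?thesis by simp
  next
    case False
    then have pos: "0 < ?B" "0 < ?V" using nn by linarith+
    define B where "B = ?B powr (1 / q)"
    define V where "V = ?V powr (1 / p)"
    have BV: "0 < B" "0 < V" using False by (simp_all add: B_def V_def)
    have powB: "B powr q = ?B" "V powr p = ?V" using pos pq by (simp_all add: B_def V_def powr_powr)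
    have "(\<Sum>i\<in>I. (v i / V) * (b i / B)) \<le> (\<Sum>i\<in>I. (v i / V) powr p / p + (b i / B) powr q / q)"
      using b v BV pq by (intro sum_mono Youngs_inequality) auto
    also have "\<dots> = (\<Sum>i\<in>I. v i powr p) / V powr p / p + (\<Sum>i\<in>I. b i powr q) / B powr q / q"
      using b v BV by (simp add: sum.distrib powr_divide sum_divide_distrib)
    also have "\<dots> = 1" using powB pos pq by simp
    finally have "(\<Sum>i\<in>I. b i * v i) / (B * V) \<le> 1" by (simp add: sum_divide_distrib mult.commute)
    then show ?thesis using BV by (simp add: B_def V_def)
  qed
qed

text \<open>The growth exponent of the \<open>L\<^sup>p\<close> product is the dual norm of the vector of growth exponents,
  attained in direction \<open>\<xi>\<close>; for \<open>p > 1\<close> it drops when one entry is lowered, and still after a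
  small increase of all entries.\<close>

lemma Lp_gap:
  fixes \<delta> :: "'i \<Rightarrow> real" and p :: ereal
  assumes I: "finite I" "i0 \<in> I" and p: "1 < p \<or> I = {i0} \<and> 1 \<le> p" and \<delta>: "\<And>i. i \<in> I \<Longrightarrow> 0 \<le> \<delta> i" and \<delta>': "0 \<le> \<delta>'" "\<delta>' < \<delta> i0"
  obtains \<xi> \<beta> \<tau> where "\<And>i. i \<in> I \<Longrightarrow> 0 \<le> \<xi> i"
    "\<And>v r. \<lbrakk>0 \<le> r; \<And>i. i \<in> I \<Longrightarrow> 0 \<le> v i; \<And>i. i \<in> I \<Longrightarrow> v i \<le> \<xi> i * r\<rbrakk> \<Longrightarrow> Lp_norm p I v \<le> r"
    "\<And>i. \<lbrakk>i \<in> I; i \<noteq> i0\<rbrakk> \<Longrightarrow> \<delta> i < \<beta> i" "\<delta>' < \<beta> i0" "0 \<le> \<tau>"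
    "\<And>v. (\<And>i. i \<in> I \<Longrightarrow> 0 \<le> v i) \<Longrightarrow> (\<Sum>i\<in>I. \<beta> i * v i) \<le> \<tau> * Lp_norm p I v"
    "\<tau> < (\<Sum>i\<in>I. \<delta> i * \<xi> i)"
proof -
  consider "I = {i0}" "1 \<le> p" | "p = \<infinity>" | r where "p = ereal r" "1 < r"
    using p by (cases p) auto
  then show ?thesis
  proof cases
    case 1
    show ?thesis
      by (rule that[of "\<lambda>_. 1" "\<lambda>_. (\<delta>' + \<delta> i0) / 2" "(\<delta>' + \<delta> i0) / 2"])
        (use 1 \<delta>' in \<open>auto simp: Lp_norm_singleton\<close>)
  next
    case 2
    \<comment> \<open>All entries together rise by less than the gap at \<open>i0\<close>; the
      summand 1 in the denominator keeps this strict.\<close>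
    define \<epsilon> where "\<epsilon> = (\<delta> i0 - \<delta>') / (real (card I) + 1)"
    define \<beta> where "\<beta> = (\<lambda>i. (if i = i0 then \<delta>' else \<delta> i) + \<epsilon>)"
    have e: "0 < \<epsilon>" using \<delta>' by (simp add: \<epsilon>_def)
    have b: "0 \<le> \<beta> i" if "i \<in> I" for i using \<delta>[OF that] \<delta>' e by (simp add: \<beta>_def)
    have "(\<Sum>i\<in>I. \<beta> i) = (\<Sum>i\<in>I. \<delta> i) - (\<delta> i0 - \<delta>') + real (card I) * \<epsilon>"
      using I by (simp add: \<beta>_def sum.distrib sum.remove[of I i0])
    moreover have "real (card I) * \<epsilon> < \<delta> i0 - \<delta>'" using \<delta>' by (simp add: \<epsilon>_def field_simps)
    ultimately have lt: "(\<Sum>i\<in>I. \<beta> i) < (\<Sum>i\<in>I. \<delta> i)" by linarith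
    show ?thesis
    proof (rule that[of "\<lambda>_. 1" \<beta> "\<Sum>i\<in>I. \<beta> i"])
      show "Lp_norm p I v \<le> r" if "\<And>i. i \<in> I \<Longrightarrow> v i \<le> 1 * r" for v r
        using 2 I that by (auto simp: Lp_norm_def intro!: Max.boundedI)
      show "(\<Sum>i\<in>I. \<beta> i * v i) \<le> (\<Sum>i\<in>I. \<beta> i) * Lp_norm p I v" if "\<And>i. i \<in> I \<Longrightarrow> 0 \<le> v i" for v
        unfolding sum_distrib_right using b Lp_norm_coord_le[OF I(1), of p v] that 2 by (intro sum_mono mult_left_mono) auto
    qed (use b lt e \<delta>' in \<open>auto simp: \<beta>_def intro: sum_nonneg\<close>)
  next
    case 3
    define q where "q = r / (r - 1)"
    have q: "1 < q" "1 / r + 1 / q = 1" "(q - 1) * r = q" "1 - 1 / r = 1 / q" using 3 by (auto simp: q_def field_simps)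
    have norm: "Lp_norm p I v = (\<Sum>i\<in>I. v i powr r) powr (1 / r)" for v using 3 by (simp add: Lp_norm_def)
    define S where "S = (\<Sum>i\<in>I. \<delta> i powr q)"
    have "\<delta> i0 powr q \<le> S" unfolding S_def using I by (intro member_le_sum) auto
    moreover have "0 < \<delta> i0 powr q" using \<delta>' by simp
    ultimately have S: "0 < S" by linarith
    define \<eta> where "\<eta> = (\<lambda>i. if i = i0 then \<delta>' else \<delta> i)"
    have \<eta>: "0 \<le> \<eta> i" if "i \<in> I" for i using \<delta>[OF that] \<delta>' by (simp add: \<eta>_def)
    have lt: "(\<Sum>i\<in>I. \<eta> i powr q) < S"
      unfolding S_def
    proof (rule sum_strict_mono_ex1[OF I(1)])
      show "\<forall>i\<in>I. \<eta> i powr q \<le> \<delta> i powr q"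
        using \<delta>' \<eta> q(1) by (auto simp: \<eta>_def intro!: powr_mono2)
      show "\<exists>i\<in>I. \<eta> i powr q < \<delta> i powr q"
        using I(2) \<delta>' q(1) by (intro bexI[of _ i0] powr_less_mono2) (auto simp: \<eta>_def)
    qed
    \<comment> \<open>Entries of \<eta> may be 0, where the limit rule for \<open>powr\<close> asks
      for nonnegative bases; hence the limit from the right.\<close>
    have "((\<lambda>\<epsilon>. \<Sum>i\<in>I. (\<eta> i + \<epsilon>) powr q) \<longlongrightarrow> (\<Sum>i\<in>I. (\<eta> i + 0) powr q)) (at_right 0)"
    proof (intro tendsto_sum tendsto_powr' tendsto_add tendsto_const)
      fix i assume i: "i \<in> I"
      have "\<forall>\<^sub>F \<epsilon> in at_right 0. 0 \<le> \<eta> i + \<epsilon>" using \<eta>[OF i] by (auto simp: eventually_at_right_less intro!: eventually_at_rightI[of 0 1])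
      then show "\<eta> i + 0 \<noteq> 0 \<or> (0 < q \<and> (\<forall>\<^sub>F \<epsilon> in at_right 0. 0 \<le> \<eta> i + \<epsilon>))" using q by auto
    qed (auto intro: tendsto_ident_at)
    then have "\<forall>\<^sub>F \<epsilon> in at_right 0. (\<Sum>i\<in>I. (\<eta> i + \<epsilon>) powr q) < S" using lt by (simp add: order_tendstoD(2))
    then have "\<forall>\<^sub>F \<epsilon> in at_right 0. 0 < \<epsilon> \<and> (\<Sum>i\<in>I. (\<eta> i + \<epsilon>) powr q) < S"
      using eventually_at_right_less[of 0] by (rule eventually_conj[rotated])
    then obtain \<epsilon> where e: "0 < \<epsilon>" "(\<Sum>i\<in>I. (\<eta> i + \<epsilon>) powr q) < S"
      using eventually_happens'[OF trivial_limit_at_right_real] by blast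
    define \<beta> where "\<beta> = (\<lambda>i. \<eta> i + \<epsilon>)"
    \<comment> \<open>The equality case of the Hoelder inequality, scaled to norm 1, so that pairing
      with \<delta> gives its dual norm.\<close>
    define \<xi> where "\<xi> = (\<lambda>i. \<delta> i powr (q - 1) / S powr (1 / r))"
    have \<xi>0: "0 \<le> \<xi> i" for i by (simp add: \<xi>_def)
    have \<xi>p: "(\<Sum>i\<in>I. \<xi> i powr r) = 1"
    proof -
      have "\<xi> i powr r = \<delta> i powr q / S" for i
        using S 3 q(3) by (simp add: \<xi>_def powr_divide powr_powr)
      then show ?thesis using S by (simp add: S_def flip: sum_divide_distrib)
    qed
    have \<delta>\<xi>: "(\<Sum>i\<in>I. \<delta> i * \<xi> i) = S powr (1 / q)"
    proof -
      have "\<delta> i * \<xi> i = \<delta> i powr q / S powr (1 / r)" if "i \<in> I" for i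
      proof (cases "\<delta> i = 0")
        case False
        then have "0 < \<delta> i" using \<delta>[OF that] by simp
        then have "\<delta> i * \<delta> i powr (q - 1) = \<delta> i powr q" by (simp add: powr_diff)
        then show ?thesis by (simp add: \<xi>_def)
      qed (simp add: \<xi>_def)
      then have "(\<Sum>i\<in>I. \<delta> i * \<xi> i) = S / S powr (1 / r)" by (simp add: S_def flip: sum_divide_distrib)
      also have "\<dots> = S powr (1 - 1 / r)" using S by (simp add: powr_diff)
      finally show ?thesis by (simp add: q(4))
    qed
    show ?thesis
    proof (rule that[of \<xi> \<beta> "(\<Sum>i\<in>I. \<beta> i powr q) powr (1 / q)"])
      show "Lp_norm p I v \<le> t" if t: "0 \<le> t" and v: "\<And>i. i \<in> I \<Longrightarrow> 0 \<le> v i" "\<And>i. i \<in> I \<Longrightarrow> v i \<le> \<xi> i * t" for v t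
      proof -
        have "(\<Sum>i\<in>I. v i powr r) \<le> (\<Sum>i\<in>I. (\<xi> i * t) powr r)"
          using v 3 by (intro sum_mono powr_mono2) auto
        also have "\<dots> = t powr r" using t \<xi>0 \<xi>p by (simp add: powr_mult flip: sum_distrib_right)
        finally have "(\<Sum>i\<in>I. v i powr r) powr (1 / r) \<le> (t powr r) powr (1 / r)"
          using 3 by (intro powr_mono2) (auto intro: sum_nonneg)
        then show ?thesis unfolding norm using t 3 by (simp add: powr_powr)
      qed
      show "(\<Sum>i\<in>I. \<beta> i * v i) \<le> (\<Sum>i\<in>I. \<beta> i powr q) powr (1 / q) * Lp_norm p I v" if "\<And>i. i \<in> I \<Longrightarrow> 0 \<le> v i" for v
        unfolding norm by (rule holder[OF 3(2) q(1,2) I(1)]) (use that \<eta> e in \<open>auto simp: \<beta>_def\<close>)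
      show "(\<Sum>i\<in>I. \<beta> i powr q) powr (1 / q) < (\<Sum>i\<in>I. \<delta> i * \<xi> i)"
        unfolding \<delta>\<xi> using e q(1) by (intro powr_less_mono2) (auto simp: \<beta>_def intro: sum_nonneg)
    qed (use \<xi>0 e in \<open>auto simp: \<beta>_def \<eta>_def\<close>)
  qed
qed

section \<open>Products\<close>

locale length_group_family =
  fixes I :: "'i set" and G :: "'i \<Rightarrow> 'g monoid" and lens :: "'i \<Rightarrow> 'g \<Rightarrow> real" and p :: ereal
  assumes I: "finite I" and p: "1 \<le> p" and factor: "\<And>i. i \<in> I \<Longrightarrow> length_group (G i) (lens i)"
begin

abbreviation P :: "('i \<Rightarrow> 'g) monoid" where "P \<equiv> product_group I G"

definition plen :: "('i \<Rightarrow> 'g) \<Rightarrow> real" where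
  "plen g = Lp_norm p I (\<lambda>i. lens i (g i))"

definition emb :: "'i \<Rightarrow> 'g \<Rightarrow> 'i \<Rightarrow> 'g" where
  "emb i x = (\<lambda>j\<in>I. if j = i then x else \<one>\<^bsub>G j\<^esub>)"

lemma group_factor: "i \<in> I \<Longrightarrow> group (G i)"
  using factor length_group.axioms(1) by blast

lemma group_P: "group P"
  by (intro product_group group_factor)

lemma coord_closed: "\<lbrakk>g \<in> carrier P; i \<in> I\<rbrakk> \<Longrightarrow> g i \<in> carrier (G i)"
  by (auto simp: PiE_iff)

lemma coord_inv: "\<lbrakk>g \<in> carrier P; i \<in> I\<rbrakk> \<Longrightarrow> (inv\<^bsub>P\<^esub> g) i = inv\<^bsub>G i\<^esub> (g i)"
  using group_factor by simp

lemma coord_mult: "i \<in> I \<Longrightarrow> (g \<otimes>\<^bsub>P\<^esub> g') i = g i \<otimes>\<^bsub>G i\<^esub> g' i"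
  by simp

lemma lens_nonneg: "\<lbrakk>g \<in> carrier P; i \<in> I\<rbrakk> \<Longrightarrow> 0 \<le> lens i (g i)"
  using length_group.len_nonneg[OF factor] coord_closed by blast

lemma lens_le_plen: "\<lbrakk>g \<in> carrier P; i \<in> I\<rbrakk> \<Longrightarrow> lens i (g i) \<le> plen g"
  unfolding plen_def using Lp_norm_coord_le[OF I p, of "\<lambda>i. lens i (g i)"] lens_nonneg by blast

lemma finite_plen_ball: "finite {g \<in> carrier P. plen g \<le> r}"
proof -
  have "{g \<in> carrier P. plen g \<le> r} \<subseteq> Pi\<^sub>E I (\<lambda>i. {x \<in> carrier (G i). lens i x \<le> r})"
  proof
    fix g assume g: "g \<in> {g \<in> carrier P. plen g \<le> r}"
    then have "lens i (g i) \<le> r" if "i \<in> I" for i using lens_le_plen[of g i] that by force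
    then show "g \<in> Pi\<^sub>E I (\<lambda>i. {x \<in> carrier (G i). lens i x \<le> r})" using g by (auto simp: PiE_iff)
  qed
  moreover have "finite (Pi\<^sub>E I (\<lambda>i. {x \<in> carrier (G i). lens i x \<le> r}))"
    using I length_group.finite_ball[OF factor] by (intro finite_PiE) auto
  ultimately show ?thesis by (rule finite_subset)
qed

lemma emb_closed: "\<lbrakk>i \<in> I; x \<in> carrier (G i)\<rbrakk> \<Longrightarrow> emb i x \<in> carrier P"
  using group.is_monoid[OF group_factor] by (auto simp: emb_def monoid.one_closed)

lemma emb_mult: "\<lbrakk>i \<in> I; x \<in> carrier (G i); y \<in> carrier (G i)\<rbrakk> \<Longrightarrow> emb i x \<otimes>\<^bsub>P\<^esub> emb i y = emb i (x \<otimes>\<^bsub>G i\<^esub> y)"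
  using group.is_monoid[OF group_factor] by (auto simp: emb_def fun_eq_iff monoid.l_one monoid.one_closed)

lemma emb_one: "emb i \<one>\<^bsub>G i\<^esub> = \<one>\<^bsub>P\<^esub>"
  by (auto simp: emb_def fun_eq_iff)

lemma emb_inv: "\<lbrakk>i \<in> I; x \<in> carrier (G i)\<rbrakk> \<Longrightarrow> inv\<^bsub>P\<^esub> (emb i x) = emb i (inv\<^bsub>G i\<^esub> x)"
  using emb_closed[of i x] group_factor
  by (subst inv_product_group) (auto simp: emb_def fun_eq_iff group.is_monoid monoid.inv_one)

lemma normal_preimage_emb:
  assumes N: "N \<lhd> P" and i: "i \<in> I"
  shows "{x \<in> carrier (G i). emb i x \<in> N} \<lhd> G i"
proof -
  interpret N: normal N P by (rule N)
  interpret Gi: group "G i" by (rule group_factor[OF i])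
  show ?thesis
    unfolding Gi.normal_inv_iff
  proof (intro conjI ballI)
    show "subgroup {x \<in> carrier (G i). emb i x \<in> N} (G i)"
    proof (rule Gi.subgroupI)
      show "{x \<in> carrier (G i). emb i x \<in> N} \<noteq> {}" using emb_one[of i] subgroup.one_closed[OF N.subgroup_axioms] Gi.one_closed by force
      show "inv\<^bsub>G i\<^esub> x \<in> {x \<in> carrier (G i). emb i x \<in> N}" if "x \<in> {x \<in> carrier (G i). emb i x \<in> N}" for x
        using that emb_inv[OF i, of x] subgroup.m_inv_closed[OF N.subgroup_axioms, of "emb i x"] by auto
      show "x \<otimes>\<^bsub>G i\<^esub> y \<in> {x \<in> carrier (G i). emb i x \<in> N}"
        if "x \<in> {x \<in> carrier (G i). emb i x \<in> N}" "y \<in> {x \<in> carrier (G i). emb i x \<in> N}" for x y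
        using that emb_mult[OF i, of x y] subgroup.m_closed[OF N.subgroup_axioms, of "emb i x" "emb i y"] by auto
    qed auto
    fix x k assume x: "x \<in> carrier (G i)" and k: "k \<in> {x \<in> carrier (G i). emb i x \<in> N}"
    have kc: "k \<in> carrier (G i)" "emb i k \<in> N" using k by auto
    have "emb i x \<otimes>\<^bsub>P\<^esub> emb i k \<otimes>\<^bsub>P\<^esub> inv\<^bsub>P\<^esub> (emb i x) \<in> N"
      by (rule N.inv_op_closed2[OF emb_closed[OF i x] kc(2)])
    also have "emb i x \<otimes>\<^bsub>P\<^esub> emb i k \<otimes>\<^bsub>P\<^esub> inv\<^bsub>P\<^esub> (emb i x) = emb i (x \<otimes>\<^bsub>G i\<^esub> k \<otimes>\<^bsub>G i\<^esub> inv\<^bsub>G i\<^esub> x)"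
      unfolding emb_inv[OF i x] emb_mult[OF i x kc(1)] by (rule emb_mult[OF i]) (use x kc in auto)
    finally show "x \<otimes>\<^bsub>G i\<^esub> k \<otimes>\<^bsub>G i\<^esub> inv\<^bsub>G i\<^esub> x \<in> {x \<in> carrier (G i). emb i x \<in> N}"
      using x kc by simp
  qed
qed

lemma normal_proj:
  assumes N: "N \<lhd> P" and i: "i \<in> I"
  shows "(\<lambda>x. x i) ` N \<lhd> G i"
proof -
  interpret N: normal N P by (rule N)
  interpret Gi: group "G i" by (rule group_factor[OF i])
  show ?thesis
    unfolding Gi.normal_inv_iff
  proof (intro conjI ballI)
    show "subgroup ((\<lambda>x. x i) ` N) (G i)"
    proof (rule Gi.subgroupI)
      show "(\<lambda>x. x i) ` N \<subseteq> carrier (G i)" using N.subset coord_closed i by blast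
      show "(\<lambda>x. x i) ` N \<noteq> {}" using subgroup.one_closed[OF N.subgroup_axioms] by blast
      show "inv\<^bsub>G i\<^esub> a \<in> (\<lambda>x. x i) ` N" if a: "a \<in> (\<lambda>x. x i) ` N" for a
      proof -
        obtain x where x: "x \<in> N" "a = x i" using a by blast
        have "x \<in> carrier P" using x N.subset by blast
        then have e: "inv\<^bsub>G i\<^esub> a = (inv\<^bsub>P\<^esub> x) i" using x i by (simp only: coord_inv)
        show ?thesis unfolding e by (rule imageI[OF subgroup.m_inv_closed[OF N.subgroup_axioms x(1)]])
      qed
      show "a \<otimes>\<^bsub>G i\<^esub> b \<in> (\<lambda>x. x i) ` N" if ab: "a \<in> (\<lambda>x. x i) ` N" "b \<in> (\<lambda>x. x i) ` N" for a b
      proof -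
        obtain x y where x: "x \<in> N" "a = x i" "y \<in> N" "b = y i" using ab by blast
        have e: "a \<otimes>\<^bsub>G i\<^esub> b = (x \<otimes>\<^bsub>P\<^esub> y) i" using x i by simp
        show ?thesis unfolding e by (rule imageI[OF subgroup.m_closed[OF N.subgroup_axioms x(1,3)]])
      qed
    qed
    fix a k assume a: "a \<in> carrier (G i)" and k: "k \<in> (\<lambda>x. x i) ` N"
    obtain x where x: "x \<in> N" "k = x i" using k by blast
    have m: "emb i a \<otimes>\<^bsub>P\<^esub> x \<otimes>\<^bsub>P\<^esub> inv\<^bsub>P\<^esub> (emb i a) \<in> N" by (rule N.inv_op_closed2[OF emb_closed[OF i a] x(1)])
    have e: "a \<otimes>\<^bsub>G i\<^esub> k \<otimes>\<^bsub>G i\<^esub> inv\<^bsub>G i\<^esub> a = (emb i a \<otimes>\<^bsub>P\<^esub> x \<otimes>\<^bsub>P\<^esub> inv\<^bsub>P\<^esub> (emb i a)) i"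
      unfolding emb_inv[OF i a] using i x(2) by (simp add: emb_def)
    show "a \<otimes>\<^bsub>G i\<^esub> k \<otimes>\<^bsub>G i\<^esub> inv\<^bsub>G i\<^esub> a \<in> (\<lambda>x. x i) ` N" unfolding e by (rule imageI[OF m])
  qed
qed

text \<open>Outside coordinate \<open>i\<close> the embedded element is trivial and the commutator
  with \<open>x\<close> cancels. Thus an element of \<open>N\<close> with arbitrary other
  coordinates yields elements of \<open>N\<close> in a single factor, of the form produced by
  \<open>contracting_commutator\<close>.\<close>

lemma emb_commutator:
  assumes N: "N \<lhd> P" and i: "i \<in> I" and x: "x \<in> N" and y: "y \<in> carrier (G i)"
  shows "emb i (y \<otimes>\<^bsub>G i\<^esub> (x i \<otimes>\<^bsub>G i\<^esub> inv\<^bsub>G i\<^esub> y \<otimes>\<^bsub>G i\<^esub> inv\<^bsub>G i\<^esub> (x i))) \<in> N"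
proof -
  interpret N: normal N P by (rule N)
  interpret Gi: group "G i" by (rule group_factor[OF i])
  have xP: "x \<in> carrier P" using x N.subset by blast
  have "(emb i y \<otimes>\<^bsub>P\<^esub> x \<otimes>\<^bsub>P\<^esub> inv\<^bsub>P\<^esub> (emb i y)) \<otimes>\<^bsub>P\<^esub> inv\<^bsub>P\<^esub> x \<in> N"
    using subgroup.m_closed[OF N.subgroup_axioms N.inv_op_closed2[OF emb_closed[OF i y] x] subgroup.m_inv_closed[OF N.subgroup_axioms x]] .
  moreover have "(emb i y \<otimes>\<^bsub>P\<^esub> x \<otimes>\<^bsub>P\<^esub> inv\<^bsub>P\<^esub> (emb i y)) \<otimes>\<^bsub>P\<^esub> inv\<^bsub>P\<^esub> x
      = emb i (y \<otimes>\<^bsub>G i\<^esub> (x i \<otimes>\<^bsub>G i\<^esub> inv\<^bsub>G i\<^esub> y \<otimes>\<^bsub>G i\<^esub> inv\<^bsub>G i\<^esub> (x i)))"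
  proof
    fix j
    show "((emb i y \<otimes>\<^bsub>P\<^esub> x \<otimes>\<^bsub>P\<^esub> inv\<^bsub>P\<^esub> (emb i y)) \<otimes>\<^bsub>P\<^esub> inv\<^bsub>P\<^esub> x) j
      = emb i (y \<otimes>\<^bsub>G i\<^esub> (x i \<otimes>\<^bsub>G i\<^esub> inv\<^bsub>G i\<^esub> y \<otimes>\<^bsub>G i\<^esub> inv\<^bsub>G i\<^esub> (x i))) j"
    proof (cases "j \<in> I")
      case True
      interpret Gj: group "G j" by (rule group_factor[OF True])
      have xj: "x j \<in> carrier (G j)" using coord_closed[OF xP True] .
      have ix: "(inv\<^bsub>P\<^esub> x) j = inv\<^bsub>G j\<^esub> (x j)" using coord_inv[OF xP True] .
      have iy: "(inv\<^bsub>P\<^esub> (emb i y)) j = emb i (inv\<^bsub>G i\<^esub> y) j" by (simp only: emb_inv[OF i y])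
      have "((emb i y \<otimes>\<^bsub>P\<^esub> x \<otimes>\<^bsub>P\<^esub> inv\<^bsub>P\<^esub> (emb i y)) \<otimes>\<^bsub>P\<^esub> inv\<^bsub>P\<^esub> x) j
          = emb i y j \<otimes>\<^bsub>G j\<^esub> x j \<otimes>\<^bsub>G j\<^esub> emb i (inv\<^bsub>G i\<^esub> y) j \<otimes>\<^bsub>G j\<^esub> inv\<^bsub>G j\<^esub> (x j)"
        using True by (simp add: iy ix)
      also have "\<dots> = emb i (y \<otimes>\<^bsub>G i\<^esub> (x i \<otimes>\<^bsub>G i\<^esub> inv\<^bsub>G i\<^esub> y \<otimes>\<^bsub>G i\<^esub> inv\<^bsub>G i\<^esub> (x i))) j"
        using True xj y by (auto simp: emb_def Gi.m_assoc)
      finally show ?thesis .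
    qed (simp add: emb_def)
  qed
  ultimately show ?thesis by simp
qed

text \<open>Any representative bounds the length of its coset from above, so short elements in
  distinct cosets count cosets from below.\<close>

lemma exp_lower_quotient:
  assumes N: "N \<lhd> P" and T: "exp_lower T l \<sigma>" and f: "\<And>t. t \<in> T \<Longrightarrow> f t \<in> carrier P" "inj_on (\<lambda>t. N #>\<^bsub>P\<^esub> f t) T"
    and l: "\<And>t. t \<in> T \<Longrightarrow> plen (f t) \<le> l t"
  shows "exp_lower (carrier (P Mod N)) (coset_len plen) \<sigma>"
proof (rule exp_lower_inj[OF T f(2)])
  interpret P: group P by (rule group_P)
  interpret N: normal N P by (rule N)
  show "(\<lambda>t. N #>\<^bsub>P\<^esub> f t) ` T \<subseteq> carrier (P Mod N)" using f(1) by (auto simp: carrier_FactGroup)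
  show "finite {A \<in> carrier (P Mod N). coset_len plen A \<le> r}" for r by (rule N.finite_coset_ball[OF finite_plen_ball])
  fix t assume t: "t \<in> T"
  have A: "N #>\<^bsub>P\<^esub> f t \<in> carrier (P Mod N)" using f(1)[OF t] by (auto simp: carrier_FactGroup)
  obtain a where a: "a \<in> carrier P" "N #>\<^bsub>P\<^esub> f t = N #>\<^bsub>P\<^esub> a" "plen a = coset_len plen (N #>\<^bsub>P\<^esub> f t)"
    "\<And>n. n \<in> N \<Longrightarrow> plen a \<le> plen (n \<otimes>\<^bsub>P\<^esub> a)" by (rule N.coset_rep[OF finite_plen_ball A]) (rule that)
  have "f t \<in> N #>\<^bsub>P\<^esub> a" using P.rcos_self[OF f(1)[OF t] N.subgroup_axioms] a(2) by simp
  then obtain n where "n \<in> N" "f t = n \<otimes>\<^bsub>P\<^esub> a" by (auto simp: r_coset_def)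
  then show "coset_len plen (N #>\<^bsub>P\<^esub> f t) \<le> l t" using a(3,4) l[OF t] by (metis order_trans)
qed

lemma inj_on_singleton_cosets: "inj_on (\<lambda>t. {\<one>\<^bsub>P\<^esub>} #>\<^bsub>P\<^esub> t) (carrier P)"
  using group.is_monoid[OF group_P] by (auto simp: inj_on_def r_coset_def monoid.l_one simp del: mult_product_group one_product_group carrier_product_group)

lemma exp_summable_trivial_quotient:
  assumes "exp_summable (carrier P) plen \<alpha>"
  shows "exp_summable (carrier (P Mod {\<one>\<^bsub>P\<^esub>})) (coset_len plen) \<alpha>"
proof -
  interpret P: group P by (rule group_P)
  have "\<forall>A\<in>carrier (P Mod {\<one>\<^bsub>P\<^esub>}). \<exists>a. a \<in> carrier P \<and> A = {\<one>\<^bsub>P\<^esub>} #>\<^bsub>P\<^esub> a \<and> plen a = coset_len plen A"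
    using normal.coset_rep[OF P.one_is_normal finite_plen_ball] by metis
  then obtain \<mu> where \<mu>: "\<And>A. A \<in> carrier (P Mod {\<one>\<^bsub>P\<^esub>}) \<Longrightarrow> \<mu> A \<in> carrier P \<and> A = {\<one>\<^bsub>P\<^esub>} #>\<^bsub>P\<^esub> \<mu> A \<and> plen (\<mu> A) = coset_len plen A"
    by metis
  show ?thesis
    by (rule exp_summable_inj[OF assms, where f = \<mu>]) (use \<mu> in \<open>blast, metis inj_onI, metis\<close>)
qed

lemma exp_lower_product:
  assumes low: "\<And>i. i \<in> I \<Longrightarrow> exp_lower (carrier (G i)) (lens i) (\<delta> i)" and \<xi>: "\<And>i. i \<in> I \<Longrightarrow> 0 \<le> \<xi> i"
    and norm: "\<And>v r. \<lbrakk>0 \<le> r; \<And>i. i \<in> I \<Longrightarrow> 0 \<le> v i; \<And>i. i \<in> I \<Longrightarrow> v i \<le> \<xi> i * r\<rbrakk> \<Longrightarrow> Lp_norm p I v \<le> r"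
  shows "exp_lower (carrier P) plen (\<Sum>i\<in>I. \<delta> i * \<xi> i)"
proof -
  have "exp_lower (Pi\<^sub>E I (\<lambda>i. carrier (G i))) plen (\<Sum>i\<in>I. \<delta> i * \<xi> i)"
  proof (rule exp_lower_prod[OF I low _ \<xi>])
    show "finite {t \<in> \<Pi>\<^sub>E i\<in>I. carrier (G i). plen t \<le> r}" for r using finite_plen_ball[of r] by simp
    show "plen t \<le> r" if "t \<in> (\<Pi>\<^sub>E i\<in>I. carrier (G i))" "0 \<le> r" "\<And>i. i \<in> I \<Longrightarrow> lens i (t i) \<le> \<xi> i * r" for t r
      unfolding plen_def using norm[OF that(2), of "\<lambda>i. lens i (t i)"] that lens_nonneg[of t] by simp
  qed
  then show ?thesis by simp
qed

text \<open>A coset of \<open>N\<close> is recorded by a shortest representative outside coordinate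
  \<open>i0\<close> and, in this coordinate, by its class modulo the part of \<open>N\<close> in the
  factor. The record determines the coset, and replacing the coordinate by a shortest element of its
  class does not lengthen it. So the quotient is counted inside a product of the other factors with
  a quotient of the factor \<open>i0\<close>.\<close>

lemma exp_summable_quotient:
  assumes N: "N \<lhd> P" and i0: "i0 \<in> I" and \<tau>: "0 \<le> \<tau>"
    and s: "\<And>i. \<lbrakk>i \<in> I; i \<noteq> i0\<rbrakk> \<Longrightarrow> exp_summable (carrier (G i)) (lens i) (\<beta> i)"
    and s0: "exp_summable (carrier (G i0 Mod {x \<in> carrier (G i0). emb i0 x \<in> N})) (coset_len (lens i0)) (\<beta> i0)"
    and norm: "\<And>v. (\<And>i. i \<in> I \<Longrightarrow> 0 \<le> v i) \<Longrightarrow> (\<Sum>i\<in>I. \<beta> i * v i) \<le> \<tau> * Lp_norm p I v" and b0: "0 \<le> \<beta> i0"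
  shows "exp_summable (carrier (P Mod N)) (coset_len plen) \<tau>"
proof -
  define N0 where "N0 = {x \<in> carrier (G i0). emb i0 x \<in> N}"
  interpret P: group P by (rule group_P)
  interpret N: normal N P by (rule N)
  interpret L0: length_group "G i0" "lens i0" by (rule factor[OF i0])
  interpret N0: normal N0 "G i0" unfolding N0_def by (rule normal_preimage_emb[OF N i0])
  have "\<forall>A\<in>carrier (P Mod N). \<exists>a. a \<in> carrier P \<and> A = N #>\<^bsub>P\<^esub> a \<and> plen a = coset_len plen A"
    using N.coset_rep[OF finite_plen_ball] by metis
  then obtain \<mu> where \<mu>: "\<And>A. A \<in> carrier (P Mod N) \<Longrightarrow> \<mu> A \<in> carrier P"
    "\<And>A. A \<in> carrier (P Mod N) \<Longrightarrow> A = N #>\<^bsub>P\<^esub> \<mu> A" "\<And>A. A \<in> carrier (P Mod N) \<Longrightarrow> plen (\<mu> A) = coset_len plen A"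
    by metis
  have "\<forall>B\<in>carrier (G i0 Mod N0). \<exists>b. b \<in> carrier (G i0) \<and> B = N0 #>\<^bsub>G i0\<^esub> b \<and> lens i0 b = coset_len (lens i0) B"
    using N0.coset_rep[OF L0.finite_ball] by metis
  then obtain \<nu> where \<nu>: "\<And>B. B \<in> carrier (G i0 Mod N0) \<Longrightarrow> \<nu> B \<in> carrier (G i0)"
    "\<And>B. B \<in> carrier (G i0 Mod N0) \<Longrightarrow> B = N0 #>\<^bsub>G i0\<^esub> \<nu> B"
    "\<And>B. B \<in> carrier (G i0 Mod N0) \<Longrightarrow> lens i0 (\<nu> B) = coset_len (lens i0) B"
    by metis
  define B where "B = (\<lambda>A. N0 #>\<^bsub>G i0\<^esub> (\<mu> A i0))"
  have Bm: "B A \<in> carrier (G i0 Mod N0)" if "A \<in> carrier (P Mod N)" for A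
    using coord_closed[OF \<mu>(1)[OF that] i0] by (auto simp: B_def carrier_FactGroup)
  define T where "T = (\<lambda>i. if i = i0 then \<nu> ` carrier (G i0 Mod N0) else carrier (G i))"
  define \<Psi> where "\<Psi> = (\<lambda>A. \<lambda>i\<in>I. if i = i0 then \<nu> (B A) else \<mu> A i)"
  show ?thesis
  proof (rule exp_summable_prod[OF I, where T = T and l = lens and \<beta> = \<beta> and \<Psi> = \<Psi>])
    fix i assume i: "i \<in> I"
    show "exp_summable (T i) (lens i) (\<beta> i)"
    proof (cases "i = i0")
      case True
      have "exp_summable (\<nu> ` carrier (G i0 Mod N0)) (lens i0) (\<beta> i0)"
      proof (rule exp_summable_inj[OF s0[folded N0_def], where f = "\<lambda>t. N0 #>\<^bsub>G i0\<^esub> t"])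
        show "(\<lambda>t. N0 #>\<^bsub>G i0\<^esub> t) ` \<nu> ` carrier (G i0 Mod N0) \<subseteq> carrier (G i0 Mod N0)"
          using \<nu>(1) by (auto simp: carrier_FactGroup)
        show "inj_on (\<lambda>t. N0 #>\<^bsub>G i0\<^esub> t) (\<nu> ` carrier (G i0 Mod N0))"
          by (rule inj_onI) (metis \<nu>(2) imageE)
        show "lens i0 t = coset_len (lens i0) (N0 #>\<^bsub>G i0\<^esub> t)" if t: "t \<in> \<nu> ` carrier (G i0 Mod N0)" for t
        proof -
          obtain B where "B \<in> carrier (G i0 Mod N0)" "t = \<nu> B" using t by blast
          then show ?thesis using \<nu>(2,3) by metis
        qed
      qed
      then show ?thesis using True by (simp add: T_def)
    qed (use s i in \<open>simp add: T_def\<close>)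
  next
    show "\<Psi> ` carrier (P Mod N) \<subseteq> Pi\<^sub>E I T"
      using Bm coord_closed[OF \<mu>(1)] by (auto simp: \<Psi>_def T_def)
    show "inj_on \<Psi> (carrier (P Mod N))"
    proof (rule inj_onI)
      fix A A' assume A: "A \<in> carrier (P Mod N)" "A' \<in> carrier (P Mod N)" and e: "\<Psi> A = \<Psi> A'"
      have c: "\<mu> A \<in> carrier P" "\<mu> A' \<in> carrier P" using \<mu>(1) A by auto
      have off: "\<mu> A i = \<mu> A' i" if "i \<in> I" "i \<noteq> i0" for i using fun_cong[OF e, of i] that by (simp add: \<Psi>_def)
      have "\<nu> (B A) = \<nu> (B A')" using fun_cong[OF e, of i0] i0 by (simp add: \<Psi>_def)
      then have BB: "B A = B A'" using \<nu>(2)[OF Bm[OF A(1)]] \<nu>(2)[OF Bm[OF A(2)]] by simp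
      have c0: "\<mu> A i0 \<in> carrier (G i0)" "\<mu> A' i0 \<in> carrier (G i0)" using coord_closed c i0 by auto
      have "\<mu> A i0 \<in> N0 #>\<^bsub>G i0\<^esub> (\<mu> A' i0)"
        using L0.rcos_self[OF c0(1) N0.subgroup_axioms] BB by (simp add: B_def)
      then obtain k where k: "k \<in> N0" "\<mu> A i0 = k \<otimes>\<^bsub>G i0\<^esub> \<mu> A' i0" by (auto simp: r_coset_def)
      \<comment> \<open>Equal records differ only in coordinate \<open>i0\<close>, and there by an
        element \<open>k\<close> whose embedding lies in \<open>N\<close>.\<close>
      have "\<mu> A = emb i0 k \<otimes>\<^bsub>P\<^esub> \<mu> A'"
      proof
        fix i
        show "\<mu> A i = (emb i0 k \<otimes>\<^bsub>P\<^esub> \<mu> A') i"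
        proof (cases "i \<in> I")
          case True
          interpret Gi: group "G i" by (rule group_factor[OF True])
          show ?thesis using True k(2) off[of i] coord_closed[OF c(2) True] by (auto simp: emb_def)
        next
          case False
          then show ?thesis using c by (simp add: PiE_iff extensional_def)
        qed
      qed
      moreover have "emb i0 k \<in> N" using k(1) unfolding N0_def by blast
      ultimately have "\<mu> A \<in> N #>\<^bsub>P\<^esub> \<mu> A'" unfolding r_coset_def by blast
      then have "N #>\<^bsub>P\<^esub> \<mu> A' = N #>\<^bsub>P\<^esub> \<mu> A" by (rule P.repr_independence[OF _ c(2) N.subgroup_axioms])
      then show "A = A'" using \<mu>(2)[OF A(1)] \<mu>(2)[OF A(2)] by simp
    qed
    fix A assume A: "A \<in> carrier (P Mod N)"
    have c: "\<mu> A \<in> carrier P" using \<mu>(1) A by auto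
    have "lens i0 (\<nu> (B A)) \<le> lens i0 (\<mu> A i0)"
      using L0.coset_len_le[OF N0.normal_axioms coord_closed[OF c i0]] \<nu>(3)[OF Bm[OF A]] by (simp add: B_def)
    then have "\<beta> i * lens i (\<Psi> A i) \<le> \<beta> i * lens i (\<mu> A i)" if "i \<in> I" for i
      using that b0 by (auto simp: \<Psi>_def intro: mult_left_mono)
    then have "(\<Sum>i\<in>I. \<beta> i * lens i (\<Psi> A i)) \<le> (\<Sum>i\<in>I. \<beta> i * lens i (\<mu> A i))" by (rule sum_mono)
    also have "\<dots> \<le> \<tau> * plen (\<mu> A)" unfolding plen_def by (rule norm) (rule lens_nonneg[OF c])
    finally show "(\<Sum>i\<in>I. \<beta> i * lens i (\<Psi> A i)) \<le> \<tau> * coset_len plen A" using \<mu>(3)[OF A] by simp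
  qed
qed

section \<open>Growth of products and their quotients\<close>

lemma factor_growth_rate:
  assumes i: "i \<in> I" and cg: "\<exists>D. length_group.coarsely_geodesic (G i) (lens i) D"
  shows "\<exists>\<delta>. growth_rate (carrier (G i)) (lens i) \<delta>"
proof -
  interpret L: length_group "G i" "lens i" by (rule factor[OF i])
  obtain D where D: "L.coarsely_geodesic D" using cg by blast
  show ?thesis by (rule L.group_growth_rate_exists[OF D]) blast
qed

text \<open>One factor losing growth suffices: \<open>Lp_gap\<close> turns this single loss into a
  loss of the dual norm, with room for exponents \<beta> slightly above the growth rates, where the
  series of the factors converge.\<close>

theorem product_growth_gap:
  assumes p1: "1 < p \<or> card I = 1"
    and h: "\<And>i. i \<in> I \<Longrightarrow> h i \<in> carrier (G i)" "\<And>i. i \<in> I \<Longrightarrow> inj (\<lambda>k::int. h i [^]\<^bsub>G i\<^esub> k)"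
      "\<And>i. i \<in> I \<Longrightarrow> \<exists>C\<ge>0. length_group.contracting (G i) (lens i) C (length_group.cyc (G i) (h i))"
    and ne: "\<And>i. i \<in> I \<Longrightarrow> \<not> elementary_group (G i)"
    and cg: "\<And>i. i \<in> I \<Longrightarrow> \<exists>D. length_group.coarsely_geodesic (G i) (lens i) D"
    and N: "N \<lhd> P" "infinite N"
  obtains \<sigma> \<tau> where "\<tau> < \<sigma>" "0 \<le> \<tau>" "exp_lower (carrier P) plen \<sigma>"
    "exp_summable (carrier (P Mod N)) (coset_len plen) \<tau>"
proof -
  interpret N: normal N P by (rule N)
  have "\<exists>i0\<in>I. infinite ((\<lambda>x. x i0) ` N)"
  proof (rule ccontr)
    assume "\<not> ?thesis"
    then have "finite (Pi\<^sub>E I (\<lambda>i. (\<lambda>x. x i) ` N))" by (intro finite_PiE I) auto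
    moreover have "N \<subseteq> Pi\<^sub>E I (\<lambda>i. (\<lambda>x. x i) ` N)"
    proof
      fix x assume x: "x \<in> N"
      then have "x \<in> Pi\<^sub>E I (\<lambda>i. carrier (G i))" using N.subset by auto
      then show "x \<in> Pi\<^sub>E I (\<lambda>i. (\<lambda>x. x i) ` N)" using x by (auto simp: PiE_iff)
    qed
    ultimately show False using N(2) finite_subset by blast
  qed
  then obtain i0 where i0: "i0 \<in> I" "infinite ((\<lambda>x. x i0) ` N)" by blast
  interpret L: length_group "G i0" "lens i0" by (rule factor[OF i0(1)])
  obtain C where C: "0 \<le> C" "L.contracting C (L.cyc (h i0))" using h(3)[OF i0(1)] by blast
  note h0 = h(1)[OF i0(1)] h(2)[OF i0(1)]
  define N0 where "N0 = {x \<in> carrier (G i0). emb i0 x \<in> N}"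
  have N0: "N0 \<lhd> G i0" unfolding N0_def by (rule normal_preimage_emb[OF N(1) i0(1)])
  interpret N0: normal N0 "G i0" by (rule N0)
  \<comment> \<open>An infinite projection need not by itself come from elements of \<open>N\<close>
    inside the factor; the powers of the contracting commutator are such elements, and there are
    infinitely many of them.\<close>
  have infN0: "infinite N0"
  proof -
    obtain f where f: "f \<in> (\<lambda>x. x i0) ` N" "\<not> L.commensurates (h i0) f"
      by (rule L.normal_not_commensurate[OF h0 C(2) ne[OF i0(1)] normal_proj[OF N(1) i0(1)] i0(2)])
    obtain x where x: "x \<in> N" "f = x i0" using f(1) by blast
    have xP: "x \<in> carrier P" using x N.subset by blast
    have fc: "f \<in> carrier (G i0)" using coord_closed[OF xP i0(1)] x by simp
    obtain m :: int and K where
      inj: "inj (\<lambda>k::int. (h i0 [^]\<^bsub>G i0\<^esub> m \<otimes>\<^bsub>G i0\<^esub> (f \<otimes>\<^bsub>G i0\<^esub> inv\<^bsub>G i0\<^esub> (h i0 [^]\<^bsub>G i0\<^esub> m) \<otimes>\<^bsub>G i0\<^esub> inv\<^bsub>G i0\<^esub> f)) [^]\<^bsub>G i0\<^esub> k)"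
      by (rule L.contracting_commutator[OF h0 C(2,1) fc f(2)])
    define c where "c = h i0 [^]\<^bsub>G i0\<^esub> m \<otimes>\<^bsub>G i0\<^esub> (f \<otimes>\<^bsub>G i0\<^esub> inv\<^bsub>G i0\<^esub> (h i0 [^]\<^bsub>G i0\<^esub> m) \<otimes>\<^bsub>G i0\<^esub> inv\<^bsub>G i0\<^esub> f)"
    have cc: "c \<in> carrier (G i0)" using fc h0(1) by (simp add: c_def)
    have "emb i0 c \<in> N" unfolding c_def x(2) by (rule emb_commutator[OF N(1) i0(1) x(1)]) (use h0 in simp)
    then have "c \<in> N0" using cc unfolding N0_def by blast
    then have "L.cyc c \<subseteq> N0" using L.subgroup_int_pow_closed[OF N0.subgroup_axioms] by (auto simp: L.cyc_def)
    moreover have "infinite (L.cyc c)" using L.infinite_cyc[of c] inj by (simp add: c_def)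
    ultimately show ?thesis by (rule infinite_super)
  qed
  have "\<forall>i\<in>I. \<exists>\<delta>. growth_rate (carrier (G i)) (lens i) \<delta>" using factor_growth_rate cg by blast
  from bchoice[OF this] obtain \<delta> where "\<forall>i\<in>I. growth_rate (carrier (G i)) (lens i) (\<delta> i)" ..
  then have \<delta>: "growth_rate (carrier (G i)) (lens i) (\<delta> i)" if "i \<in> I" for i using that by blast
  obtain \<delta>' where \<delta>': "growth_rate (carrier (G i0 Mod N0)) (coset_len (lens i0)) \<delta>'"
  proof -
    obtain D where D: "L.coarsely_geodesic D" using cg[OF i0(1)] by blast
    show ?thesis by (rule L.coset_growth_rate_exists[OF D N0]) (rule that)
  qed
  have gap: "\<delta>' < \<delta> i0" by (rule L.quotient_growth_gap[OF h0 C(2,1) ne[OF i0(1)] N0 infN0 \<delta>[OF i0(1)] \<delta>'])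
  have pI: "1 < p \<or> I = {i0} \<and> 1 \<le> p" using p1 p i0(1) card_1_singletonE[of I] by auto
  have \<delta>0: "0 \<le> \<delta> i" if "i \<in> I" for i using \<delta>[OF that] by (simp add: growth_rate_def)
  have \<delta>'0: "0 \<le> \<delta>'" using \<delta>' by (simp add: growth_rate_def)
  show ?thesis
  proof (rule Lp_gap[where \<delta> = \<delta>, OF I i0(1) pI _ \<delta>'0 gap])
    show "0 \<le> \<delta> i" if "i \<in> I" for i by (rule \<delta>0[OF that])
    fix \<xi> \<beta> \<tau> assume \<xi>: "\<And>i. i \<in> I \<Longrightarrow> 0 \<le> \<xi> i"
      and \<xi>n: "\<And>v r. \<lbrakk>0 \<le> r; \<And>i. i \<in> I \<Longrightarrow> 0 \<le> v i; \<And>i. i \<in> I \<Longrightarrow> v i \<le> \<xi> i * r\<rbrakk> \<Longrightarrow> Lp_norm p I v \<le> r"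
      and \<beta>: "\<And>i. \<lbrakk>i \<in> I; i \<noteq> i0\<rbrakk> \<Longrightarrow> \<delta> i < \<beta> i" "\<delta>' < \<beta> i0" and \<tau>: "0 \<le> \<tau>"
      and \<tau>n: "\<And>v. (\<And>i. i \<in> I \<Longrightarrow> 0 \<le> v i) \<Longrightarrow> (\<Sum>i\<in>I. \<beta> i * v i) \<le> \<tau> * Lp_norm p I v"
      and lt: "\<tau> < (\<Sum>i\<in>I. \<delta> i * \<xi> i)"
    have "exp_lower (carrier P) plen (\<Sum>i\<in>I. \<delta> i * \<xi> i)"
      by (rule exp_lower_product[OF _ \<xi> \<xi>n]) (use \<delta> in \<open>auto simp: growth_rate_def\<close>)
    moreover have "exp_summable (carrier (P Mod N)) (coset_len plen) \<tau>"
    proof (rule exp_summable_quotient[OF N(1) i0(1) \<tau> _ _ \<tau>n])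
      show "exp_summable (carrier (G i)) (lens i) (\<beta> i)" if "i \<in> I" "i \<noteq> i0" for i
        using \<delta>[OF that(1)] \<beta>(1)[OF that] by (simp add: growth_rate_def)
      show "exp_summable (carrier (G i0 Mod {x \<in> carrier (G i0). emb i0 x \<in> N})) (coset_len (lens i0)) (\<beta> i0)"
        using \<delta>' \<beta>(2) unfolding growth_rate_def N0_def by blast
      show "0 \<le> \<beta> i0" using \<beta>(2) \<delta>'0 by simp
    qed
    ultimately show ?thesis by (rule that[OF lt \<tau>])
  qed
qed

text \<open>Killing a factor which does not have the largest growth exponent preserves the growth
  exponent of the \<open>L\<^sup>1\<close> product.\<close>

theorem product_no_growth_gap:
  assumes p1: "p = 1" and card: "1 < card I" and ne: "\<And>i. i \<in> I \<Longrightarrow> infinite (carrier (G i))"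
    and cg: "\<And>i. i \<in> I \<Longrightarrow> \<exists>D. length_group.coarsely_geodesic (G i) (lens i) D"
  obtains N \<delta> where "N \<lhd> P" "infinite N" "0 \<le> \<delta>" "exp_lower (carrier (P Mod N)) (coset_len plen) \<delta>"
    "\<And>\<alpha>. \<delta> < \<alpha> \<Longrightarrow> exp_summable (carrier P) plen \<alpha>"
proof -
  interpret P: group P by (rule group_P)
  have "\<forall>i\<in>I. \<exists>\<delta>. growth_rate (carrier (G i)) (lens i) \<delta>" using factor_growth_rate cg by blast
  from bchoice[OF this] obtain \<delta> where "\<forall>i\<in>I. growth_rate (carrier (G i)) (lens i) (\<delta> i)" ..
  then have \<delta>: "growth_rate (carrier (G i)) (lens i) (\<delta> i)" if "i \<in> I" for i using that by blast
  have Ine: "I \<noteq> {}" using card by auto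
  have "Max (\<delta> ` I) \<in> \<delta> ` I" using I Ine by simp
  \<comment> \<open>Factor \<open>k\<close> carries the exponent of the whole sum metric product;
    the factor \<open>j\<close> to be killed is any other one.\<close>
  then obtain k where "k \<in> I" "\<delta> k = Max (\<delta> ` I)" by auto
  then have k: "k \<in> I" "\<And>i. i \<in> I \<Longrightarrow> \<delta> i \<le> \<delta> k" using I by auto
  have "I \<noteq> {k}" using card by auto
  then obtain j where j: "j \<in> I" "j \<noteq> k" using k(1) by blast
  define N where "N = {x \<in> carrier P. \<forall>i\<in>I. i \<noteq> j \<longrightarrow> x i = \<one>\<^bsub>G i\<^esub>}"
  have one_N: "\<one>\<^bsub>P\<^esub> \<in> N" using P.one_closed by (simp add: N_def)
  have N: "N \<lhd> P"
    unfolding P.normal_inv_iff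
  proof (intro conjI ballI)
    show "subgroup N P"
    proof (rule P.subgroupI)
      show "N \<noteq> {}" using one_N by blast
      show "inv\<^bsub>P\<^esub> x \<in> N" if x: "x \<in> N" for x
      proof -
        have xP: "x \<in> carrier P" using x by (simp add: N_def)
        have "(inv\<^bsub>P\<^esub> x) i = \<one>\<^bsub>G i\<^esub>" if "i \<in> I" "i \<noteq> j" for i
          using xP x that group_factor by (simp add: N_def group.is_monoid monoid.inv_one)
        then show ?thesis using P.inv_closed[OF xP] by (simp add: N_def)
      qed
      show "x \<otimes>\<^bsub>P\<^esub> y \<in> N" if xy: "x \<in> N" "y \<in> N" for x y
      proof -
        have c: "x \<in> carrier P" "y \<in> carrier P" using xy by (auto simp: N_def)
        have "(x \<otimes>\<^bsub>P\<^esub> y) i = \<one>\<^bsub>G i\<^esub>" if "i \<in> I" "i \<noteq> j" for i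
          using xy that group_factor by (simp add: N_def group.is_monoid monoid.one_closed)
        then show ?thesis using P.m_closed[OF c] by (simp add: N_def)
      qed
    qed (auto simp: N_def)
    fix x y assume x: "x \<in> carrier P" and y: "y \<in> N"
    have yP: "y \<in> carrier P" using y by (simp add: N_def)
    have "(x \<otimes>\<^bsub>P\<^esub> y \<otimes>\<^bsub>P\<^esub> inv\<^bsub>P\<^esub> x) i = \<one>\<^bsub>G i\<^esub>" if "i \<in> I" "i \<noteq> j" for i
    proof -
      interpret Gi: group "G i" by (rule group_factor[OF that(1)])
      have "(inv\<^bsub>P\<^esub> x) i = inv\<^bsub>G i\<^esub> (x i)" using coord_inv[OF x that(1)] .
      then show ?thesis using y that coord_closed[OF x that(1)] by (simp add: N_def)
    qed
    then show "x \<otimes>\<^bsub>P\<^esub> y \<otimes>\<^bsub>P\<^esub> inv\<^bsub>P\<^esub> x \<in> N" using P.m_closed[OF P.m_closed[OF x yP] P.inv_closed[OF x]] by (simp add: N_def)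
  qed
  interpret N: normal N P by (rule N)
  have "inj_on (emb j) (carrier (G j))"
  proof (rule inj_onI)
    fix s t assume "emb j s = emb j t"
    then have "emb j s j = emb j t j" by simp
    then show "s = t" using j(1) by (simp add: emb_def)
  qed
  then have "infinite (emb j ` carrier (G j))" using ne[OF j(1)] by (simp add: finite_image_iff)
  moreover have "emb j ` carrier (G j) \<subseteq> N"
  proof (rule image_subsetI)
    fix t assume "t \<in> carrier (G j)"
    then show "emb j t \<in> N" unfolding N_def using emb_closed[OF j(1), of t] by (simp add: emb_def)
  qed
  ultimately have infN: "infinite N" using infinite_super by blast
  have embP: "emb k t \<in> carrier P" if "t \<in> carrier (G k)" for t using emb_closed[OF k(1) that] .
  have plen_emb: "plen (emb k t) = lens k t" if "t \<in> carrier (G k)" for t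
  proof -
    have "plen (emb k t) = (\<Sum>i\<in>I. lens i (emb k t i))"
      unfolding plen_def using Lp_norm_one[of I "\<lambda>i. lens i (emb k t i)"] lens_nonneg[OF embP[OF that]] p1 by simp
    also have "\<dots> = (\<Sum>i\<in>I. if i = k then lens k t else 0)"
      by (rule sum.cong) (auto simp: emb_def length_group.len_one[OF factor])
    finally show ?thesis using I k(1) by simp
  qed
  have low: "exp_lower (carrier (P Mod N)) (coset_len plen) (\<delta> k)"
  \<comment> \<open>Factor \<open>k\<close> survives in the quotient with its growth:
    \<open>N\<close> is trivial in coordinate \<open>k\<close>, and embedding the factor preserves
    lengths.\<close>
  proof (rule exp_lower_quotient[OF N])
    show "exp_lower (carrier (G k)) (lens k) (\<delta> k)" using \<delta>[OF k(1)] by (simp add: growth_rate_def)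
    show "inj_on (\<lambda>t. N #>\<^bsub>P\<^esub> emb k t) (carrier (G k))"
    proof (rule inj_onI)
      fix s t assume st: "s \<in> carrier (G k)" "t \<in> carrier (G k)" and e: "N #>\<^bsub>P\<^esub> emb k s = N #>\<^bsub>P\<^esub> emb k t"
      have "emb k s \<in> N #>\<^bsub>P\<^esub> emb k t" using P.rcos_self[OF embP[OF st(1)] N.subgroup_axioms] e by simp
      then obtain n where n: "n \<in> N" "emb k s = n \<otimes>\<^bsub>P\<^esub> emb k t" by (auto simp: r_coset_def)
      have "emb k s k = \<one>\<^bsub>G k\<^esub> \<otimes>\<^bsub>G k\<^esub> emb k t k" using n k(1) j(2) by (simp add: N_def)
      then show "s = t" using k(1) st group_factor[OF k(1)] by (simp add: emb_def group.is_monoid monoid.l_one)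
    qed
  qed (use embP plen_emb in auto)
  \<comment> \<open>For \<open>p = 1\<close> the norm is the sum of the coordinates, so a single
    exponent above the maximum of the \<delta> i serves all factors.\<close>
  have "exp_summable (carrier P) plen \<alpha>" if a: "\<delta> k < \<alpha>" for \<alpha>
  proof (rule exp_summable_prod[OF I, where T = "\<lambda>i. carrier (G i)" and l = lens and \<beta> = "\<lambda>_. \<alpha>" and \<Psi> = "\<lambda>x. x"])
    show "exp_summable (carrier (G i)) (lens i) \<alpha>" if "i \<in> I" for i
      using \<delta>[OF that] k(2)[OF that] a by (simp add: growth_rate_def)
    show "(\<Sum>i\<in>I. \<alpha> * lens i (s i)) \<le> \<alpha> * plen s" if "s \<in> carrier P" for s
      unfolding plen_def using Lp_norm_one[of I "\<lambda>i. lens i (s i)"] lens_nonneg[OF that] p1 by (simp add: sum_distrib_left)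
  qed auto
  moreover have "0 \<le> \<delta> k" using \<delta>[OF k(1)] by (simp add: growth_rate_def)
  ultimately show ?thesis using that N infN low by blast
qed

end

section \<open>Growth tightness of the product action\<close>

theorem theorem1p2:
  fixes n :: nat
    and G :: "nat \<Rightarrow> 'g monoid"
    and X :: "nat \<Rightarrow> 'x set"
    and d :: "nat \<Rightarrow> 'x \<Rightarrow> 'x \<Rightarrow> real"
    and bp :: "nat \<Rightarrow> 'x"
    and \<phi> :: "nat \<Rightarrow> 'g \<Rightarrow> 'x \<Rightarrow> 'x"
    and p :: ereal
  assumes "n \<ge> 1" and "1 \<le> p"
    and "\<And>i. i \<in> {1..n} \<Longrightarrow> finitely_generated_group (G i)"
    and "\<And>i. i \<in> {1..n} \<Longrightarrow> \<not> elementary_group (G i)"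
    and "\<And>i. i \<in> {1..n} \<Longrightarrow> proper_metric_space (X i) (d i)"
    and "\<And>i. i \<in> {1..n} \<Longrightarrow> geodesic_metric_space (X i) (d i)"
    and "\<And>i. i \<in> {1..n} \<Longrightarrow> bp i \<in> X i"
    and "\<And>i. i \<in> {1..n} \<Longrightarrow> isometric_action (G i) (X i) (d i) (\<phi> i)"
    and "\<And>i. i \<in> {1..n} \<Longrightarrow> properly_discontinuous (G i) (X i) (d i) (\<phi> i)"
    and "\<And>i. i \<in> {1..n} \<Longrightarrow> cocompact (G i) (X i) (d i) (\<phi> i)"
    and "\<And>i. i \<in> {1..n} \<Longrightarrow> \<exists>h. strongly_contracting (G i) (X i) (d i) (\<phi> i) (bp i) h"
  shows "(p > 1 \<or> n = 1 \<longrightarrow>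
            growth_tight (product_group {1..n} G) (Lp_metric p {1..n} d)
              (coordinatewise_action {1..n} X \<phi>) (\<lambda>i\<in>{1..n}. bp i)) \<and>
         (p = 1 \<and> n > 1 \<longrightarrow>
            \<not> growth_tight (product_group {1..n} G) (Lp_metric p {1..n} d)
              (coordinatewise_action {1..n} X \<phi>) (\<lambda>i\<in>{1..n}. bp i))"
proof -
  let ?I = "{1..n}"
  let ?lens = "\<lambda>i g. d i (bp i) (\<phi> i g (bp i))"
  let ?P = "product_group ?I G" and ?d = "Lp_metric p ?I d" and ?act = "coordinatewise_action ?I X \<phi>" and ?bp = "\<lambda>i\<in>?I. bp i"
  note orb = orbit_length_group[OF assms(8,5,9,7)]
  interpret F: length_group_family ?I G ?lens p
  proof (rule length_group_family.intro)
    show "length_group (G i) (?lens i)" if "i \<in> ?I" for i by (rule orb(1)[OF that that that that])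
  qed (use assms(2) in auto)
  have cg: "\<exists>D. length_group.coarsely_geodesic (G i) (?lens i) D" if "i \<in> ?I" for i
    using orbit_coarsely_geodesic[OF assms(8,5,6,9,10,7)] that by blast
  obtain h where "\<And>i. i \<in> ?I \<Longrightarrow> strongly_contracting (G i) (X i) (d i) (\<phi> i) (bp i) (h i)"
    using assms(11) by metis
  then have h: "h i \<in> carrier (G i)" "inj (\<lambda>k::int. h i [^]\<^bsub>G i\<^esub> k)"
      "\<exists>C\<ge>0. length_group.contracting (G i) (?lens i) C (length_group.cyc (G i) (h i))" if "i \<in> ?I" for i
    using strongly_contracting_imp_contracting[OF assms(8,5,6,9,7)] that by blast+
  \<comment> \<open>\<open>coordinatewise_action\<close> is restricted to the product set, so
    evaluating it uses that every \<open>bp i\<close> lies in \<open>X i\<close>.\<close>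
  have act: "?act g ?bp = (\<lambda>i\<in>?I. \<phi> i (g i) (bp i))" for g
    using assms(7) by (auto simp: coordinatewise_action_def fun_eq_iff)
  have dist: "?d (?act a ?bp) (?act b ?bp) = F.plen (inv\<^bsub>?P\<^esub> a \<otimes>\<^bsub>?P\<^esub> b)" if "a \<in> carrier ?P" "b \<in> carrier ?P" for a b
    unfolding act Lp_metric_eq_norm F.plen_def
  proof (rule Lp_norm_cong)
    fix i assume i: "i \<in> ?I"
    have "(inv\<^bsub>?P\<^esub> a \<otimes>\<^bsub>?P\<^esub> b) i = inv\<^bsub>G i\<^esub> (a i) \<otimes>\<^bsub>G i\<^esub> b i" by (simp only: F.coord_mult[OF i] F.coord_inv[OF that(1) i])
    then show "d i ((\<lambda>i\<in>?I. \<phi> i (a i) (bp i)) i) ((\<lambda>i\<in>?I. \<phi> i (b i) (bp i)) i) = ?lens i ((inv\<^bsub>?P\<^esub> a \<otimes>\<^bsub>?P\<^esub> b) i)"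
      using orb(3)[OF i i i i F.coord_closed[OF that(1) i] F.coord_closed[OF that(2) i]] i by simp
  qed
  have fin: "finite {A \<in> carrier (?P Mod N). coset_len F.plen A \<le> r}" if "N \<lhd> ?P" for N r
    by (rule normal.finite_coset_ball[OF that F.finite_plen_ball])
  have qd: "quotient_dist ?d ?act ?bp N A = coset_len F.plen A" if "N \<lhd> ?P" "A \<in> carrier (?P Mod N)" for N A
    by (rule normal.quotient_dist_eq_coset_len[where d = ?d and \<phi> = ?act and bp = ?bp, OF that(1) dist that(2)])
  have upper: "quotient_growth ?P ?d ?act ?bp N \<le> ereal \<alpha>"
    if N: "N \<lhd> ?P" and "exp_summable (carrier (?P Mod N)) (coset_len F.plen) \<alpha>" "0 \<le> \<alpha>" for N \<alpha>
    unfolding quotient_growth_def by (rule growth_exponent_le[OF that(2,3)]) (rule fin[OF N], rule qd[OF N])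
  have lower: "ereal \<sigma> \<le> quotient_growth ?P ?d ?act ?bp N"
    if N: "N \<lhd> ?P" and "exp_lower (carrier (?P Mod N)) (coset_len F.plen) \<sigma>" for N \<sigma>
    unfolding quotient_growth_def by (rule growth_exponent_ge[OF that(2)]) (rule fin[OF N], rule qd[OF N])
  interpret P: group ?P by (rule F.group_P)
  have one: "{\<one>\<^bsub>?P\<^esub>} \<lhd> ?P" by (rule P.one_is_normal)
  have "growth_tight ?P ?d ?act ?bp" if "p > 1 \<or> n = 1"
    unfolding growth_tight_def
  proof (intro allI impI, elim conjE)
    fix N assume N: "N \<lhd> ?P" "infinite N"
    have "1 < p \<or> card ?I = 1" using that by auto
    then obtain \<sigma> \<tau> where st: "\<tau> < \<sigma>" "0 \<le> \<tau>" "exp_lower (carrier ?P) F.plen \<sigma>"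
      "exp_summable (carrier (?P Mod N)) (coset_len F.plen) \<tau>"
      using F.product_growth_gap[OF _ h assms(4) cg N] by blast
    have "exp_lower (carrier (?P Mod {\<one>\<^bsub>?P\<^esub>})) (coset_len F.plen) \<sigma>"
      by (rule F.exp_lower_quotient[OF one st(3) _ F.inj_on_singleton_cosets]) auto
    then have "ereal \<sigma> \<le> quotient_growth ?P ?d ?act ?bp {\<one>\<^bsub>?P\<^esub>}" by (rule lower[OF one])
    moreover have "quotient_growth ?P ?d ?act ?bp N \<le> ereal \<tau>" by (rule upper[OF N(1) st(4,2)])
    ultimately show "quotient_growth ?P ?d ?act ?bp N < quotient_growth ?P ?d ?act ?bp {\<one>\<^bsub>?P\<^esub>}"
      using st(1) by (meson le_less_trans less_ereal.simps(1) less_le_trans)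
  qed
  moreover have "\<not> growth_tight ?P ?d ?act ?bp" if pn: "p = 1 \<and> n > 1"
  proof
    assume gt: "growth_tight ?P ?d ?act ?bp"
    have "infinite (carrier (G i))" if "i \<in> ?I" for i using assms(4)[OF that] by (auto simp: elementary_group_def)
    then obtain N \<delta> where N: "N \<lhd> ?P" "infinite N" "0 \<le> \<delta>" "exp_lower (carrier (?P Mod N)) (coset_len F.plen) \<delta>"
      "\<And>\<alpha>. \<delta> < \<alpha> \<Longrightarrow> exp_summable (carrier ?P) F.plen \<alpha>"
      using F.product_no_growth_gap[OF _ _ _ cg] pn by auto
    have le: "quotient_growth ?P ?d ?act ?bp {\<one>\<^bsub>?P\<^esub>} \<le> ereal \<alpha>" if a: "\<delta> < \<alpha>" for \<alpha>
    proof (rule upper[OF one])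
      show "exp_summable (carrier (?P Mod {\<one>\<^bsub>?P\<^esub>})) (coset_len F.plen) \<alpha>"
        by (rule F.exp_summable_trivial_quotient[OF N(5)[OF a]])
    qed (use a N(3) in simp)
    \<comment> \<open>Convergence is available only strictly above \<delta>, so the bound at
      \<delta> itself is reached as a limit.\<close>
    have "quotient_growth ?P ?d ?act ?bp {\<one>\<^bsub>?P\<^esub>} \<le> ereal \<delta>"
    proof (rule ereal_le_epsilon2)
      show "quotient_growth ?P ?d ?act ?bp {\<one>\<^bsub>?P\<^esub>} \<le> ereal \<delta> + ereal e" if "0 < e" for e :: real
        using le[of "\<delta> + e"] that by simp
    qed
    also have "\<dots> \<le> quotient_growth ?P ?d ?act ?bp N" by (rule lower[OF N(1,4)])
    finally show False using gt N(1,2) unfolding growth_tight_def by (meson leD)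
  qed
  ultimately show ?thesis by blast
qed

end
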